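(* Let $d\ge 2$, $p\in(d,+\infty)$, $q\in(d,+\infty]$, let $\theta_c\in[0,1)$ be given by $\frac{1}{\theta_c} = 1 + \frac{dp+2p}{dp+2d}\left(\frac{q}{d}-1\right)$ (with $\theta_c=0$ if $q=+\infty$), let $\theta\in[\theta_c,1]$, and let $$\alpha = (1-\theta)\frac{d}{d+2} + \theta\frac{p}{p+2}, \qquad \beta = (1-\theta)\frac{2}{d+2}, \qquad \gamma = \theta\frac{2}{p+2},$$ with $\theta$ such that $\alpha,\beta,\gamma\in(0,1)$. Then there exists $C<\infty$ (depending only on $d,p,q,\theta$) such that for every $w:\mathbb{B}\to[0,\infty)$ and every static environment $a:\mathbb{B}\to[0,1]$ that is $w$-moderate, for every $t\ge1$, $$p_t(0,0)\le C\,\frac{\mathcal{M}_q(w)^{2\alpha/\beta}}{t^{d/2}}.$$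
   Context: $\mathbb{B}$ is the set of unoriented nearest-neighbour edges of $\mathbb{Z}^d$. For a positive integer $r$, $B_r=\{-r,\dots,r\}^d$ and $\mathbb{B}_r$ is the set of edges with both endpoints in $B_r$. For $w:\mathbb{B}\to[0,\infty)$, $\mathcal{M}_q(w) = \left(\sup_{r\ge1}\frac{1}{|\mathbb{B}_r|}\sum_{e\in\mathbb{B}_r}w(e)^{-q}\right)^{1/q}$ for $q<\infty$ and $\mathcal{M}_\infty(w)=\sup_{e}w(e)^{-1}$, with $0^{-1}=+\infty$ (the bound is trivial if $\mathcal{M}_q(w)=+\infty$). For $f:\mathbb{Z}^d\to\mathbb{R}$ and $e=\{x,y\}\in\mathbb B$, $|\nabla f(e)|=|f(x)-f(y)|$. $\|\cdot\|_2$ is the $\ell^2$ norm over $\mathbb{Z}^d$ or $\mathbb{B}$. A static environment is a function $a:\mathbb{B}\to[0,1]$. For it, $p_t(x,\cdot)$, $t\ge0$, is the unique bounded function with $p_0(x,y)=\mathbf{1}_{x=y}$ and $\partial_t p_t(x,y)=\sum_{z\sim y}a(\{y,z\})\,(p_t(x,z)-p_t(x,y))$, the sum running over nearest neighbours $z$ of $y$. Write $u_t=p_t(0,\cdot)$ and $\mathcal{D}_t=\|\sqrt{a}\,\nabla u_t\|_2^2$. The environment $a$ is called $w$-moderate if $\|w\,\nabla u_t\|_2^2\le\mathcal{D}_t$ for every $t\ge0$. *)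

theory Defs
  imports "HOL-Analysis.Analysis"
begin

text \<open>The lattice \<open>\<int>\<^sup>d\<close> is the type \<open>int ^ 'd\<close>, with \<open>d = CARD('d)\<close>; an unoriented edge is a
  two-element set of vertices.\<close>

type_synonym 'd edge = "(int ^ 'd) set"

definition adjacent :: "int ^ 'd::finite \<Rightarrow> int ^ 'd \<Rightarrow> bool" where
  "adjacent x y \<longleftrightarrow> (\<Sum>i\<in>UNIV. \<bar>x $ i - y $ i\<bar>) = 1"

definition edges :: "('d::finite) edge set" where
  "edges = {{x, y} | x y. adjacent x y}"

definition vbox :: "nat \<Rightarrow> (int ^ 'd::finite) set" where
  "vbox r = {x. \<forall>i. - int r \<le> x $ i \<and> x $ i \<le> int r}"

definition box_edges :: "nat \<Rightarrow> ('d::finite) edge set" where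
  "box_edges r = {e \<in> edges. e \<subseteq> vbox r}"

text \<open>Powers \<open>x\<^sup>s\<close> of \<open>x \<in> [0, \<infinity>]\<close>, intended for exponents \<open>s > 0\<close> only. For negative powers of
  a real number \<open>c \<ge> 0\<close> we write \<open>epowr (inverse (ennreal c)) s\<close>, where \<open>inverse 0 = \<infinity>\<close>.\<close>

definition epowr :: "ennreal \<Rightarrow> real \<Rightarrow> ennreal" where
  "epowr x s = (if x = \<infinity> then \<infinity> else ennreal (enn2real x powr s))"

definition moment :: "ereal \<Rightarrow> (('d::finite) edge \<Rightarrow> real) \<Rightarrow> ennreal" where
  "moment q w =
    (if q = \<infinity> then (SUP e\<in>edges. inverse (ennreal (w e)))
     else epowr
       (SUP r\<in>{1..}. (\<Sum>e\<in>box_edges r. epowr (inverse (ennreal (w e))) (real_of_ereal q))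
                        / of_nat (card (box_edges r :: 'd edge set)))
       (1 / real_of_ereal q))"

text \<open>The value does not depend on the order of the endpoints, so that the description below is
  proper on every edge.\<close>

definition grad_abs :: "(int ^ 'd::finite \<Rightarrow> real) \<Rightarrow> 'd edge \<Rightarrow> real" where
  "grad_abs f e = (THE c. \<exists>x y. e = {x, y} \<and> c = \<bar>f x - f y\<bar>)"

lemma grad_abs_pair [simp]: "grad_abs f {x, y} = \<bar>f x - f y\<bar>"
  unfolding grad_abs_def by (rule the_equality) (auto simp: doubleton_eq_iff)

text \<open>The \<open>\<ell>\<^sup>2\<close> norm over an index set, with value \<open>\<infinity>\<close> if the function is not square summable.\<close>

definition l2norm :: "'i set \<Rightarrow> ('i \<Rightarrow> real) \<Rightarrow> ennreal" where
  "l2norm I F = epowr (\<Sum>\<^sub>\<infinity>i\<in>I. ennreal ((F i)\<^sup>2)) (1/2)"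

definition static_environment :: "(('d::finite) edge \<Rightarrow> real) \<Rightarrow> bool" where
  "static_environment a \<longleftrightarrow> (\<forall>e\<in>edges. 0 \<le> a e \<and> a e \<le> 1)"

text \<open>\<open>is_heat_kernel a x u\<close>: \<open>u t y\<close> is the bounded solution started from \<open>x\<close>. Time is restricted to
  \<open>t \<ge> 0\<close> (one-sided derivative at \<open>0\<close>); setting \<open>u t = 0\<close> for \<open>t < 0\<close> is only a convention that
  makes the solution unique as a function on all of \<open>\<real>\<close>.\<close>

definition is_heat_kernel ::
  "(('d::finite) edge \<Rightarrow> real) \<Rightarrow> int ^ 'd \<Rightarrow> (real \<Rightarrow> int ^ 'd \<Rightarrow> real) \<Rightarrow> bool" where
  "is_heat_kernel a x u \<longleftrightarrow>
     (\<forall>y. u 0 y = (if x = y then 1 else 0)) \<and>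
     (\<forall>t\<ge>0. \<forall>y. ((\<lambda>s. u s y) has_real_derivative
                   (\<Sum>z\<in>{z. adjacent z y}. a {y, z} * (u t z - u t y))) (at t within {0..})) \<and>
     (\<exists>K. \<forall>t\<ge>0. \<forall>y. \<bar>u t y\<bar> \<le> K) \<and>
     (\<forall>t<0. \<forall>y. u t y = 0)"

definition heat_kernel ::
  "(('d::finite) edge \<Rightarrow> real) \<Rightarrow> real \<Rightarrow> int ^ 'd \<Rightarrow> int ^ 'd \<Rightarrow> real" where
  "heat_kernel a t x y = (THE u. is_heat_kernel a x u) t y"

definition dirichlet_energy :: "(('d::finite) edge \<Rightarrow> real) \<Rightarrow> real \<Rightarrow> ennreal" where
  "dirichlet_energy a t =
     (l2norm edges (\<lambda>e. sqrt (a e) * grad_abs (heat_kernel a t 0) e))\<^sup>2"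

definition moderate :: "(('d::finite) edge \<Rightarrow> real) \<Rightarrow> ('d edge \<Rightarrow> real) \<Rightarrow> bool" where
  "moderate w a \<longleftrightarrow>
     (\<forall>t\<ge>0. (l2norm edges (\<lambda>e. w e * grad_abs (heat_kernel a t 0) e))\<^sup>2 \<le> dirichlet_energy a t)"

definition theta_crit :: "nat \<Rightarrow> real \<Rightarrow> ereal \<Rightarrow> real" where
  "theta_crit d p q =
     (if q = \<infinity> then 0
      else 1 / (1 + (real d * p + 2 * p) / (real d * p + 2 * real d)
                     * (real_of_ereal q / real d - 1)))"

end

theory Submission
  imports Defs
begin

text \<open>The case of general \<open>\<theta>\<close> reduces to the critical one: there is \<open>q' \<in> (d, q]\<close> for which \<open>\<theta>\<close> is critical, moments are monotone in \<open>q\<close>,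
  and then \<open>2 \<alpha> / \<beta> = d / \<delta>\<close> with \<open>\<delta> = 1 - d / q'\<close>, so that \<open>p\<close> disappears.

  Comparing averages over boxes of side \<open>2\<^sup>j\<close> and \<open>2\<^sup>j\<^sup>+\<^sup>1\<close> and summing the resulting geometric series gives,
  for \<open>1 \<le> \<rho> \<le> R\<close>, the local Nash inequality
  \<open>\<parallel>f\<parallel>\<^sup>2 \<le> K (m\<^sup>2 \<rho>\<^bsup>2\<delta>\<^esup> R\<^bsup>2-2\<delta>\<^esup> \<parallel>w \<nabla>f\<parallel>\<^sup>2 + \<rho>\<^bsup>-d\<^esup> \<parallel>f\<parallel>\<^sub>1\<^sup>2)\<close> on the ball of radius \<open>R\<close>. Outside of that ball the energy
  \<open>E\<close> of the heat kernel is at most \<open>R\<^bsup>-2d\<^esup> N\<close>, where \<open>N = \<Sum> (1 + |x|)\<^bsup>2d\<^esup> u\<^sup>2\<close>. Let \<open>\<Lambda>\<close> be the maximum of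
  \<open>t\<^bsup>d/2\<^esup> E\<close> up to the time \<open>T\<close>. Integration by parts gives \<open>N \<le> C \<Lambda> T\<^bsup>d/2\<^esup>\<close>; inserting this with
  optimal \<open>\<rho>\<close> and \<open>R\<close> into \<open>E' = - 2 D\<close> yields \<open>\<Lambda>\<^bsup>2\<delta>/d\<^esup> \<le> C m\<^sup>2\<close>. Finally \<open>p\<^sub>t(0, 0)\<close> is the energy at
  time \<open>t / 2\<close>.\<close>

section \<open>Edges and boxes of the lattice\<close>

text \<open>The moment controls \<open>w\<close> only through boxes centred at the origin, so a
  small cube at distance R may contain the worst edges of the whole box of radius R. Estimating by
  that box costs the factor in R; this makes the inequality local and calls for separate control of
  the mass far away, which rests on the upper bound \<open>a\<close> \<le> 1. The exponent 2 d of
  the weight is a choice: for (1 + |x|)^k, integrating the growth of N requires s^(- d / k) to be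
  integrable at 0, that is k > d, and k = 2 d leaves s^(- 1 / 2). Bounding N through \<Lambda> is
  circular, since \<Lambda> is what has to be estimated. The circle closes because N enters with the
  power (1 - \<delta>) / d, smaller than the power (1 + \<delta>) / d of E, while all powers of T
  cancel. The definitions characterise the heat kernel only by its equation. Its decay in space, its
  mass and its symmetric pairing are obtained from an explicit construction, which uniqueness of
  bounded solutions then identifies with it.\<close>

lemma adjacent_iff:
  fixes x y :: "int ^ 'd::finite"
  shows "adjacent x y \<longleftrightarrow> (\<exists>i. y = x + axis i 1 \<or> y = x - axis i 1)"
proof
  assume "adjacent x y"
  then have s: "(\<Sum>i\<in>UNIV. \<bar>x $ i - y $ i\<bar>) = 1" by (simp add: adjacent_def)
  then obtain i where i: "x $ i \<noteq> y $ i" by (metis (mono_tags, lifting) abs_zero cancel_comm_monoid_add_class.diff_cancel sum.neutral zero_neq_one)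
  have "\<bar>x $ i - y $ i\<bar> + (\<Sum>j\<in>UNIV-{i}. \<bar>x $ j - y $ j\<bar>) = 1"
    using s by (simp add: sum.remove[of UNIV i])
  moreover have "\<bar>x $ i - y $ i\<bar> \<ge> 1" using i by linarith
  moreover have nn: "(\<Sum>j\<in>UNIV-{i}. \<bar>x $ j - y $ j\<bar>) \<ge> 0" by (simp add: sum_nonneg)
  ultimately have 1: "\<bar>x $ i - y $ i\<bar> = 1" and 0: "(\<Sum>j\<in>UNIV-{i}. \<bar>x $ j - y $ j\<bar>) = 0" by linarith+
  from 0 have "\<forall>j\<in>UNIV-{i}. \<bar>x $ j - y $ j\<bar> = 0" by (subst (asm) sum_nonneg_eq_0_iff) auto
  then have j: "\<And>j. j \<noteq> i \<Longrightarrow> x $ j = y $ j" by auto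
  from 1 consider "y $ i = x $ i + 1" | "y $ i = x $ i - 1" by linarith
  then show "\<exists>i. y = x + axis i 1 \<or> y = x - axis i 1"
  proof cases
    case 1
    then have "y = x + axis i 1" using j by (auto simp: vec_eq_iff axis_def)
    then show ?thesis by blast
  next
    case 2
    then have "y = x - axis i 1" using j by (auto simp: vec_eq_iff axis_def)
    then show ?thesis by blast
  qed
next
  have *: "(\<Sum>j\<in>UNIV. \<bar>axis i (1::int) $ j\<bar>) = 1" for i :: 'd
    by (simp add: axis_def if_distrib cong: if_cong)
  assume "\<exists>i. y = x + axis i 1 \<or> y = x - axis i 1"
  then show "adjacent x y" using * by (auto simp: adjacent_def)
qed

lemma sum_adjacent:
  fixes y :: "int ^ 'd::finite" and g :: "int ^ 'd \<Rightarrow> 'a::comm_monoid_add"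
  shows "(\<Sum>z\<in>{z. adjacent z y}. g z) = (\<Sum>i\<in>UNIV. g (y + axis i 1) + g (y - axis i 1))"
proof -
  have eq: "{z. adjacent z y} = range (\<lambda>i. y + axis i 1) \<union> range (\<lambda>i. y - axis i 1)"
    by (force simp: adjacent_iff)
  have i1: "inj (\<lambda>i. y + axis i 1)" "inj (\<lambda>i. y - axis i 1)"
    by (auto simp: inj_on_def axis_eq_axis)
  have "y + axis i 1 \<noteq> y - axis j 1" for i j
  proof
    assume "y + axis i 1 = y - axis j 1"
    then have "(y + axis i 1) $ i = (y - axis j 1) $ i" by simp
    then show False by (auto simp: axis_def split: if_splits)
  qed
  then have "(\<Sum>z\<in>{z. adjacent z y}. g z) = sum g (range (\<lambda>i. y + axis i 1)) + sum g (range (\<lambda>i. y - axis i 1))"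
    unfolding eq by (intro sum.union_disjoint) auto
  also have "\<dots> = (\<Sum>i\<in>UNIV. g (y + axis i 1)) + (\<Sum>i\<in>UNIV. g (y - axis i 1))"
    by (simp add: sum.reindex[OF i1(1)] sum.reindex[OF i1(2)])
  finally show ?thesis by (simp add: sum.distrib)
qed

text \<open>Every unoriented edge has exactly one such form, given by its lower endpoint and its
  direction. Sums over edges become sums over vertices and directions, on which translations
  act.\<close>

definition edge_at :: "int ^ 'd::finite \<Rightarrow> 'd \<Rightarrow> 'd edge" where
  "edge_at y i = {y, y + axis i 1}"

lemma grad_abs_edge_at: "grad_abs f (edge_at y i) = \<bar>f (y + axis i 1) - f y\<bar>"
  by (simp add: edge_at_def abs_minus_commute)

lemma edge_at_inject: "edge_at y i = edge_at z j \<longleftrightarrow> y = z \<and> i = j"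
proof
  assume "edge_at y i = edge_at z j"
  then consider "y = z" "y + axis i 1 = z + axis j 1" | "y = z + axis j 1" "y + axis i 1 = z"
    unfolding edge_at_def by (auto simp: doubleton_eq_iff)
  then show "y = z \<and> i = j"
  proof cases
    case 2
    then have "axis j (1::int) + axis i 1 = 0" by (metis add.assoc add_cancel_left_right)
    then have "(axis j (1::int) + axis i 1) $ i = 0" by simp
    then show ?thesis by (auto simp: axis_def split: if_splits)
  qed (auto simp: axis_eq_axis)
qed auto

lemma bij_betw_edge_at: "bij_betw (\<lambda>(y, i). edge_at y i) UNIV (edges :: 'd::finite edge set)"
  unfolding bij_betw_def
proof
  show "inj (\<lambda>(y, i). edge_at y i)" by (auto simp: inj_on_def edge_at_inject)
  have "edge_at y i \<in> edges" for y i
    unfolding edges_def edge_at_def using adjacent_iff by blast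
  moreover have "e \<in> range (\<lambda>(y, i). edge_at y i)" if "e \<in> edges" for e :: "'d edge"
  proof -
    from that obtain x y where e: "e = {x, y}" and xy: "adjacent x y" unfolding edges_def by auto
    from xy obtain i where "y = x + axis i 1 \<or> y = x - axis i 1" unfolding adjacent_iff by auto
    then have "e = edge_at x i \<or> e = edge_at y i" unfolding e edge_at_def by auto
    then show ?thesis by auto
  qed
  ultimately show "range (\<lambda>(y, i). edge_at y i) = (edges :: 'd edge set)" by auto
qed

lemma edge_at_in_edges [simp]: "edge_at y i \<in> edges"
  using bij_betw_edge_at by (auto simp: bij_betw_def)

lemma edgesE:
  assumes "e \<in> edges" obtains y i where "e = edge_at y i"
  using assms bij_betw_edge_at unfolding bij_betw_def by (metis (no_types, lifting) case_prod_unfold imageE)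

text \<open>Half-open, so that doubling one side yields exactly two disjoint translates. The sides
  may differ because a cube is doubled one direction at a time.\<close>

definition cuboid :: "('d \<Rightarrow> int) \<Rightarrow> (int ^ 'd::finite) set" where
  "cuboid s = {h. \<forall>i. 0 \<le> h $ i \<and> h $ i < s i}"

lemma cuboid_eq_image: "cuboid s = vec_lambda ` (PiE UNIV (\<lambda>i. {0..<s i}))"
proof -
  have "h \<in> vec_lambda ` (PiE UNIV (\<lambda>i. {0..<s i}))" if "h \<in> cuboid s" for h
    using that by (intro image_eqI[of _ _ "vec_nth h"]) (auto simp: cuboid_def)
  then show ?thesis by (auto simp: cuboid_def)
qed

lemma finite_cuboid [simp]: "finite (cuboid s)"
  unfolding cuboid_eq_image by (intro finite_imageI finite_PiE) auto

lemma card_cuboid: "card (cuboid s) = (\<Prod>i\<in>UNIV. nat (s i))"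
proof -
  have "inj_on vec_lambda (PiE UNIV (\<lambda>i. {0..<s i}))" by (simp add: inj_on_def)
  then show ?thesis unfolding cuboid_eq_image by (subst card_image) (auto simp: card_PiE)
qed

lemma vbox_eq_image: "vbox r = (\<lambda>h. h - (\<chi> i. int r)) ` cuboid (\<lambda>_. 2 * int r + 1)"
proof (intro set_eqI iffI)
  fix x :: "int ^ 'd::finite" assume x: "x \<in> vbox r"
  have "0 \<le> x $ i + int r \<and> x $ i + int r < 2 * int r + 1" for i
    using x[unfolded vbox_def mem_Collect_eq, rule_format, of i] by linarith
  then show "x \<in> (\<lambda>h. h - (\<chi> i. int r)) ` cuboid (\<lambda>_. 2 * int r + 1)"
    by (intro image_eqI[of _ _ "x + (\<chi> i. int r)"]) (auto simp: cuboid_def)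
next
  fix x :: "int ^ 'd::finite" assume "x \<in> (\<lambda>h. h - (\<chi> i. int r)) ` cuboid (\<lambda>_. 2 * int r + 1)"
  then obtain h where x: "x = h - (\<chi> i. int r)" and h: "h \<in> cuboid (\<lambda>_. 2 * int r + 1)" by auto
  have "- int r \<le> h $ i - int r \<and> h $ i - int r \<le> int r" for i
    using h[unfolded cuboid_def mem_Collect_eq, rule_format, of i] by linarith
  then show "x \<in> vbox r" by (auto simp: vbox_def x)
qed

lemma finite_vbox [simp]: "finite (vbox r)"
  unfolding vbox_eq_image by simp

lemma card_vbox: "card (vbox r :: (int ^ 'd::finite) set) = (2 * r + 1) ^ CARD('d)"
proof -
  have "nat (2 * int r + 1) = 2 * r + 1" by simp
  then show ?thesis
    unfolding vbox_eq_image by (subst card_image) (auto simp: inj_on_def card_cuboid)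
qed

lemma box_edges_eq: "box_edges r = (\<lambda>(y, i). edge_at y i) ` {(y, i). y \<in> vbox r \<and> y + axis i 1 \<in> vbox r}"
proof (intro equalityI subsetI)
  fix e assume e: "e \<in> box_edges r"
  then obtain y i where y: "e = edge_at y i" unfolding box_edges_def using edgesE by blast
  with e have "y \<in> vbox r" "y + axis i 1 \<in> vbox r" by (simp_all add: box_edges_def edge_at_def)
  with y show "e \<in> (\<lambda>(y, i). edge_at y i) ` {(y, i). y \<in> vbox r \<and> y + axis i 1 \<in> vbox r}"
    by (intro image_eqI[of _ _ "(y, i)"]) simp_all
next
  fix e assume "e \<in> (\<lambda>(y, i). edge_at y i) ` {(y, i). y \<in> vbox r \<and> y + axis i 1 \<in> vbox r}"
  then obtain y i where y: "e = edge_at y i" "y \<in> vbox r" "y + axis i 1 \<in> vbox r" by auto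
  have "edge_at y i \<in> edges" by simp
  with y show "e \<in> box_edges r" unfolding box_edges_def edge_at_def by simp
qed

lemma finite_box_edges [simp]: "finite (box_edges r)"
proof -
  have "{(y, i). y \<in> vbox r \<and> y + axis i 1 \<in> vbox r} \<subseteq> vbox r \<times> UNIV" by blast
  then have "finite {(y, i). y \<in> vbox r \<and> y + axis i 1 \<in> vbox r}" by (rule finite_subset) simp
  then show ?thesis unfolding box_edges_eq by (rule finite_imageI)
qed

lemma card_box_edges_le:
  "card (box_edges r :: 'd::finite edge set) \<le> CARD('d) * (2 * r + 1) ^ CARD('d)"
proof -
  let ?A = "{(y, i :: 'd). y \<in> vbox r \<and> y + axis i 1 \<in> vbox r}"
  have A: "?A \<subseteq> vbox r \<times> UNIV" by blast
  then have "finite ?A" by (rule finite_subset) simp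
  then have "card (box_edges r :: 'd edge set) \<le> card ?A"
    unfolding box_edges_eq by (rule card_image_le)
  also have "\<dots> \<le> card ((vbox r :: (int ^ 'd) set) \<times> (UNIV :: 'd set))" by (rule card_mono[OF _ A]) auto
  finally have "card (box_edges r :: 'd edge set) \<le> card ((vbox r :: (int ^ 'd) set) \<times> (UNIV :: 'd set))" .
  then show ?thesis by (simp add: card_cartesian_product card_vbox mult.commute)
qed

text \<open>Jensen's inequality for the concave function x powr (s / q). Young's inequality gives
  its tangent line at the mean \<open>a\<close> of the numbers \<open>v x powr q\<close>; summing
  that bound over \<open>A\<close> gives the claim.\<close>

lemma power_mean:
  fixes v :: "'a \<Rightarrow> real"
  assumes "finite A" and v: "\<And>x. x \<in> A \<Longrightarrow> 0 \<le> v x" and "0 < s" "s \<le> q"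
  shows "(\<Sum>x\<in>A. v x powr s) \<le> real (card A) powr (1 - s / q) * (\<Sum>x\<in>A. v x powr q) powr (s / q)"
proof (cases "(\<Sum>x\<in>A. v x powr q) = 0")
  case True
  then have "\<forall>x\<in>A. v x powr q = 0" using assms by (subst (asm) sum_nonneg_eq_0_iff) auto
  then have "\<forall>x\<in>A. v x = 0" by auto
  then show ?thesis by simp
next
  case False
  define S where "S = (\<Sum>x\<in>A. v x powr q)"
  have S: "S > 0" using False unfolding S_def by (simp add: order_less_le sum_nonneg)
  have n: "card A > 0" using False \<open>finite A\<close> by (cases "A = {}") (auto simp: card_gt_0_iff)
  define a where "a = S / card A"
  have a: "a > 0" using S n by (simp add: a_def)
  have pt: "v x powr s \<le> (s / q * v x powr q + (1 - s / q) * a) * a powr (s / q - 1)" if "x \<in> A" for x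
  proof (cases "v x = 0")
    case True
    then show ?thesis using assms a by simp
  next
    case False
    then have vx: "v x > 0" using v[OF that] by simp
    have "(v x powr q) powr (s / q) * a powr (1 - s / q) \<le> s / q * v x powr q + (1 - s / q) * a"
      using assms a vx by (intro Youngs_inequality_0) auto
    then have "(v x powr q) powr (s / q) * a powr (1 - s / q) * a powr (s / q - 1) \<le> (s / q * v x powr q + (1 - s / q) * a) * a powr (s / q - 1)"
      by (intro mult_right_mono) auto
    moreover have "a powr (1 - s / q) * a powr (s / q - 1) = 1" using a by (simp flip: powr_add)
    moreover have "(v x powr q) powr (s / q) = v x powr s" using assms by (simp add: powr_powr)
    ultimately show ?thesis by (simp add: mult.assoc)
  qed
  have "(\<Sum>x\<in>A. v x powr s) \<le> (\<Sum>x\<in>A. (s / q * v x powr q + (1 - s / q) * a) * a powr (s / q - 1))"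
    by (intro sum_mono pt)
  also have "\<dots> = (s / q * S + card A * ((1 - s / q) * a)) * a powr (s / q - 1)"
    by (simp only: S_def sum_distrib_right[symmetric] sum.distrib sum_distrib_left sum_constant of_nat_mult mult.assoc)
  also have "s / q * S + card A * ((1 - s / q) * a) = S"
  proof -
    have "card A * a = S" using n by (simp add: a_def)
    then have "card A * ((1 - s / q) * a) = (1 - s / q) * S" by (metis mult.left_commute)
    then show ?thesis by (simp add: algebra_simps)
  qed
  also have "S * a powr (s / q - 1) = card A powr (1 - s / q) * S powr (s / q)"
  proof -
    have "a powr (s / q - 1) = S powr (s / q - 1) * card A powr (1 - s / q)"
      using S n powr_minus_divide[of "card A" "s / q - 1"] by (simp add: a_def powr_divide)
    moreover have "S * S powr (s / q - 1) = S powr (s / q)" using S by (simp add: powr_mult_base)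
    ultimately show ?thesis by (metis mult.assoc mult.commute)
  qed
  finally show ?thesis by (simp add: S_def)
qed

section \<open>A local Nash inequality\<close>

definition avg :: "('d \<Rightarrow> int) \<Rightarrow> (int ^ 'd::finite \<Rightarrow> real) \<Rightarrow> int ^ 'd \<Rightarrow> real" where
  "avg s f x = (\<Sum>h\<in>cuboid s. f (x + h)) / card (cuboid s)"

lemma cuboid_double:
  fixes s :: "'d::finite \<Rightarrow> int"
  assumes "0 \<le> s i"
  shows "cuboid (s(i := 2 * s i)) = cuboid s \<union> (\<lambda>h. h + axis i (s i)) ` cuboid s"
    and "cuboid s \<inter> (\<lambda>h. h + axis i (s i)) ` cuboid s = {}"
proof -
  have ax: "axis i c $ j = (if j = i then c else 0)" for c :: int and j by (simp add: axis_def)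
  show "cuboid (s(i := 2 * s i)) = cuboid s \<union> (\<lambda>h. h + axis i (s i)) ` cuboid s"
  proof (intro equalityI subsetI)
    fix h assume h: "h \<in> cuboid (s(i := 2 * s i))"
    then have hj: "0 \<le> h $ j \<and> h $ j < (s(i := 2 * s i)) j" for j by (simp add: cuboid_def)
    show "h \<in> cuboid s \<union> (\<lambda>h. h + axis i (s i)) ` cuboid s"
    proof (cases "h $ i < s i")
      case True
      have "0 \<le> h $ j \<and> h $ j < s j" for j using hj[of j] True by (cases "j = i") auto
      then show ?thesis by (simp add: cuboid_def)
    next
      case False
      have "0 \<le> (h - axis i (s i)) $ j \<and> (h - axis i (s i)) $ j < s j" for j
        using hj[of j] False by (cases "j = i") (auto simp: ax)
      then have "h - axis i (s i) \<in> cuboid s" by (simp add: cuboid_def)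
      then show ?thesis by (intro UnI2 image_eqI[of _ _ "h - axis i (s i)"]) simp_all
    qed
  next
    fix h assume "h \<in> cuboid s \<union> (\<lambda>h. h + axis i (s i)) ` cuboid s"
    then consider "h \<in> cuboid s" | g where "g \<in> cuboid s" "h = g + axis i (s i)" by blast
    then show "h \<in> cuboid (s(i := 2 * s i))"
    proof cases
      case 1
      then have "0 \<le> h $ j \<and> h $ j < s j" for j by (simp add: cuboid_def)
      then have "0 \<le> h $ j \<and> h $ j < (s(i := 2 * s i)) j" for j
        using assms by (cases "j = i") (auto, smt (verit))
      then show ?thesis by (simp add: cuboid_def)
    next
      case 2
      then have "0 \<le> g $ j \<and> g $ j < s j" for j by (simp add: cuboid_def)
      then have "0 \<le> h $ j \<and> h $ j < (s(i := 2 * s i)) j" for j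
        using assms 2(2) by (cases "j = i") (auto simp: ax)
      then show ?thesis by (simp add: cuboid_def)
    qed
  qed
  have "h + axis i (s i) \<notin> cuboid s" if "h \<in> cuboid s" for h
  proof
    assume "h + axis i (s i) \<in> cuboid s"
    then have "(h + axis i (s i)) $ i < s i" unfolding cuboid_def by blast
    moreover have "0 \<le> h $ i" using that by (simp add: cuboid_def)
    ultimately show False by simp
  qed
  then show "cuboid s \<inter> (\<lambda>h. h + axis i (s i)) ` cuboid s = {}" by blast
qed

lemma card_cuboid_pos:
  assumes "\<And>j. 0 < s j"
  shows "card (cuboid s) > 0"
  unfolding card_cuboid by (intro prod_pos) (simp add: assms)

text \<open>The doubled box consists of two translates, so the new average is the mean of two old
  ones; half of their difference remains.\<close>

lemma avg_double:
  fixes s :: "'d::finite \<Rightarrow> int"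
  assumes s: "\<And>j. 0 < s j"
  shows "avg (s(i := 2 * s i)) f x - avg s f x =
    (\<Sum>h\<in>cuboid s. f (x + h + axis i (s i)) - f (x + h)) / (2 * card (cuboid s))"
proof -
  have si: "0 \<le> s i" using s[of i] by simp
  note double = cuboid_double[where s = s and i = i, OF si]
  have inj: "inj_on (\<lambda>h. h + axis i (s i)) (cuboid s)" by (simp add: inj_on_def)
  have c: "card (cuboid (s(i := 2 * s i))) = 2 * card (cuboid s)"
    unfolding double(1) using double(2)
    by (subst card_Un_disjoint) (auto simp: card_image[OF inj])
  have "(\<Sum>h\<in>cuboid (s(i := 2 * s i)). f (x + h)) = (\<Sum>h\<in>cuboid s. f (x + h)) + (\<Sum>h\<in>cuboid s. f (x + h + axis i (s i)))"
    unfolding double(1) using double(2)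
    by (subst sum.union_disjoint) (auto simp: sum.reindex[OF inj] add.assoc)
  moreover have "real (card (cuboid s)) > 0" using card_cuboid_pos[of s] s by simp
  ultimately show ?thesis
    by (simp add: avg_def c sum_subtractf diff_divide_distrib add_divide_distrib)
qed

lemma abs_diff_axis_le:
  fixes f :: "int ^ 'd::finite \<Rightarrow> real"
  shows "\<bar>f (z + axis i (int n)) - f z\<bar> \<le> (\<Sum>m<n. grad_abs f (edge_at (z + axis i (int m)) i))"
proof (induction n)
  case 0
  have "z + axis i (int 0) = z" by (simp add: vec_eq_iff axis_def)
  then have "\<bar>f (z + axis i (int 0)) - f z\<bar> = 0" by (simp only: diff_self abs_zero)
  then show ?case by simp
next
  case (Suc n)
  have "axis i (int (Suc n)) = axis i (int n) + axis i (1::int)" by (simp add: vec_eq_iff axis_def)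
  then have "f (z + axis i (int (Suc n))) = f (z + axis i (int n) + axis i 1)" by (simp add: add.assoc)
  then show ?case using Suc by (simp add: grad_abs_edge_at)
qed

text \<open>An increment over the distance \<open>r\<close> is a sum of \<open>r\<close> gradients
  in direction \<open>i\<close>. Points of a box with sides at most 2 r, moved by less than
  \<open>r\<close>, stay in the cube of side 3 r, and the box has at least r^d points. Sides
  \<open>r\<close> and 2 r both occur because these are the boxes between a cube and its
  double.\<close>

lemma avg_double_le:
  fixes s :: "'d::finite \<Rightarrow> int"
  assumes r: "0 < r" and s: "\<And>j. s j = int r \<or> s j = 2 * int r" and si: "s i = int r"
  shows "\<bar>avg (s(i := 2 * int r)) f x - avg s f x\<bar>
    \<le> real r / (2 * real r ^ CARD('d)) * (\<Sum>h\<in>cuboid (\<lambda>_. 3 * int r). grad_abs f (edge_at (x + h) i))"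
    (is "_ \<le> _ * ?S")
proof -
  have spos: "0 < s j" for j using s[of j] r by auto
  let ?G = "\<lambda>y. grad_abs f (edge_at y i)"
  have S0: "?S \<ge> 0" by (intro sum_nonneg) (simp add: grad_abs_edge_at)
  have *: "(\<Sum>h\<in>cuboid s. ?G (x + h + axis i (int m))) \<le> ?S" if "m < r" for m
  proof -
    have "(\<Sum>h\<in>cuboid s. ?G (x + h + axis i (int m))) = sum (\<lambda>h. ?G (x + h)) ((\<lambda>h. h + axis i (int m)) ` cuboid s)"
      by (subst sum.reindex) (auto simp: inj_on_def add.assoc)
    also have "\<dots> \<le> ?S"
    proof (rule sum_mono2)
      show "(\<lambda>h. h + axis i (int m)) ` cuboid s \<subseteq> cuboid (\<lambda>_. 3 * int r)"
      proof
        fix g assume "g \<in> (\<lambda>h. h + axis i (int m)) ` cuboid s"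
        then obtain h where g: "g = h + axis i (int m)" and h: "\<And>j. 0 \<le> h $ j \<and> h $ j < s j"
          by (auto simp: cuboid_def)
        have "0 \<le> g $ j \<and> g $ j < 3 * int r" for j
          using h[of j] s[of j] that by (auto simp: g axis_def)
        then show "g \<in> cuboid (\<lambda>_. 3 * int r)" by (simp add: cuboid_def)
      qed
    qed (auto simp: grad_abs_edge_at)
    finally show ?thesis .
  qed
  have "real r ^ CARD('d) \<le> real (card (cuboid s))"
  proof -
    have "(\<Prod>i\<in>(UNIV :: 'd set). r) \<le> (\<Prod>i\<in>UNIV. nat (s i))"
      using s by (intro prod_mono) (smt (verit) nat_int of_nat_0_le_iff zero_le nat_le_eq_zle)
    then have "r ^ CARD('d) \<le> card (cuboid s)" by (simp add: card_cuboid)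
    then show ?thesis by (metis of_nat_le_iff of_nat_power)
  qed
  moreover have rp: "real r ^ CARD('d) > 0" using r by simp
  moreover have "\<bar>avg (s(i := 2 * int r)) f x - avg s f x\<bar> \<le> (real r * ?S) / (2 * card (cuboid s))"
  proof -
    have "\<bar>\<Sum>h\<in>cuboid s. f (x + h + axis i (int r)) - f (x + h)\<bar>
      \<le> (\<Sum>h\<in>cuboid s. \<Sum>m<r. ?G (x + h + axis i (int m)))"
      by (intro order.trans[OF sum_abs] sum_mono abs_diff_axis_le)
    also have "\<dots> = (\<Sum>m<r. \<Sum>h\<in>cuboid s. ?G (x + h + axis i (int m)))" by (rule sum.swap)
    also have "\<dots> \<le> (\<Sum>m<r. ?S)" by (intro sum_mono *) simp
    finally have "\<bar>\<Sum>h\<in>cuboid s. f (x + h + axis i (int r)) - f (x + h)\<bar> \<le> real r * ?S" by simp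
    then show ?thesis
      using avg_double[of s i f x] spos si by (simp add: divide_right_mono)
  qed
  moreover have "(real r * ?S) / (2 * card (cuboid s)) \<le> (real r * ?S) / (2 * real r ^ CARD('d))"
    using calculation(1,2) S0 by (intro divide_left_mono mult_pos_pos mult_nonneg_nonneg) (linarith | simp)+
  ultimately show ?thesis by simp
qed

text \<open>Cauchy-Schwarz with the weight \<open>v\<close>, followed by the power mean from
  exponent 2 to \<open>q\<close>. The sum of \<open>(1 / v) powr q\<close> over a small cube is
  replaced by the one over the large box, where \<open>V\<close> bounds it; this is the loss caused
  by locality. Summing over \<open>x\<close> counts each vertex at most (3 r)^d times.\<close>

lemma sum_local_sums_power2_le:
  fixes v G :: "int ^ 'd::finite \<Rightarrow> real"
  assumes q: "2 \<le> q"
    and v: "\<And>y. y \<in> vbox (R + 3 * r) \<Longrightarrow> 0 < v y"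
    and V: "(\<Sum>y\<in>vbox (R + 3 * r). (1 / v y) powr q) \<le> V"
    and W: "\<And>Y. finite Y \<Longrightarrow> (\<Sum>y\<in>Y. (v y * G y)\<^sup>2) \<le> W"
  shows "(\<Sum>x\<in>vbox R. (\<Sum>h\<in>cuboid (\<lambda>_. 3 * int r). G (x + h))\<^sup>2)
    \<le> ((3 * real r) ^ CARD('d)) powr (1 - 2 / q) * V powr (2 / q) * ((3 * real r) ^ CARD('d) * W)"
proof -
  let ?K = "cuboid (\<lambda>_ :: 'd. 3 * int r)"
  have cK: "real (card ?K) = (3 * real r) ^ CARD('d)" by (simp add: card_cuboid nat_mult_distrib)
  have inK: "x + h \<in> vbox (R + 3 * r)" if "x \<in> vbox R" "h \<in> ?K" for x h
  proof -
    have "- int (R + 3 * r) \<le> (x + h) $ i \<and> (x + h) $ i \<le> int (R + 3 * r)" for i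
      using that[unfolded vbox_def cuboid_def mem_Collect_eq, rule_format, of i] by auto
    then show ?thesis by (simp add: vbox_def)
  qed
  have pt: "(\<Sum>h\<in>?K. G (x + h))\<^sup>2 \<le> ((3 * real r) ^ CARD('d)) powr (1 - 2 / q) * V powr (2 / q) * (\<Sum>h\<in>?K. (v (x + h) * G (x + h))\<^sup>2)"
    if x: "x \<in> vbox R" for x
  proof -
    have "(\<Sum>h\<in>?K. G (x + h)) = (\<Sum>h\<in>?K. (1 / v (x + h)) * (v (x + h) * G (x + h)))"
      using v[OF inK[OF x]] by (intro sum.cong) force+
    then have "(\<Sum>h\<in>?K. G (x + h))\<^sup>2 \<le> (\<Sum>h\<in>?K. (1 / v (x + h))\<^sup>2) * (\<Sum>h\<in>?K. (v (x + h) * G (x + h))\<^sup>2)"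
      by (simp only: Cauchy_Schwarz_ineq_sum)
    also have "\<dots> \<le> (((3 * real r) ^ CARD('d)) powr (1 - 2 / q) * V powr (2 / q)) * (\<Sum>h\<in>?K. (v (x + h) * G (x + h))\<^sup>2)"
    proof (intro mult_right_mono sum_nonneg)
      have "(\<Sum>h\<in>?K. (1 / v (x + h))\<^sup>2) = (\<Sum>h\<in>?K. (1 / v (x + h)) powr 2)"
        using v[OF inK[OF x]] by (intro sum.cong refl) (simp add: less_imp_le)
      also have "\<dots> \<le> real (card ?K) powr (1 - 2 / q) * (\<Sum>h\<in>?K. (1 / v (x + h)) powr q) powr (2 / q)"
        using v[OF inK[OF x]] q by (intro power_mean) (auto intro: less_imp_le)
      also have "\<dots> \<le> real (card ?K) powr (1 - 2 / q) * V powr (2 / q)"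
      proof (intro mult_left_mono powr_mono2)
        have "(\<Sum>h\<in>?K. (1 / v (x + h)) powr q) = sum (\<lambda>y. (1 / v y) powr q) ((+) x ` ?K)"
          by (subst sum.reindex) auto
        also have "\<dots> \<le> (\<Sum>y\<in>vbox (R + 3 * r). (1 / v y) powr q)"
          using inK[OF x] by (intro sum_mono2) auto
        finally show "(\<Sum>h\<in>?K. (1 / v (x + h)) powr q) \<le> V" using V by simp
      qed (use q in \<open>auto intro: sum_nonneg\<close>)
      finally show "(\<Sum>h\<in>?K. (1 / v (x + h))\<^sup>2) \<le> ((3 * real r) ^ CARD('d)) powr (1 - 2 / q) * V powr (2 / q)"
        unfolding cK .
    qed auto
    finally show ?thesis .
  qed
  have "(\<Sum>x\<in>vbox R. (\<Sum>h\<in>?K. G (x + h))\<^sup>2) \<le> ((3 * real r) ^ CARD('d)) powr (1 - 2 / q) * V powr (2 / q) * (\<Sum>x\<in>vbox R. \<Sum>h\<in>?K. (v (x + h) * G (x + h))\<^sup>2)"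
    unfolding sum_distrib_left[of _ _ "vbox R"] by (intro sum_mono pt)
  also have "\<dots> \<le> ((3 * real r) ^ CARD('d)) powr (1 - 2 / q) * V powr (2 / q) * ((3 * real r) ^ CARD('d) * W)"
  proof (intro mult_left_mono)
    have "(\<Sum>x\<in>vbox R. (v (x + h) * G (x + h))\<^sup>2) \<le> W" for h
    proof -
      have "(\<Sum>x\<in>vbox R. (v (x + h) * G (x + h))\<^sup>2) = sum (\<lambda>y. (v y * G y)\<^sup>2) ((\<lambda>x. x + h) ` vbox R)"
        by (subst sum.reindex) (auto simp: inj_on_def)
      also have "\<dots> \<le> W" by (rule W) simp
      finally show ?thesis .
    qed
    then have "(\<Sum>h\<in>?K. \<Sum>x\<in>vbox R. (v (x + h) * G (x + h))\<^sup>2) \<le> (\<Sum>h\<in>?K. W)"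
      by (intro sum_mono)
    then show "(\<Sum>x\<in>vbox R. \<Sum>h\<in>?K. (v (x + h) * G (x + h))\<^sup>2) \<le> (3 * real r) ^ CARD('d) * W"
      by (subst sum.swap) (simp add: cK)
  qed auto
  finally show ?thesis .
qed

text \<open>The prefactor \<open>c\<close> is of order r^(1 - d), and the (3 r)^d points of a cube
  enter with the power 1 - 1 / q. Together they give r to the power 1 - d / q.\<close>

lemma L2_set_avg_double_le:
  fixes s :: "'d::finite \<Rightarrow> int" and w :: "'d edge \<Rightarrow> real" and f :: "int ^ 'd \<Rightarrow> real"
  assumes r: "0 < r" and s: "\<And>j. s j = int r \<or> s j = 2 * int r" and si: "s i = int r"
    and q: "2 \<le> q"
    and v: "\<And>y. y \<in> vbox (R + 3 * r) \<Longrightarrow> 0 < w (edge_at y i)"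
    and V: "(\<Sum>y\<in>vbox (R + 3 * r). (1 / w (edge_at y i)) powr q) \<le> V"
    and W: "\<And>Y. finite Y \<Longrightarrow> (\<Sum>y\<in>Y. (w (edge_at y i) * grad_abs f (edge_at y i))\<^sup>2) \<le> W"
  shows "L2_set (\<lambda>x. avg (s(i := 2 * int r)) f x - avg s f x) (vbox R)
    \<le> 3 ^ CARD('d) * real r powr (1 - CARD('d) / q) * V powr (1 / q) * sqrt W"
proof -
  define d where "d = CARD('d)"
  let ?G = "\<lambda>y. grad_abs f (edge_at y i)"
  define c where "c = real r / (2 * real r ^ d)"
  define a where "a = (3 * real r) ^ d"
  have c0: "c \<ge> 0" by (simp add: c_def)
  have a0: "a > 0" using r by (simp add: a_def)
  have W0: "W \<ge> 0" using W[of "{}"] by simp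
  have V0: "V \<ge> 0" using V by (rule order.trans[rotated]) (simp add: sum_nonneg)
  have "(\<Sum>x\<in>vbox R. (avg (s(i := 2 * int r)) f x - avg s f x)\<^sup>2)
    \<le> (\<Sum>x\<in>vbox R. (c * (\<Sum>h\<in>cuboid (\<lambda>_. 3 * int r). ?G (x + h)))\<^sup>2)"
  proof (intro sum_mono)
    fix x
    have "\<bar>avg (s(i := 2 * int r)) f x - avg s f x\<bar> \<le> c * (\<Sum>h\<in>cuboid (\<lambda>_. 3 * int r). ?G (x + h))"
      using avg_double_le[of r s i f x] r s si by (simp add: c_def d_def)
    then show "(avg (s(i := 2 * int r)) f x - avg s f x)\<^sup>2 \<le> (c * (\<Sum>h\<in>cuboid (\<lambda>_. 3 * int r). ?G (x + h)))\<^sup>2"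
      by (metis abs_ge_zero power2_abs power_mono)
  qed
  also have "\<dots> = c\<^sup>2 * (\<Sum>x\<in>vbox R. (\<Sum>h\<in>cuboid (\<lambda>_. 3 * int r). ?G (x + h))\<^sup>2)"
    by (simp only: power_mult_distrib sum_distrib_left[of "c\<^sup>2"])
  also have "\<dots> \<le> c\<^sup>2 * (a powr (1 - 2 / q) * V powr (2 / q) * (a * W))"
    unfolding a_def d_def
    by (intro mult_left_mono sum_local_sums_power2_le[where v = "\<lambda>y. w (edge_at y i)"] q v V W) auto
  also have "\<dots> = (c * a powr (1 - 1 / q) * V powr (1 / q) * sqrt W)\<^sup>2"
  proof -
    have "(a powr (1 - 1 / q))\<^sup>2 = a powr (1 - 2 / q) * a"
    proof -
      have "(a powr (1 - 1 / q))\<^sup>2 = a powr (2 - 2 / q)"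
        using a0 by (simp add: power2_eq_square flip: powr_add)
      also have "\<dots> = a powr ((1 - 2 / q) + 1)" by simp
      also have "\<dots> = a powr (1 - 2 / q) * a" using a0 by (simp only: powr_add powr_one)
      finally show ?thesis .
    qed
    moreover have "(V powr (1 / q))\<^sup>2 = V powr (2 / q)"
      using V0 by (simp add: power2_eq_square flip: powr_add)
    ultimately show ?thesis using W0 by (simp add: power_mult_distrib)
  qed
  finally have "L2_set (\<lambda>x. avg (s(i := 2 * int r)) f x - avg s f x) (vbox R) \<le> c * a powr (1 - 1 / q) * V powr (1 / q) * sqrt W"
    unfolding L2_set_def using c0 W0 by (intro real_le_lsqrt) auto
  also have "\<dots> \<le> 3 ^ d * real r powr (1 - d / q) * V powr (1 / q) * sqrt W"
  proof (intro mult_right_mono)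
    have "a powr (1 - 1 / q) = (3 ^ d) powr (1 - 1 / q) * real r powr (d * (1 - 1 / q))"
      using r by (simp add: a_def power_mult_distrib powr_mult powr_powr powr_realpow[symmetric])
    moreover have "c = real r powr (1 - real d) / 2"
      using r by (simp add: c_def powr_diff powr_realpow)
    ultimately have "c * a powr (1 - 1 / q) = (3 ^ d) powr (1 - 1 / q) / 2 * (real r powr (1 - real d) * real r powr (d * (1 - 1 / q)))"
      by simp
    also have "real r powr (1 - real d) * real r powr (d * (1 - 1 / q)) = real r powr (1 - d / q)"
      by (simp add: algebra_simps flip: powr_add)
    also have "(3 ^ d) powr (1 - 1 / q) / 2 * real r powr (1 - d / q) \<le> 3 ^ d * real r powr (1 - d / q)"
    proof (intro mult_right_mono)
      have "(3 ^ d) powr (1 - 1 / q) \<le> (3 ^ d :: real) powr 1" using q by (intro powr_mono) auto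
      also have "\<dots> \<le> 3 ^ d * 2" by simp
      finally show "(3 ^ d) powr (1 - 1 / q) / 2 \<le> (3 ^ d :: real)" by simp
    qed auto
    finally show "c * a powr (1 - 1 / q) \<le> 3 ^ d * real r powr (1 - d / q)" .
  qed (use W0 in auto)
  finally show ?thesis by (simp add: d_def)
qed

lemma L2_set_avg_cube_double_le:
  fixes w :: "'d::finite edge \<Rightarrow> real" and f :: "int ^ 'd \<Rightarrow> real"
  assumes r: "0 < r" and q: "2 \<le> q"
    and v: "\<And>y i. y \<in> vbox (R + 3 * r) \<Longrightarrow> 0 < w (edge_at y i)"
    and V: "\<And>i. (\<Sum>y\<in>vbox (R + 3 * r). (1 / w (edge_at y i)) powr q) \<le> V"
    and W: "\<And>Y i. finite Y \<Longrightarrow> (\<Sum>y\<in>Y. (w (edge_at y i) * grad_abs f (edge_at y i))\<^sup>2) \<le> W"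
  shows "L2_set (\<lambda>x. avg (\<lambda>_. 2 * int r) f x - avg (\<lambda>_. int r) f x) (vbox R)
    \<le> CARD('d) * (3 ^ CARD('d) * real r powr (1 - CARD('d) / q) * V powr (1 / q) * sqrt W)"
proof -
  define B where "B = 3 ^ CARD('d) * real r powr (1 - CARD('d) / q) * V powr (1 / q) * sqrt W"
  \<comment> \<open>Sides are doubled in the directions of \<open>S\<close> only. The set grows from
    empty to all directions, and each insertion costs one \<open>B\<close>.\<close>
  define s where "s S j = (if j \<in> S then 2 * int r else int r)" for S and j :: 'd
  have claim: "L2_set (\<lambda>x. avg (s S) f x - avg (s {}) f x) (vbox R) \<le> card S * B" if "finite S" for S
    using that
  proof (induction S)
    case empty
    then show ?case by (simp add: L2_set_def)
  next
    case (insert i S)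
    have s_ins: "s (insert i S) = (s S)(i := 2 * int r)" by (auto simp: s_def fun_eq_iff)
    have "L2_set (\<lambda>x. avg (s (insert i S)) f x - avg (s {}) f x) (vbox R)
      = L2_set (\<lambda>x. (avg (s (insert i S)) f x - avg (s S) f x) + (avg (s S) f x - avg (s {}) f x)) (vbox R)"
      by simp
    also have "\<dots> \<le> L2_set (\<lambda>x. avg (s (insert i S)) f x - avg (s S) f x) (vbox R) + L2_set (\<lambda>x. avg (s S) f x - avg (s {}) f x) (vbox R)"
      by (rule L2_set_triangle_ineq)
    also have "\<dots> \<le> B + card S * B"
      unfolding B_def
    proof (rule add_mono[OF _ insert.IH[unfolded B_def]])
      show "L2_set (\<lambda>x. avg (s (insert i S)) f x - avg (s S) f x) (vbox R)
        \<le> 3 ^ CARD('d) * real r powr (1 - CARD('d) / q) * V powr (1 / q) * sqrt W"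
        unfolding s_ins
        by (rule L2_set_avg_double_le[OF r _ _ q]) (use insert v V W in \<open>auto simp: s_def\<close>)
    qed
    finally show ?case using insert by (simp add: algebra_simps)
  qed
  have s: "s UNIV = (\<lambda>_. 2 * int r)" "s {} = (\<lambda>_. int r)" by (auto simp: s_def)
  show ?thesis using claim[of UNIV] unfolding s B_def by simp
qed

lemma avg_unit: "avg (\<lambda>_ :: 'd::finite. 1) f x = f x"
proof -
  have "cuboid (\<lambda>_ :: 'd. 1) = {0}" by (auto simp: cuboid_def vec_eq_iff) (smt (verit))
  then show ?thesis by (simp add: avg_def)
qed

text \<open>Telescoping over the scales 1, 2, 4, ..., 2^n. As \<open>q\<close> exceeds the
  dimension, the bounds on the increments grow with the ratio 2 powr (1 - d / q) > 1, so the largest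
  scale dominates. All cubes lie in the box of radius \<open>R'\<close>, so one \<open>V\<close>
  serves every scale.\<close>

lemma L2_set_avg_minus_le:
  fixes w :: "'d::finite edge \<Rightarrow> real" and f :: "int ^ 'd \<Rightarrow> real" and q :: real
  assumes q: "2 \<le> q" "CARD('d) < q" and R': "R + 3 * 2 ^ n \<le> R'"
    and v: "\<And>y i. y \<in> vbox R' \<Longrightarrow> 0 < w (edge_at y i)"
    and V: "\<And>i. (\<Sum>y\<in>vbox R'. (1 / w (edge_at y i)) powr q) \<le> V"
    and W: "\<And>Y i. finite Y \<Longrightarrow> (\<Sum>y\<in>Y. (w (edge_at y i) * grad_abs f (edge_at y i))\<^sup>2) \<le> W"
  shows "L2_set (\<lambda>x. avg (\<lambda>_. 2 ^ n) f x - f x) (vbox R)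
    \<le> CARD('d) * (3 ^ CARD('d) * V powr (1 / q) * sqrt W) *
      ((2 powr (1 - CARD('d) / q)) ^ n / (2 powr (1 - CARD('d) / q) - 1))"
proof -
  define z :: real where "z = 2 powr (1 - CARD('d) / q)"
  define B where "B = CARD('d) * (3 ^ CARD('d) * V powr (1 / q) * sqrt W)"
  have z: "z > 1" using q by (simp add: z_def)
  have W0: "W \<ge> 0" using W[of "{}"] by simp
  have B0: "B \<ge> 0" using W0 by (simp add: B_def)
  have "L2_set (\<lambda>x. avg (\<lambda>_. 2 ^ k) f x - f x) (vbox R) \<le> B * (\<Sum>j<k. z ^ j)" if "k \<le> n" for k
    using that
  proof (induction k)
    case 0
    then show ?case by (simp add: avg_unit L2_set_def)
  next
    case (Suc k)
    have "R + 3 * 2 ^ k \<le> R + 3 * 2 ^ n" using Suc.prems by simp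
    then have le: "R + 3 * 2 ^ k \<le> R'" using R' by linarith
    then have sub: "vbox (R + 3 * 2 ^ k) \<subseteq> (vbox R' :: (int ^ 'd) set)"
      unfolding vbox_def by (intro Collect_mono) (smt (verit) of_nat_le_iff)
    have V': "(\<Sum>y\<in>vbox (R + 3 * 2 ^ k). (1 / w (edge_at y i)) powr q) \<le> V" for i
      by (rule order.trans[OF sum_mono2 V]) (use sub in auto)
    have "L2_set (\<lambda>x. avg (\<lambda>_. 2 ^ Suc k) f x - f x) (vbox R)
      = L2_set (\<lambda>x. (avg (\<lambda>_. 2 ^ Suc k) f x - avg (\<lambda>_. 2 ^ k) f x) + (avg (\<lambda>_. 2 ^ k) f x - f x)) (vbox R)"
      by simp
    also have "\<dots> \<le> L2_set (\<lambda>x. avg (\<lambda>_. 2 ^ Suc k) f x - avg (\<lambda>_. 2 ^ k) f x) (vbox R) + L2_set (\<lambda>x. avg (\<lambda>_. 2 ^ k) f x - f x) (vbox R)"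
      by (rule L2_set_triangle_ineq)
    also have "\<dots> \<le> B * z ^ k + B * (\<Sum>j<k. z ^ j)"
    proof (rule add_mono)
      have "L2_set (\<lambda>x. avg (\<lambda>_. 2 * int (2 ^ k)) f x - avg (\<lambda>_. int (2 ^ k)) f x) (vbox R)
        \<le> CARD('d) * (3 ^ CARD('d) * real (2 ^ k) powr (1 - CARD('d) / q) * V powr (1 / q) * sqrt W)"
        by (rule L2_set_avg_cube_double_le[where w = w]) (use q v V' W sub in auto)
      also have "real (2 ^ k) powr (1 - CARD('d) / q) = z ^ k"
        by (simp add: z_def powr_powr mult.commute flip: powr_realpow)
      finally show "L2_set (\<lambda>x. avg (\<lambda>_. 2 ^ Suc k) f x - avg (\<lambda>_. 2 ^ k) f x) (vbox R) \<le> B * z ^ k"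
        by (simp add: B_def mult_ac)
      show "L2_set (\<lambda>x. avg (\<lambda>_. 2 ^ k) f x - f x) (vbox R) \<le> B * (\<Sum>j<k. z ^ j)"
        using Suc by simp
    qed
    finally show ?case by (simp add: algebra_simps)
  qed
  from this[of n] have "L2_set (\<lambda>x. avg (\<lambda>_. 2 ^ n) f x - f x) (vbox R) \<le> B * (\<Sum>j<n. z ^ j)" by simp
  also have "\<dots> \<le> B * (z ^ n / (z - 1))"
    using z B0 by (intro mult_left_mono) (auto simp: sum_gp_strict divide_right_mono field_simps)
  finally show ?thesis by (simp add: B_def z_def)
qed

text \<open>The averages have supremum at most \<open>F / card (cuboid s)\<close> and absolute sum
  at most \<open>F\<close>; the sum of squares is bounded by the product.\<close>

lemma sum_avg_power2_le:
  fixes f :: "int ^ 'd::finite \<Rightarrow> real"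
  assumes F: "\<And>Y. finite Y \<Longrightarrow> (\<Sum>y\<in>Y. \<bar>f y\<bar>) \<le> F"
    and s: "\<And>j. 0 < s j" and "finite A"
  shows "(\<Sum>x\<in>A. (avg s f x)\<^sup>2) \<le> F\<^sup>2 / card (cuboid s)"
proof -
  define c where "c = real (card (cuboid s))"
  have c: "c > 0" using card_cuboid_pos[of s] s by (simp add: c_def)
  have F0: "F \<ge> 0" using F[of "{}"] by simp
  have a: "\<bar>avg s f x\<bar> \<le> (\<Sum>h\<in>cuboid s. \<bar>f (x + h)\<bar>) / c" for x
    unfolding avg_def c_def[symmetric] using c by (simp add: divide_right_mono)
  have sup: "\<bar>avg s f x\<bar> \<le> F / c" for x
  proof -
    have "(\<Sum>h\<in>cuboid s. \<bar>f (x + h)\<bar>) = sum (\<lambda>y. \<bar>f y\<bar>) ((+) x ` cuboid s)" by (subst sum.reindex) auto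
    also have "\<dots> \<le> F" by (rule F) simp
    finally show ?thesis using a[of x] c by (meson divide_right_mono less_imp_le order.trans)
  qed
  have "(\<Sum>x\<in>A. \<bar>avg s f x\<bar>) \<le> (\<Sum>x\<in>A. (\<Sum>h\<in>cuboid s. \<bar>f (x + h)\<bar>) / c)" by (intro sum_mono a)
  also have "\<dots> = (\<Sum>h\<in>cuboid s. \<Sum>x\<in>A. \<bar>f (x + h)\<bar>) / c"
    by (subst sum.swap) (simp add: sum_divide_distrib)
  also have "\<dots> \<le> (\<Sum>h\<in>cuboid s. F) / c"
  proof (intro divide_right_mono sum_mono)
    fix h
    have "(\<Sum>x\<in>A. \<bar>f (x + h)\<bar>) = sum (\<lambda>y. \<bar>f y\<bar>) ((\<lambda>x. x + h) ` A)"
      by (subst sum.reindex) (auto simp: inj_on_def)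
    also have "\<dots> \<le> F" by (rule F) (simp add: \<open>finite A\<close>)
    finally show "(\<Sum>x\<in>A. \<bar>f (x + h)\<bar>) \<le> F" .
  qed (use c in auto)
  also have "\<dots> = F" using c by (simp add: c_def del: card_gt_0_iff) (metis card.empty less_irrefl)
  finally have l1: "(\<Sum>x\<in>A. \<bar>avg s f x\<bar>) \<le> F" .
  have "(\<Sum>x\<in>A. (avg s f x)\<^sup>2) \<le> (\<Sum>x\<in>A. F / c * \<bar>avg s f x\<bar>)"
  proof (intro sum_mono)
    fix x
    show "(avg s f x)\<^sup>2 \<le> F / c * \<bar>avg s f x\<bar>"
      using mult_right_mono[OF sup[of x], of "\<bar>avg s f x\<bar>"] by (simp add: power2_eq_square flip: abs_mult)
  qed
  also have "\<dots> \<le> F / c * F" unfolding sum_distrib_left[symmetric] using l1 c F0 by (intro mult_left_mono) auto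
  finally show ?thesis by (simp add: c_def power2_eq_square)
qed

lemma vbox_mono: "r \<le> s \<Longrightarrow> vbox r \<subseteq> (vbox s :: (int ^ 'd::finite) set)"
  unfolding vbox_def by (intro Collect_mono) (smt (verit) of_nat_le_iff)

lemma ex_power_two_between:
  assumes "1 \<le> (x :: real)"
  shows "\<exists>n. x \<le> 2 ^ n \<and> 2 ^ n \<le> 2 * x"
proof -
  obtain n where n: "x \<le> 2 ^ n" "\<And>m. m < n \<Longrightarrow> \<not> x \<le> 2 ^ m"
  proof
    have "\<exists>n. x \<le> 2 ^ n" using real_arch_pow[of 2 x] by (auto intro: less_imp_le)
    then show "x \<le> 2 ^ (LEAST n. x \<le> 2 ^ n)" by (rule LeastI_ex)
    show "\<not> x \<le> 2 ^ m" if "m < (LEAST n. x \<le> 2 ^ n)" for m using that by (rule not_less_Least)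
  qed
  show ?thesis
  proof (cases n)
    case 0
    then show ?thesis using n assms by (intro exI[of _ n]) auto
  next
    case (Suc m)
    then show ?thesis using n(1) n(2)[of m] by (intro exI[of _ n]) auto
  qed
qed

text \<open>A real-valued substitute for a bound \<open>m\<close> on the moment, raised to the power
  \<open>q\<close> and multiplied by the number of edges. Positivity of \<open>w\<close> is included
  because a zero of \<open>w\<close> makes the moment infinite.\<close>

definition moment_le :: "real \<Rightarrow> real \<Rightarrow> ('d::finite edge \<Rightarrow> real) \<Rightarrow> bool" where
  "moment_le q m w \<longleftrightarrow> 0 \<le> m \<and> (\<forall>e\<in>edges. 0 < w e) \<and>
    (\<forall>r\<ge>1. (\<Sum>e\<in>box_edges r. (1 / w e) powr q) \<le> m powr q * card (box_edges r :: 'd edge set))"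

text \<open>At a scale comparable to \<rho>, \<open>f\<close> is split into its box average, bounded
  through \<open>F\<close>, and the remainder, bounded through the gradient. The sum of
  \<open>(1 / w) powr q\<close> over a box of radius comparable to R is at most of order m^q R^d;
  its q-th root contributes R^(d / q) = R^(1 - \<delta>), which is then squared.\<close>

lemma local_nash_inequality:
  fixes q \<delta> :: real
  assumes q: "2 \<le> q" "CARD('d) < q"
  defines "\<delta> \<equiv> 1 - CARD('d::finite) / q"
  shows "\<exists>K\<ge>1. \<forall>(w :: 'd edge \<Rightarrow> real) m f F W \<rho> R. moment_le q m w \<longrightarrow>
    (\<forall>Y. finite Y \<longrightarrow> (\<Sum>y\<in>Y. \<bar>f y\<bar>) \<le> F) \<longrightarrow>
    (\<forall>Z. finite Z \<longrightarrow> Z \<subseteq> edges \<longrightarrow> (\<Sum>e\<in>Z. (w e * grad_abs f e)\<^sup>2) \<le> W) \<longrightarrow>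
    1 \<le> \<rho> \<longrightarrow> \<rho> \<le> R \<longrightarrow>
    (\<Sum>x\<in>vbox (nat \<lfloor>R\<rfloor>). (f x)\<^sup>2) \<le> K * (m\<^sup>2 * \<rho> powr (2 * \<delta>) * R powr (2 - 2 * \<delta>) * W + F\<^sup>2 / \<rho> ^ CARD('d))"
proof -
  define d where "d = CARD('d)"
  \<comment> \<open>The factors are, in this order, those of the telescoped estimate, of the q-th
    root of \<open>V\<close>, and of the passage from 2^n to \<rho>.\<close>
  define c where "c = d * 3 ^ d / (2 powr \<delta> - 1) * (d * 33 ^ d) * 2"
  have d1: "d \<ge> 1" by (simp add: d_def Suc_leI)
  have \<delta>: "0 < \<delta>" "\<delta> < 1" using q d1 by (auto simp: \<delta>_def d_def)
  have z: "2 powr \<delta> > 1" using \<delta> by simp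
  have c0: "c \<ge> 0" using z by (simp add: c_def)
  have main: "(\<Sum>x\<in>vbox (nat \<lfloor>R\<rfloor>). (f x)\<^sup>2) \<le> (2 * c\<^sup>2 + 2) * (m\<^sup>2 * \<rho> powr (2 * \<delta>) * R powr (2 - 2 * \<delta>) * W + F\<^sup>2 / \<rho> ^ d)"
    if mom: "moment_le q m w"
      and F: "\<And>Y. finite Y \<Longrightarrow> (\<Sum>y\<in>Y. \<bar>f y\<bar>) \<le> F"
      and W: "\<And>Z. finite Z \<Longrightarrow> Z \<subseteq> edges \<Longrightarrow> (\<Sum>e\<in>Z. (w e * grad_abs f e)\<^sup>2) \<le> W"
      and \<rho>: "1 \<le> \<rho>" "\<rho> \<le> R"
    for w :: "'d edge \<Rightarrow> real" and m f F W \<rho> R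
  proof -
    obtain n where n: "\<rho> \<le> 2 ^ n" "2 ^ n \<le> 2 * \<rho>" using ex_power_two_between[OF \<rho>(1)] by auto
    \<comment> \<open>Lower corners of the averaging cubes range over the box of radius
      \<open>S\<close>. Since 2^n \<le> 2 \<rho> \<le> 2 R \<le> S, the cubes stay in radius 4 S,
      and edges starting there lie in radius 5 S. The number of edges is at most d (10 S + 1)^d
      \<le> d (33 R)^d.\<close>
    define S where "S = nat \<lceil>2 * R\<rceil>"
    have S: "2 * R \<le> S" "S \<le> 3 * R" "1 \<le> S" using \<rho> unfolding S_def by linarith+
    have nS: "2 ^ n \<le> S"
    proof -
      have "(2 :: real) ^ n \<le> real S" using n(2) \<rho> S(1) by linarith
      then have "real (2 ^ n) \<le> real S" by simp
      then show ?thesis by (simp only: of_nat_le_iff)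
    qed
    have m0: "m \<ge> 0" and wpos: "\<And>e. e \<in> edges \<Longrightarrow> 0 < w e" using mom by (auto simp: moment_le_def)
    have W0: "W \<ge> 0" using W[of "{}"] by simp
    define V where "V = m powr q * (d * (33 * R) ^ d)"
    have V: "(\<Sum>y\<in>vbox (4 * S). (1 / w (edge_at y i)) powr q) \<le> V" for i
    proof -
      have inj: "inj_on (\<lambda>y. edge_at y i) (vbox (4 * S))" by (simp add: inj_on_def edge_at_inject)
      have sub: "(\<lambda>y. edge_at y i) ` vbox (4 * S) \<subseteq> box_edges (5 * S)"
      proof
        fix e assume "e \<in> (\<lambda>y. edge_at y i) ` vbox (4 * S)"
        then obtain y where y: "e = edge_at y i" "y \<in> vbox (4 * S)" by auto
        have "- int (5 * S) \<le> y $ j \<and> (y + axis i 1) $ j \<le> int (5 * S) \<and> - int (5 * S) \<le> (y + axis i 1) $ j \<and> y $ j \<le> int (5 * S)" for j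
          using y(2)[unfolded vbox_def mem_Collect_eq, rule_format, of j] S(3) by (auto simp: axis_def)
        then have "y \<in> vbox (5 * S)" "y + axis i 1 \<in> vbox (5 * S)" by (simp_all add: vbox_def)
        then show "e \<in> box_edges (5 * S)" using y(1) edge_at_in_edges[of y i] by (simp add: box_edges_def edge_at_def)
      qed
      have "(\<Sum>y\<in>vbox (4 * S). (1 / w (edge_at y i)) powr q) = (\<Sum>e\<in>(\<lambda>y. edge_at y i) ` vbox (4 * S). (1 / w e) powr q)"
        by (simp add: sum.reindex[OF inj])
      also have "\<dots> \<le> (\<Sum>e\<in>box_edges (5 * S). (1 / w e) powr q)" using sub by (intro sum_mono2) auto
      also have "\<dots> \<le> m powr q * card (box_edges (5 * S) :: 'd edge set)"
        using mom S(3) unfolding moment_le_def by auto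
      also have "\<dots> \<le> V"
        unfolding V_def
      proof (intro mult_left_mono)
        have "real (card (box_edges (5 * S) :: 'd edge set)) \<le> real (d * (2 * (5 * S) + 1) ^ d)"
          unfolding d_def of_nat_le_iff by (rule card_box_edges_le)
        also have "\<dots> = d * (10 * real S + 1) ^ d" by (simp add: add.commute)
        also have "\<dots> \<le> d * (33 * R) ^ d" using S by (intro mult_left_mono power_mono) auto
        finally show "real (card (box_edges (5 * S) :: 'd edge set)) \<le> d * (33 * R) ^ d" .
      qed simp
      finally show ?thesis .
    qed
    have Vq: "V powr (1 / q) \<le> m * (d * 33 ^ d) * R powr (1 - \<delta>)"
    proof -
      have "V powr (1 / q) = m * ((d * 33 ^ d) powr (1 / q) * (R ^ d) powr (1 / q))"
        using m0 q \<rho> by (simp add: V_def powr_mult powr_powr power_mult_distrib mult_ac)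
      also have "(R ^ d) powr (1 / q) = R powr (1 - \<delta>)"
        using \<rho> by (simp add: powr_powr \<delta>_def d_def flip: powr_realpow)
      also have "m * ((d * 33 ^ d) powr (1 / q) * R powr (1 - \<delta>)) \<le> m * ((d * 33 ^ d) powr 1 * R powr (1 - \<delta>))"
      proof (intro mult_left_mono mult_right_mono powr_mono)
        show "1 \<le> real (d * 33 ^ d)" using d1 by (simp add: Suc_le_eq del: of_nat_mult)
      qed (use m0 q in auto)
      finally show ?thesis by simp
    qed
    have "L2_set (\<lambda>x. avg (\<lambda>_. 2 ^ n) f x - f x) (vbox S)
      \<le> d * (3 ^ d * V powr (1 / q) * sqrt W) * ((2 powr \<delta>) ^ n / (2 powr \<delta> - 1))"
      unfolding d_def \<delta>_def
    proof (rule L2_set_avg_minus_le[where w = w and R' = "4 * S", OF q])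
      show "S + 3 * 2 ^ n \<le> 4 * S" using nS by simp
      fix Y :: "(int ^ 'd) set" and i assume Y: "finite Y"
      have "(\<Sum>y\<in>Y. (w (edge_at y i) * grad_abs f (edge_at y i))\<^sup>2) = (\<Sum>e\<in>(\<lambda>y. edge_at y i) ` Y. (w e * grad_abs f e)\<^sup>2)"
        by (subst sum.reindex) (auto simp: inj_on_def edge_at_inject)
      also have "\<dots> \<le> W" by (rule W) (use Y in auto)
      finally show "(\<Sum>y\<in>Y. (w (edge_at y i) * grad_abs f (edge_at y i))\<^sup>2) \<le> W" .
    qed (use wpos V in auto)
    also have "\<dots> \<le> d * (3 ^ d * (m * (d * 33 ^ d) * R powr (1 - \<delta>)) * sqrt W) * ((2 * \<rho> powr \<delta>) / (2 powr \<delta> - 1))"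
    proof (intro mult_mono mult_left_mono mult_right_mono divide_right_mono Vq)
      have "(2 powr \<delta>) ^ n = (2 ^ n) powr \<delta>" by (simp add: powr_powr mult.commute flip: powr_realpow)
      also have "\<dots> \<le> (2 * \<rho>) powr \<delta>" using n \<delta> by (intro powr_mono2) auto
      also have "\<dots> \<le> 2 powr 1 * \<rho> powr \<delta>"
        using \<rho> \<delta> by (simp only: powr_mult) (intro mult_right_mono powr_mono, auto)
      finally show "(2 powr \<delta>) ^ n \<le> 2 * \<rho> powr \<delta>" by simp
    qed (use z W0 m0 in auto)
    also have "\<dots> = c * (m * \<rho> powr \<delta> * R powr (1 - \<delta>) * sqrt W)" by (simp add: c_def)
    finally have 1: "L2_set (\<lambda>x. avg (\<lambda>_. 2 ^ n) f x - f x) (vbox S) \<le> c * (m * \<rho> powr \<delta> * R powr (1 - \<delta>) * sqrt W)" .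
    have "(\<Sum>x\<in>vbox S. (avg (\<lambda>_. 2 ^ n) f x - f x)\<^sup>2) = (L2_set (\<lambda>x. avg (\<lambda>_. 2 ^ n) f x - f x) (vbox S))\<^sup>2"
      by (simp add: L2_set_def sum_nonneg)
    also have "\<dots> \<le> (c * (m * \<rho> powr \<delta> * R powr (1 - \<delta>) * sqrt W))\<^sup>2"
      by (intro power_mono 1) simp
    also have "\<dots> = c\<^sup>2 * (m\<^sup>2 * \<rho> powr (2 * \<delta>) * R powr (2 - 2 * \<delta>) * W)"
    proof -
      have "(\<rho> powr \<delta>)\<^sup>2 = \<rho> powr (2 * \<delta>)" by (simp add: power2_eq_square flip: powr_add)
      moreover have "(R powr (1 - \<delta>))\<^sup>2 = R powr (2 - 2 * \<delta>)" by (simp add: power2_eq_square flip: powr_add)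
      ultimately show ?thesis using W0 by (simp add: power_mult_distrib)
    qed
    finally have A: "(\<Sum>x\<in>vbox S. (avg (\<lambda>_. 2 ^ n) f x - f x)\<^sup>2) \<le> c\<^sup>2 * (m\<^sup>2 * \<rho> powr (2 * \<delta>) * R powr (2 - 2 * \<delta>) * W)" .
    have "(\<Sum>x\<in>vbox S. (avg (\<lambda>_. 2 ^ n) f x)\<^sup>2) \<le> F\<^sup>2 / card (cuboid (\<lambda>_ :: 'd. 2 ^ n))"
      by (rule sum_avg_power2_le[OF F]) auto
    also have "real (card (cuboid (\<lambda>_ :: 'd. 2 ^ n))) = (2 ^ n) ^ d"
      by (simp add: card_cuboid d_def nat_power_eq)
    also have "F\<^sup>2 / (2 ^ n) ^ d \<le> F\<^sup>2 / \<rho> ^ d"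
      using n(1) \<rho> by (intro divide_left_mono power_mono mult_pos_pos) auto
    finally have B: "(\<Sum>x\<in>vbox S. (avg (\<lambda>_. 2 ^ n) f x)\<^sup>2) \<le> F\<^sup>2 / \<rho> ^ d" .
    have "(\<Sum>x\<in>vbox (nat \<lfloor>R\<rfloor>). (f x)\<^sup>2) \<le> (\<Sum>x\<in>vbox S. (f x)\<^sup>2)"
    proof (rule sum_mono2)
      have "nat \<lfloor>R\<rfloor> \<le> S" using \<rho> S(1) by linarith
      then show "vbox (nat \<lfloor>R\<rfloor>) \<subseteq> (vbox S :: (int ^ 'd) set)" by (rule vbox_mono)
    qed auto
    also have "\<dots> \<le> (\<Sum>x\<in>vbox S. 2 * (avg (\<lambda>_. 2 ^ n) f x - f x)\<^sup>2 + 2 * (avg (\<lambda>_. 2 ^ n) f x)\<^sup>2)"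
    proof (rule sum_mono)
      fix x
      \<comment> \<open>The difference of the two sides of the next inequality is exactly this
        square.\<close>
      have "0 \<le> (2 * avg (\<lambda>_. 2 ^ n) f x - f x)\<^sup>2" by simp
      then show "(f x)\<^sup>2 \<le> 2 * (avg (\<lambda>_. 2 ^ n) f x - f x)\<^sup>2 + 2 * (avg (\<lambda>_. 2 ^ n) f x)\<^sup>2"
        by (simp add: power2_eq_square algebra_simps)
    qed
    also have "\<dots> \<le> 2 * (c\<^sup>2 * (m\<^sup>2 * \<rho> powr (2 * \<delta>) * R powr (2 - 2 * \<delta>) * W)) + 2 * (F\<^sup>2 / \<rho> ^ d)"
      unfolding sum.distrib sum_distrib_left[symmetric] using A B by simp
    also have "\<dots> \<le> (2 * c\<^sup>2 + 2) * (m\<^sup>2 * \<rho> powr (2 * \<delta>) * R powr (2 - 2 * \<delta>) * W + F\<^sup>2 / \<rho> ^ d)"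
    proof -
      have "0 \<le> m\<^sup>2 * \<rho> powr (2 * \<delta>) * R powr (2 - 2 * \<delta>) * W" using W0 by simp
      moreover have "0 \<le> c\<^sup>2 * (F\<^sup>2 / \<rho> ^ d)" using \<rho> by simp
      ultimately show ?thesis by (simp add: algebra_simps)
    qed
    finally show ?thesis .
  qed
  show ?thesis
  proof (intro exI[of _ "2 * c\<^sup>2 + 2"] conjI allI impI)
    show "1 \<le> 2 * c\<^sup>2 + 2" using zero_le_power2[of c] by linarith
  qed (rule main[unfolded d_def], auto)
qed

section \<open>Decay of the energy from a differential inequality\<close>

text \<open>The choice l = N / E balances the two terms and gives N' \<le> 2 K N^(1 - 1 / d) E^(1 /
  d). Hence N^(1 / d) has derivative at most c s^(- 1 / 2), which is integrable at 0. The initial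
  value 1 is absorbed because \<open>\<Lambda>\<close> and \<open>T\<close> are at least 1.\<close>

lemma weighted_energy_growth:
  fixes d :: nat and E N :: "real \<Rightarrow> real"
  assumes d: "1 \<le> d" and K: "0 \<le> K"
    and N: "\<And>t. 0 \<le> t \<Longrightarrow> \<exists>N'. (N has_real_derivative N') (at t) \<and>
        (\<forall>l>0. N' \<le> K * (N t * l powr (- 1 / real d) + E t * l powr (1 - 1 / d)))"
    and pos: "\<And>t. 0 \<le> t \<Longrightarrow> 0 < E t \<and> E t \<le> N t" and N0: "N 0 = 1"
    and T: "1 \<le> T" and L: "1 \<le> \<Lambda>" and E: "\<And>s. 0 < s \<Longrightarrow> s \<le> T \<Longrightarrow> E s \<le> \<Lambda> * s powr (- real d / 2)"
    and t: "0 \<le> t" "t \<le> T"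
  shows "N t \<le> (1 + 4 * K) ^ d * \<Lambda> * T powr (d / 2)"
proof -
  define c where "c = 2 * K / d * \<Lambda> powr (1 / d)"
  \<comment> \<open>The subtracted term is the integral of c s^(- 1 / 2). It is not differentiable
    at 0, so monotonicity is derived from the open interval and continuity on the closed
    one.\<close>
  define g where "g s = N s powr (1 / d) - 2 * c * s powr (1 / 2)" for s
  have Npos: "0 < N s" if "0 \<le> s" for s using pos[OF that] by linarith
  have dN: "\<exists>y. DERIV g s :> y \<and> y \<le> 0" if s: "0 < s" "s < t" for s
  proof -
    obtain N' where N': "(N has_real_derivative N') (at s)"
      and le: "\<And>l. l > 0 \<Longrightarrow> N' \<le> K * (N s * l powr (- 1 / real d) + E s * l powr (1 - 1 / d))"
      using N[of s] s by auto
    have p: "0 < N s" "0 < E s" using Npos[of s] pos[of s] s by auto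
    have "N' \<le> K * (N s * (N s / E s) powr (- 1 / real d) + E s * (N s / E s) powr (1 - 1 / d))"
      using p by (intro le) simp
    also have "N s * (N s / E s) powr (- 1 / real d) = N s powr (1 - 1 / d) * E s powr (1 / d)"
      using p by (simp add: powr_divide powr_diff powr_minus field_simps)
    also have "E s * (N s / E s) powr (1 - 1 / d) = N s powr (1 - 1 / d) * E s powr (1 / d)"
      using p by (simp add: powr_divide powr_diff field_simps)
    finally have 1: "N' \<le> 2 * K * (N s powr (1 - 1 / d) * E s powr (1 / d))" by (simp add: mult_ac)
    have "(g has_real_derivative (1 / d * N s powr (1 / d - 1) * N' - 2 * c * (1 / 2 * s powr (1 / 2 - 1)))) (at s)"
      unfolding g_def using p s
      by (auto intro!: derivative_eq_intros N' simp: mult_ac)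
    moreover have "1 / d * N s powr (1 / d - 1) * N' - 2 * c * (1 / 2 * s powr (1 / 2 - 1)) \<le> 0"
    proof -
      have "1 / d * N s powr (1 / d - 1) * N' \<le> 1 / d * N s powr (1 / d - 1) * (2 * K * (N s powr (1 - 1 / d) * E s powr (1 / d)))"
        using 1 by (intro mult_left_mono) auto
      also have "\<dots> = 2 * K / d * E s powr (1 / d) * (N s powr (1 / d - 1) * N s powr (1 - 1 / d))"
        by simp
      also have "N s powr (1 / d - 1) * N s powr (1 - 1 / d) = 1"
        using p by (simp flip: powr_add)
      also have "2 * K / d * E s powr (1 / d) * 1 \<le> 2 * K / d * (\<Lambda> * s powr (- real d / 2)) powr (1 / d) * 1"
        using K E[of s] s t p by (intro mult_right_mono mult_left_mono powr_mono2) auto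
      also have "(\<Lambda> * s powr (- real d / 2)) powr (1 / d) = \<Lambda> powr (1 / d) * s powr (- 1 / 2)"
        using L d by (simp add: powr_mult powr_powr)
      finally show ?thesis by (simp add: c_def)
    qed
    ultimately show ?thesis by blast
  qed
  have cont: "continuous_on {0..t} g"
  proof -
    have "continuous_on {0..t} N"
      using N by (intro continuous_at_imp_continuous_on) (metis DERIV_isCont atLeastAtMost_iff)
    then show ?thesis
      unfolding g_def using Npos
      by (intro continuous_intros continuous_on_powr') (auto simp: less_imp_neq[THEN not_sym] less_imp_le)
  qed
  have "g t \<le> g 0" by (rule DERIV_nonpos_imp_decreasing_open[OF t(1) dN cont])
  then have "N t powr (1 / d) \<le> 1 + 2 * c * t powr (1 / 2)" by (simp add: g_def N0)
  also have "\<dots> \<le> 1 * (\<Lambda> powr (1 / d) * T powr (1 / 2)) + 4 * K * (\<Lambda> powr (1 / d) * T powr (1 / 2))"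
  proof (rule add_mono)
    have "1 * 1 \<le> \<Lambda> powr (1 / d) * T powr (1 / 2)"
      using L T by (intro mult_mono) (auto intro!: ge_one_powr_ge_zero)
    then show "1 \<le> 1 * (\<Lambda> powr (1 / d) * T powr (1 / 2))" by simp
    have "2 * c * t powr (1 / 2) = 4 * (K / d) * (\<Lambda> powr (1 / d) * t powr (1 / 2))" by (simp add: c_def)
    also have "\<dots> \<le> 4 * K * (\<Lambda> powr (1 / d) * T powr (1 / 2))"
    proof (intro mult_mono mult_left_mono powr_mono2)
      show "K / d \<le> K" using K d mult_left_mono[of 1 "real d" K] by (simp add: field_simps)
    qed (use K t L in auto)
    finally show "2 * c * t powr (1 / 2) \<le> 4 * K * (\<Lambda> powr (1 / d) * T powr (1 / 2))" .
  qed
  finally have "N t powr (1 / d) \<le> (1 + 4 * K) * \<Lambda> powr (1 / d) * T powr (1 / 2)" by (simp add: algebra_simps)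
  then have "(N t powr (1 / d)) ^ d \<le> ((1 + 4 * K) * \<Lambda> powr (1 / d) * T powr (1 / 2)) ^ d"
    by (intro power_mono) auto
  also have "(N t powr (1 / d)) ^ d = N t"
    using d Npos[OF t(1)] by (simp add: powr_powr flip: powr_realpow)
  also have "((1 + 4 * K) * \<Lambda> powr (1 / d) * T powr (1 / 2)) ^ d = (1 + 4 * K) ^ d * \<Lambda> * T powr (d / 2)"
    using d L T by (simp add: power_mult_distrib powr_powr flip: powr_realpow)
  finally show ?thesis .
qed

text \<open>Balancing the Nash inequality leaves E^(1 + \<nu>) \<le> A D with \<nu> = (1 + \<delta>)
  / d; since E' = - 2 D, the function E^(- \<nu>) grows at least at the rate 2 \<nu> / A. The number
  \<open>Nb\<close> is one bound on N for all times up to \<open>T\<close>, which keeps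
  \<open>A\<close> constant.\<close>

lemma energy_decay:
  fixes d :: nat and E D N :: "real \<Rightarrow> real"
  assumes d: "1 \<le> d" and \<delta>: "0 < \<delta>" "\<delta> < 1" and K: "1 \<le> K" and T: "0 \<le> T"
    and dE: "\<And>t. 0 \<le> t \<Longrightarrow> (E has_real_derivative - 2 * D t) (at t)"
    and E: "\<And>t. 0 \<le> t \<Longrightarrow> 0 < E t \<and> E t \<le> 1" and D: "\<And>t. 0 \<le> t \<Longrightarrow> 0 \<le> D t"
    and nash: "\<And>t \<rho> R. 0 \<le> t \<Longrightarrow> 1 \<le> \<rho> \<Longrightarrow> \<rho> \<le> R \<Longrightarrow>
        E t \<le> K * (m\<^sup>2 * \<rho> powr (2 * \<delta>) * R powr (2 - 2 * \<delta>) * D t + 1 / \<rho> ^ d) + N t / R ^ (2 * d)"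
    and N: "\<And>t. 0 \<le> t \<Longrightarrow> t \<le> T \<Longrightarrow> N t \<le> Nb" and Nb: "4 * K \<le> E T * Nb"
  shows "2 * ((1 + \<delta>) / d) * T * E T powr ((1 + \<delta>) / d)
    \<le> 2 * K * (4 * K) powr ((1 + \<delta>) / d) * m\<^sup>2 * Nb powr ((1 - \<delta>) / d)"
proof -
  define \<nu> where "\<nu> = (1 + \<delta>) / d"
  define A where "A = 2 * K * (4 * K) powr \<nu> * m\<^sup>2 * Nb powr ((1 - \<delta>) / d)"
  have \<nu>: "\<nu> > 0" using \<delta> d by (simp add: \<nu>_def)
  have Nb0: "Nb > 0" using Nb K E[OF T] by (smt (verit) zero_less_mult_pos)
  have dec: "E T \<le> E t" if "0 \<le> t" "t \<le> T" for t
    using that(2)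
  proof (rule DERIV_nonpos_imp_nonincreasing)
    fix x assume "t \<le> x" "x \<le> T"
    then show "\<exists>y. DERIV E x :> y \<and> y \<le> 0" using dE[of x] D[of x] that by (intro exI[of _ "- 2 * D x"]) auto
  qed
  have key: "E t powr (1 + \<nu>) \<le> A * D t" if t: "0 \<le> t" "t \<le> T" for t
  proof -
    have e: "0 < E t" "E t \<le> 1" using E t by auto
    \<comment> \<open>With these choices \<open>K / \<rho> ^ d\<close> equals E / 4 and the term
      with N is at most E / 4, so half of E is left for the gradient term. The condition \<rho>
      \<le> R amounts to 4 K \<le> E Nb, which is assumed at time \<open>T\<close> and passes to
      earlier times because E decreases.\<close>
    define \<rho> where "\<rho> = (4 * K / E t) powr (1 / d)"
    define R where "R = (4 * K * Nb / E t) powr (1 / (2 * d))"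
    have "1 \<le> 4 * K / E t" using e K by (simp add: field_simps)
    then have \<rho>1: "1 \<le> \<rho>" unfolding \<rho>_def by (intro ge_one_powr_ge_zero) auto
    have \<rho>R: "\<rho> \<le> R"
    proof -
      have "4 * K \<le> E t * Nb" using Nb dec[OF t] Nb0 by (smt (verit) mult_right_mono)
      then have "4 * K / E t \<le> Nb" using e by (simp add: field_simps)
      then have "(4 * K / E t) * (4 * K / E t) \<le> (4 * K / E t) * Nb" using e K by (intro mult_left_mono) auto
      then have "((4 * K / E t) powr 2) powr (1 / (2 * d)) \<le> (4 * K * Nb / E t) powr (1 / (2 * d))"
        using e K by (intro powr_mono2) (auto simp: power2_eq_square)
      then show ?thesis by (simp add: \<rho>_def R_def powr_powr)
    qed
    have "\<rho> ^ d = 4 * K / E t" using d e K by (simp add: \<rho>_def powr_powr flip: powr_realpow)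
    then have r1: "K * (1 / \<rho> ^ d) = E t / 4" using K by simp
    have "R ^ (2 * d) = R powr real (2 * d)" using K e Nb0 by (subst powr_realpow) (auto simp: R_def)
    also have "\<dots> = 4 * K * Nb / E t" using d e K Nb0 by (simp add: R_def powr_powr)
    finally have "N t / R ^ (2 * d) = N t * E t / (4 * K * Nb)" by simp
    also have "\<dots> \<le> Nb * E t / (4 * K * Nb)" using N[OF t] e K Nb0 by (intro divide_right_mono mult_right_mono) auto
    also have "\<dots> = E t / (4 * K)" using Nb0 by simp
    also have "\<dots> \<le> E t / 4" using e K by (intro divide_left_mono) auto
    finally have r2: "N t / R ^ (2 * d) \<le> E t / 4" .
    \<comment> \<open>The exponents of 1 / E, namely 2 \<delta> / d from \<rho> and (1 - \<delta>) /
      d from R, add up to \<nu>.\<close>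
    have "\<rho> powr (2 * \<delta>) * R powr (2 - 2 * \<delta>) = (4 * K) powr \<nu> * E t powr (- \<nu>) * Nb powr ((1 - \<delta>) / d)"
    proof -
      have e1: "\<rho> powr (2 * \<delta>) = (4 * K / E t) powr (2 * \<delta> / d)" by (simp add: \<rho>_def powr_powr)
      have "1 / (2 * real d) * (2 - 2 * \<delta>) = (1 - \<delta>) / d" using d by (simp add: field_simps)
      then have "R powr (2 - 2 * \<delta>) = (4 * K / E t * Nb) powr ((1 - \<delta>) / d)" by (simp add: R_def powr_powr)
      also have "\<dots> = (4 * K / E t) powr ((1 - \<delta>) / d) * Nb powr ((1 - \<delta>) / d)"
        by (rule powr_mult)
      finally have "\<rho> powr (2 * \<delta>) * R powr (2 - 2 * \<delta>) = (4 * K / E t) powr (2 * \<delta> / d + (1 - \<delta>) / d) * Nb powr ((1 - \<delta>) / d)"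
        by (simp add: e1 powr_add)
      also have "2 * \<delta> / d + (1 - \<delta>) / d = \<nu>" using d by (simp add: \<nu>_def field_simps)
      also have "(4 * K / E t) powr \<nu> = (4 * K) powr \<nu> * E t powr (- \<nu>)"
        using e K by (simp add: powr_divide powr_minus_divide)
      finally show ?thesis .
    qed
    then have *: "K * (m\<^sup>2 * \<rho> powr (2 * \<delta>) * R powr (2 - 2 * \<delta>) * D t) = A / 2 * E t powr (- \<nu>) * D t"
      by (simp add: A_def mult.assoc)
    have "E t \<le> K * (m\<^sup>2 * \<rho> powr (2 * \<delta>) * R powr (2 - 2 * \<delta>) * D t) + K * (1 / \<rho> ^ d) + N t / R ^ (2 * d)"
      using nash[OF t(1) \<rho>1 \<rho>R] by (simp add: distrib_left)
    then have "E t \<le> A * E t powr (- \<nu>) * D t" using r1 r2 unfolding * by linarith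
    then have "E t powr \<nu> * E t \<le> E t powr \<nu> * (A * E t powr (- \<nu>) * D t)" by (intro mult_left_mono) auto
    also have "\<dots> = A * D t" using e by (simp add: powr_minus)
    finally show ?thesis using e by (simp add: powr_add mult.commute)
  qed
  \<comment> \<open>A priori \<open>m\<close>, and with it \<open>A\<close>, might vanish;
    \<open>key\<close> at time 0 excludes this, as E 0 is positive.\<close>
  have A0: "A > 0"
  proof -
    have "0 < E 0 powr (1 + \<nu>)" using E[of 0] by simp
    then have "0 < A * D 0" using key[of 0] T by linarith
    moreover have "A \<ge> 0" using K by (simp add: A_def)
    ultimately show ?thesis by (smt (verit) mult_eq_0_iff)
  qed
  define k where "k = 2 * \<nu> / A"
  define g where "g s = E s powr (- \<nu>) - k * s" for s
  have "g 0 \<le> g T"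
    using T
  proof (rule DERIV_nonneg_imp_nondecreasing)
    fix s assume s: "0 \<le> s" "s \<le> T"
    have e: "0 < E s" using E s by auto
    have "(g has_real_derivative (- \<nu> * E s powr (- \<nu> - 1) * (- 2 * D s) - k)) (at s)"
      unfolding g_def using e by (auto intro!: derivative_eq_intros dE[OF s(1)])
    moreover have "0 \<le> - \<nu> * E s powr (- \<nu> - 1) * (- 2 * D s) - k"
    proof -
      have "E s powr (- \<nu> - 1) * E s powr (1 + \<nu>) \<le> E s powr (- \<nu> - 1) * (A * D s)"
        using key[OF s] by (intro mult_left_mono) auto
      moreover have "E s powr (- \<nu> - 1) * E s powr (1 + \<nu>) = 1" using e by (simp flip: powr_add)
      ultimately have "1 \<le> A * (E s powr (- \<nu> - 1) * D s)" by (simp only: mult.left_commute)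
      then have "1 / A \<le> E s powr (- \<nu> - 1) * D s" using A0 by (simp add: pos_divide_le_eq mult.commute)
      then have "2 * \<nu> * (1 / A) \<le> 2 * \<nu> * (E s powr (- \<nu> - 1) * D s)" using \<nu> by (intro mult_left_mono) auto
      then show ?thesis by (simp add: k_def)
    qed
    ultimately show "\<exists>y. DERIV g s :> y \<and> 0 \<le> y" by blast
  qed
  then have "2 * \<nu> / A * T \<le> E T powr (- \<nu>)" using powr_ge_zero[of "E 0" "- \<nu>"] unfolding g_def k_def by linarith
  then have "A * (2 * \<nu> / A * T) * E T powr \<nu> \<le> A * E T powr (- \<nu>) * E T powr \<nu>"
    using A0 by (intro mult_right_mono mult_left_mono) auto
  also have "\<dots> = A" using E[OF T] by (simp add: powr_minus)
  also have "A * (2 * \<nu> / A * T) * E T powr \<nu> = 2 * \<nu> * T * E T powr \<nu>" using A0 by simp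
  finally show ?thesis by (simp add: A_def \<nu>_def)
qed

text \<open>The analytic core, detached from the lattice: E, D and N stand for the energy, its
  dissipation and the weighted energy.\<close>

lemma nash_ode:
  fixes d :: nat and \<delta> K :: real
  assumes d: "1 \<le> d" and \<delta>: "0 < \<delta>" "\<delta> < 1" and K: "1 \<le> K"
  shows "\<exists>C>0. \<forall>E N D m.
    (\<forall>t\<ge>0. (E has_real_derivative - 2 * D t) (at t)) \<longrightarrow>
    (\<forall>t\<ge>0. \<exists>N'. (N has_real_derivative N') (at t) \<and>
        (\<forall>l>0. N' \<le> K * (N t * l powr (- 1 / real d) + E t * l powr (1 - 1 / d)))) \<longrightarrow>
    E 0 = 1 \<longrightarrow> N 0 = 1 \<longrightarrow>
    (\<forall>t\<ge>0. 0 < E t \<and> E t \<le> 1 \<and> E t \<le> N t \<and> 0 \<le> D t \<and> D t \<le> K) \<longrightarrow> 0 \<le> m \<longrightarrow>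
    (\<forall>t\<ge>0. \<forall>\<rho> R. 1 \<le> \<rho> \<longrightarrow> \<rho> \<le> R \<longrightarrow>
        E t \<le> K * (m\<^sup>2 * \<rho> powr (2 * \<delta>) * R powr (2 - 2 * \<delta>) * D t + 1 / \<rho> ^ d) + N t / R ^ (2 * d)) \<longrightarrow>
    (\<forall>t>0. E t \<le> C * m powr (d / \<delta>) * t powr (- real d / 2))"
proof -
  define \<nu> where "\<nu> = (1 + \<delta>) / d"
  define K2 where "K2 = (1 + 4 * K) ^ d"
  define A where "A = 2 * K * (4 * K) powr \<nu> * K2 powr ((1 - \<delta>) / d) / (2 * \<nu>)"
  \<comment> \<open>The first summand covers the case \<Lambda> \<le> 1 through a lower bound on
    \<open>m\<close>; the second one comes out of the closed bootstrap.\<close>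
  define C where "C = (6 * K\<^sup>2) powr (d / \<delta>) + A powr (d / (2 * \<delta>))"
  have \<nu>: "\<nu> > 0" using \<delta> d by (simp add: \<nu>_def)
  have K2: "4 * K \<le> K2" using power_increasing[of 1 d "1 + 4 * K"] d K by (simp add: K2_def)
  have A0: "A \<ge> 0" using \<nu> K by (simp add: A_def)
  have C0: "C > 0" using K by (simp add: C_def add_pos_nonneg)
  have main: "E t \<le> C * m powr (d / \<delta>) * t powr (- real d / 2)"
    if dE: "\<And>t. 0 \<le> t \<Longrightarrow> (E has_real_derivative - 2 * D t) (at t)"
      and dN: "\<And>t. 0 \<le> t \<Longrightarrow> \<exists>N'. (N has_real_derivative N') (at t) \<and>
        (\<forall>l>0. N' \<le> K * (N t * l powr (- 1 / real d) + E t * l powr (1 - 1 / d)))"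
      and E0: "E 0 = 1" and N0: "N 0 = 1"
      and pos: "\<And>t. 0 \<le> t \<Longrightarrow> 0 < E t \<and> E t \<le> 1 \<and> E t \<le> N t \<and> 0 \<le> D t \<and> D t \<le> K" and m0: "0 \<le> m"
      and nash: "\<And>t \<rho> R. 0 \<le> t \<Longrightarrow> 1 \<le> \<rho> \<Longrightarrow> \<rho> \<le> R \<Longrightarrow>
        E t \<le> K * (m\<^sup>2 * \<rho> powr (2 * \<delta>) * R powr (2 - 2 * \<delta>) * D t + 1 / \<rho> ^ d) + N t / R ^ (2 * d)"
      and t: "t > 0"
    for E N D m t
  proof -
    \<comment> \<open>At time 0 both E and N equal 1. With \<rho> = R = 4 K the terms without
      \<open>m\<close> are at most 1 / 4 each, and the upper bound on \<open>D 0\<close> turns the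
      remaining half into a lower bound for \<open>m\<close>.\<close>
    have m_lower: "1 \<le> (6 * K\<^sup>2) * m"
    proof -
      have "1 \<le> 4 * K" "4 * K \<le> (4 * K) ^ d" using K d power_increasing[of 1 d "4 * K"] by simp_all
      moreover have "4 * K \<le> (4 * K) ^ (2 * d)" using K d power_increasing[of 1 "2 * d" "4 * K"] by simp
      ultimately have "K * (1 / (4 * K) ^ d) \<le> 1 / 4" "1 / (4 * K) ^ (2 * d) \<le> 1 / 4"
        using K by (simp_all add: field_simps)
      moreover have "1 \<le> K * (m\<^sup>2 * ((4 * K) powr (2 * \<delta>) * (4 * K) powr (2 - 2 * \<delta>)) * D 0) + K * (1 / (4 * K) ^ d) + 1 / (4 * K) ^ (2 * d)"
        using nash[of 0 "4 * K" "4 * K"] K E0 N0 by (simp add: distrib_left mult.assoc)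
      moreover have pw: "(4 * K) powr (2 * \<delta>) * (4 * K) powr (2 - 2 * \<delta>) = (4 * K)\<^sup>2"
        using K by (simp flip: powr_add)
      ultimately have "1 / 2 \<le> K * (m\<^sup>2 * (4 * K)\<^sup>2 * D 0)" unfolding pw by linarith
      also have "\<dots> \<le> K * (m\<^sup>2 * (4 * K)\<^sup>2 * K)" using pos[of 0] K by (intro mult_left_mono) auto
      finally have "1 \<le> 32 * (K\<^sup>2 * m)\<^sup>2" by (simp add: power2_eq_square mult_ac)
      also have "\<dots> \<le> ((6 * K\<^sup>2) * m)\<^sup>2" by (simp add: power_mult_distrib)
      finally have "1\<^sup>2 \<le> ((6 * K\<^sup>2) * m)\<^sup>2" by simp
      then show ?thesis by (rule power2_le_imp_le) (use m0 in simp)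
    qed
    define g where "g s = s powr (d / 2) * E s" for s
    have "continuous_on {0..t} E"
      using dE by (intro continuous_at_imp_continuous_on) (metis DERIV_isCont atLeastAtMost_iff)
    then have "continuous_on {0..t} g"
      unfolding g_def using d
      by (intro continuous_on_mult continuous_on_powr' continuous_on_id continuous_on_const) auto
    \<comment> \<open>The maximum over a compact interval exists, so \<Lambda> is finite before any
      decay is known.\<close>
    then obtain T where T: "0 \<le> T" "T \<le> t" and max: "\<And>s. 0 \<le> s \<Longrightarrow> s \<le> t \<Longrightarrow> g s \<le> g T"
      using continuous_attains_sup[of "{0..t}" g] t by auto
    have "g T \<le> C * m powr (d / \<delta>)"
    proof (cases "g T \<le> 1")
      case True
      also have "1 \<le> ((6 * K\<^sup>2) * m) powr (d / \<delta>)" using m_lower \<delta> by (intro ge_one_powr_ge_zero) auto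
      also have "\<dots> = (6 * K\<^sup>2) powr (d / \<delta>) * m powr (d / \<delta>)" using m0 by (intro powr_mult)
      also have "\<dots> \<le> C * m powr (d / \<delta>)" unfolding C_def by (intro mult_right_mono) auto
      finally show ?thesis .
    next
      case False
      define \<Lambda> where "\<Lambda> = g T"
      have L: "\<Lambda> > 1" using False by (simp add: \<Lambda>_def)
      have T1: "1 \<le> T"
      proof (rule ccontr)
        assume "\<not> 1 \<le> T"
        then have "T powr (d / 2) \<le> 1" using T by (intro powr_le1) auto
        then have "T powr (d / 2) * E T \<le> 1 * 1" using pos[OF T(1)] by (intro mult_mono) auto
        then show False using L by (simp add: \<Lambda>_def g_def)
      qed
      have ub: "E s \<le> \<Lambda> * s powr (- real d / 2)" if "0 < s" "s \<le> T" for s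
      proof -
        have "s powr (d / 2) * E s \<le> \<Lambda>" using max[of s] that T by (simp add: g_def[of s] \<Lambda>_def)
        then show ?thesis using that by (simp add: powr_minus field_simps)
      qed
      have ET: "E T = \<Lambda> * T powr (- real d / 2)" using T1 by (simp add: \<Lambda>_def g_def powr_minus)
      define Nb where "Nb = K2 * \<Lambda> * T powr (d / 2)"
      have K0: "K \<ge> 0" using K by simp
      have Nle: "N s \<le> Nb" if "0 \<le> s" "s \<le> T" for s
        unfolding Nb_def K2_def
        by (rule weighted_energy_growth[OF d K0 dN _ N0 T1 _ ub]) (use pos L that in auto)
      have "E T * Nb = K2 * (\<Lambda> * \<Lambda>)" using T1 by (simp add: ET Nb_def powr_minus)
      moreover have "K2 * 1 \<le> K2 * (\<Lambda> * \<Lambda>)" using L K2 K mult_mono[of 1 \<Lambda> 1 \<Lambda>] by (intro mult_left_mono) auto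
      ultimately have "4 * K \<le> E T * Nb" using K2 by linarith
      then have "2 * \<nu> * T * E T powr \<nu> \<le> 2 * K * (4 * K) powr \<nu> * m\<^sup>2 * Nb powr ((1 - \<delta>) / d)"
        unfolding \<nu>_def by (intro energy_decay[where D = D and N = N, OF d \<delta> K T(1) dE _ _ nash Nle]) (use pos in auto)
      also have "Nb powr ((1 - \<delta>) / d) = K2 powr ((1 - \<delta>) / d) * \<Lambda> powr ((1 - \<delta>) / d) * T powr ((1 - \<delta>) / 2)"
        using K2 K L T1 d by (simp add: Nb_def powr_mult powr_powr)
      also have "E T powr \<nu> = \<Lambda> powr \<nu> * T powr (- (1 + \<delta>) / 2)"
      proof -
        have "- real d / 2 * \<nu> = - (1 + \<delta>) / 2" using d by (simp add: \<nu>_def) (simp add: field_simps)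
        then have "(T powr (- real d / 2)) powr \<nu> = T powr (- (1 + \<delta>) / 2)" by (simp only: powr_powr)
        then show ?thesis using L by (simp add: ET powr_mult del: powr_powr)
      qed
      \<comment> \<open>Both sides carry T^((1 - \<delta>) / 2), which cancels. The powers of
        \<Lambda> leave \<nu> - (1 - \<delta>) / d = 2 \<delta> / d > 0, which closes the circular
        estimate.\<close>
      finally have "2 * \<nu> * (T * T powr (- (1 + \<delta>) / 2)) * \<Lambda> powr \<nu> \<le> (2 * \<nu> * A) * m\<^sup>2 * \<Lambda> powr ((1 - \<delta>) / d) * T powr ((1 - \<delta>) / 2)"
        using \<nu> by (simp add: A_def mult_ac)
      also have "T * T powr (- (1 + \<delta>) / 2) = T powr ((1 - \<delta>) / 2)"
        using T1 by (simp add: powr_mult_base) (simp add: field_simps)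
      finally have "(2 * \<nu> * T powr ((1 - \<delta>) / 2)) * \<Lambda> powr \<nu> \<le> (2 * \<nu> * T powr ((1 - \<delta>) / 2)) * (A * m\<^sup>2 * \<Lambda> powr ((1 - \<delta>) / d))"
        by (simp add: mult_ac)
      then have "\<Lambda> powr \<nu> \<le> A * m\<^sup>2 * \<Lambda> powr ((1 - \<delta>) / d)"
        using \<nu> T1 by (simp add: mult_le_cancel_left_pos)
      then have "\<Lambda> powr \<nu> * \<Lambda> powr (- ((1 - \<delta>) / d)) \<le> A * m\<^sup>2 * \<Lambda> powr ((1 - \<delta>) / d) * \<Lambda> powr (- ((1 - \<delta>) / d))"
        by (intro mult_right_mono) auto
      also have "\<dots> = A * m\<^sup>2" using L by (simp add: powr_minus)
      also have "\<Lambda> powr \<nu> * \<Lambda> powr (- ((1 - \<delta>) / d)) = \<Lambda> powr (2 * \<delta> / d)"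
      proof -
        have "\<nu> + - ((1 - \<delta>) / d) = 2 * \<delta> / d" by (simp add: \<nu>_def add_divide_distrib diff_divide_distrib)
        then show ?thesis by (metis powr_add)
      qed
      finally have "(\<Lambda> powr (2 * \<delta> / d)) powr (d / (2 * \<delta>)) \<le> (A * m\<^sup>2) powr (d / (2 * \<delta>))"
        using \<delta> by (intro powr_mono2) auto
      also have "(\<Lambda> powr (2 * \<delta> / d)) powr (d / (2 * \<delta>)) = \<Lambda>" using L \<delta> d by (simp add: powr_powr)
      also have "(A * m\<^sup>2) powr (d / (2 * \<delta>)) = A powr (d / (2 * \<delta>)) * m powr (d / \<delta>)"
      proof -
        have "m\<^sup>2 powr (d / (2 * \<delta>)) = (m powr 2) powr (d / (2 * \<delta>))" using m0 by simp
        also have "\<dots> = m powr (d / \<delta>)" by (simp only: powr_powr) simp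
        finally show ?thesis using A0 m0 by (simp add: powr_mult)
      qed
      also have "\<dots> \<le> C * m powr (d / \<delta>)" unfolding C_def by (intro mult_right_mono) auto
      finally show ?thesis by (simp add: \<Lambda>_def)
    qed
    then have "g t \<le> C * m powr (d / \<delta>)" using max[of t] t by auto
    then show ?thesis using t by (simp add: g_def powr_minus field_simps)
  qed
  show ?thesis
  proof (intro exI[of _ C] conjI C0 allI impI)
    fix E N D :: "real \<Rightarrow> real" and m t :: real
    assume a: "\<forall>t\<ge>0. (E has_real_derivative - 2 * D t) (at t)"
      "\<forall>t\<ge>0. \<exists>N'. (N has_real_derivative N') (at t) \<and>
        (\<forall>l>0. N' \<le> K * (N t * l powr (- 1 / d) + E t * l powr (1 - 1 / d)))"
      "E 0 = 1" "N 0 = 1"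
      "\<forall>t\<ge>0. 0 < E t \<and> E t \<le> 1 \<and> E t \<le> N t \<and> 0 \<le> D t \<and> D t \<le> K" "0 \<le> m"
      "\<forall>t\<ge>0. \<forall>\<rho> R. 1 \<le> \<rho> \<longrightarrow> \<rho> \<le> R \<longrightarrow>
        E t \<le> K * (m\<^sup>2 * \<rho> powr (2 * \<delta>) * R powr (2 - 2 * \<delta>) * D t + 1 / \<rho> ^ d) + N t / R ^ (2 * d)"
      "0 < t"
    show "E t \<le> C * m powr (d / \<delta>) * t powr (- real d / 2)"
      by (rule main[OF a(1)[THEN spec, THEN mp] a(2)[THEN spec, THEN mp] a(3,4) a(5)[THEN spec, THEN mp] a(6)
          a(7)[THEN spec, THEN mp, THEN spec, THEN spec, THEN mp, THEN mp] a(8)])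
  qed
qed

section \<open>The heat kernel\<close>

lemma has_sum_finite_sum:
  fixes f :: "'i \<Rightarrow> 'a \<Rightarrow> real"
  assumes "finite I" "\<And>i. i \<in> I \<Longrightarrow> (f i has_sum s i) A"
  shows "((\<lambda>x. \<Sum>i\<in>I. f i x) has_sum (\<Sum>i\<in>I. s i)) A"
  using assms by (induction I) (auto intro: has_sum_add)

lemma has_sum_real_diff:
  fixes f g :: "'a \<Rightarrow> real"
  assumes "(f has_sum x) A" "(g has_sum y) A"
  shows "((\<lambda>z. f z - g z) has_sum (x - y)) A"
proof -
  have "((\<lambda>z. - g z) has_sum (- y)) A" using assms(2) by (simp add: has_sum_uminus)
  from has_sum_add[OF assms(1) this] show ?thesis by simp
qed

lemma summable_on_real_diff:
  fixes f g :: "'a \<Rightarrow> real"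
  shows "f summable_on A \<Longrightarrow> g summable_on A \<Longrightarrow> (\<lambda>z. f z - g z) summable_on A"
  unfolding summable_on_def by (blast intro: has_sum_real_diff)

lemma infsum_real_diff:
  fixes f g :: "'a \<Rightarrow> real"
  assumes "f summable_on A" "g summable_on A"
  shows "infsum (\<lambda>z. f z - g z) A = infsum f A - infsum g A"
  using assms by (intro infsumI has_sum_real_diff has_sum_infsum)

lemma summable_on_bounded_mult:
  fixes f g :: "'a \<Rightarrow> real"
  assumes "f summable_on A" "\<And>x. x \<in> A \<Longrightarrow> \<bar>g x\<bar> \<le> B"
  shows "(\<lambda>x. g x * f x) summable_on A"
proof -
  have "(\<lambda>x. B * f x) summable_on A" using assms(1) by (rule summable_on_cmult_right)
  then have "(\<lambda>x. norm (B * f x)) summable_on A" by (rule summable_on_iff_abs_summable_on_real[THEN iffD1])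
  then have "(\<lambda>x. norm (g x * f x)) summable_on A"
  proof (rule Infinite_Sum.abs_summable_on_comparison_test)
    fix x assume "x \<in> A"
    then have "\<bar>g x\<bar> \<le> \<bar>B\<bar>" using assms(2)[of x] by linarith
    then show "norm (g x * f x) \<le> norm (B * f x)" by (simp add: abs_mult mult_right_mono)
  qed
  then show ?thesis by (rule summable_on_iff_abs_summable_on_real[THEN iffD2])
qed

lemma bij_shift: "bij (\<lambda>y :: 'a::group_add. y + v)"
  by (intro bij_betwI[where g = "\<lambda>y. y - v"]) auto

lemma infsum_shift:
  fixes f :: "'a::group_add \<Rightarrow> real"
  shows "(\<Sum>\<^sub>\<infinity>y. f (y + v)) = (\<Sum>\<^sub>\<infinity>y. f y)"
  by (rule infsum_reindex_bij_betw[OF bij_shift])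

lemma summable_on_shift_iff:
  fixes f :: "'a::group_add \<Rightarrow> real"
  shows "(\<lambda>y. f (y + v)) summable_on UNIV \<longleftrightarrow> f summable_on UNIV"
  by (rule summable_on_reindex_bij_betw[OF bij_shift])

text \<open>An enumeration of the index type reduces this to termwise differentiation of a series,
  with the Weierstrass test for the derivatives. The window is symmetric about 0, so derivatives at
  time 0 are two-sided.\<close>

lemma has_real_derivative_infsum:
  fixes F F' :: "real \<Rightarrow> 'a::countable \<Rightarrow> real"
  assumes inf: "infinite (UNIV :: 'a set)"
    and F: "\<And>t y. \<bar>t\<bar> < T \<Longrightarrow> ((\<lambda>t. F t y) has_real_derivative F' t y) (at t)"
    and M: "\<And>t y. \<bar>t\<bar> < T \<Longrightarrow> \<bar>F' t y\<bar> \<le> M y" "M summable_on UNIV"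
    and sum: "\<And>t. \<bar>t\<bar> < T \<Longrightarrow> F t summable_on UNIV" and t: "\<bar>t\<bar> < T"
  shows "((\<lambda>t. \<Sum>\<^sub>\<infinity>y. F t y) has_real_derivative (\<Sum>\<^sub>\<infinity>y. F' t y)) (at t)"
proof -
  define \<beta> :: "nat \<Rightarrow> 'a" where "\<beta> = from_nat_into UNIV"
  have \<beta>: "bij \<beta>" unfolding \<beta>_def by (rule bij_betw_from_nat_into) (use inf in auto)
  have to_suminf: "infsum f UNIV = (\<Sum>n. f (\<beta> n)) \<and> summable (\<lambda>n. f (\<beta> n))"
    if "f summable_on UNIV" for f :: "'a \<Rightarrow> real"
  proof -
    have "(\<lambda>n. f (\<beta> n)) summable_on UNIV" using that summable_on_reindex_bij_betw[OF \<beta>, of f] by simp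
    then have "((\<lambda>n. f (\<beta> n)) has_sum infsum (\<lambda>n. f (\<beta> n)) UNIV) UNIV" by (rule has_sum_infsum)
    then have "(\<lambda>n. f (\<beta> n)) sums infsum (\<lambda>n. f (\<beta> n)) UNIV" by (rule has_sum_imp_sums)
    then show ?thesis using infsum_reindex_bij_betw[OF \<beta>, of f] by (simp add: sums_iff)
  qed
  have sF': "F' s summable_on UNIV" if "\<bar>s\<bar> < T" for s
  proof -
    have "(\<lambda>y. norm (F' s y)) summable_on UNIV"
      by (rule summable_on_comparison_test[OF M(2)]) (use M(1)[OF that] in auto)
    then show ?thesis by (rule summable_on_iff_abs_summable_on_real[THEN iffD2])
  qed
  let ?S = "{-T<..<T}"
  have inS: "\<bar>x\<bar> < T" if "x \<in> ?S" for x using that by (simp add: abs_less_iff minus_less_iff)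
  have tS: "t \<in> interior ?S" using t by auto
  have unif: "uniformly_convergent_on ?S (\<lambda>n x. \<Sum>i<n. F' x (\<beta> i))"
  proof (rule Weierstrass_m_test'[where M = "\<lambda>n. M (\<beta> n)"])
    show "summable (\<lambda>n. M (\<beta> n))" using to_suminf[OF M(2)] by simp
    show "norm (F' x (\<beta> n)) \<le> M (\<beta> n)" if "x \<in> ?S" for n x using M(1)[OF inS[OF that], of "\<beta> n"] by simp
  qed
  have "((\<lambda>x. \<Sum>n. F x (\<beta> n)) has_field_derivative (\<Sum>n. F' t (\<beta> n))) (at t)"
  proof (rule has_field_derivative_series'(2)[where S = ?S and x0 = t and f = "\<lambda>n x. F x (\<beta> n)" and f' = "\<lambda>n x. F' x (\<beta> n)"])
    show "((\<lambda>t. F t (\<beta> n)) has_field_derivative F' x (\<beta> n)) (at x within ?S)" if "x \<in> ?S" for n x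
      by (rule has_field_derivative_at_within[OF F[OF inS[OF that]]])
    show "uniformly_convergent_on ?S (\<lambda>n x. \<Sum>i<n. F' x (\<beta> i))" by (rule unif)
    show "t \<in> interior ?S" by (rule tS)
    show "t \<in> ?S" using t by auto
    show "summable (\<lambda>n. F t (\<beta> n))" using to_suminf[OF sum[OF t]] by simp
  qed simp
  also have "(\<Sum>n. F' t (\<beta> n)) = (\<Sum>\<^sub>\<infinity>y. F' t y)" using to_suminf[OF sF'[OF t]] by simp
  finally show ?thesis
  proof (rule has_field_derivative_transform_within_open[where S = ?S])
    show "(\<Sum>n. F x (\<beta> n)) = (\<Sum>\<^sub>\<infinity>y. F x y)" if "x \<in> ?S" for x
      using to_suminf[OF sum[OF inS[OF that]]] by simp
  qed (use t in auto)
qed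

lemma infinite_lattice: "infinite (UNIV :: (int ^ 'd::finite) set)"
proof -
  have "inj (\<lambda>n :: int. (axis undefined n :: int ^ 'd))" by (auto simp: inj_on_def axis_eq_axis)
  then show ?thesis using infinite_UNIV_int finite_subset[OF subset_UNIV] finite_imageD by metis
qed

section \<open>The Laplacian and summation by parts\<close>

definition lap :: "('d::finite edge \<Rightarrow> real) \<Rightarrow> (int ^ 'd \<Rightarrow> real) \<Rightarrow> int ^ 'd \<Rightarrow> real" where
  "lap a f y = (\<Sum>z\<in>{z. adjacent z y}. a {y, z} * (f z - f y))"

text \<open>Divergence form: in each direction the difference of the fluxes through the two edges at
  the vertex.\<close>

lemma lap_eq:
  "lap a f y = (\<Sum>i\<in>UNIV. a (edge_at y i) * (f (y + axis i 1) - f y)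
     - a (edge_at (y - axis i 1) i) * (f y - f (y - axis i 1)))"
  unfolding lap_def sum_adjacent edge_at_def
  by (intro sum.cong refl) (simp add: insert_commute algebra_simps)

lemma static_environmentD:
  "static_environment a \<Longrightarrow> 0 \<le> a (edge_at y i)" "static_environment a \<Longrightarrow> a (edge_at y i) \<le> 1"
  by (simp_all add: static_environment_def)

lemma abs_lap_le:
  fixes f :: "int ^ 'd::finite \<Rightarrow> real" and B :: real
  assumes a: "static_environment a" and f: "\<And>y. \<bar>f y\<bar> \<le> B"
  shows "\<bar>lap a f y\<bar> \<le> 4 * real CARD('d) * B"
proof -
  have p: "\<bar>a (edge_at x i) * (f u - f v)\<bar> \<le> 2 * B" for x i u v
  proof -
    have "\<bar>a (edge_at x i) * (f u - f v)\<bar> \<le> 1 * (2 * B)"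
      unfolding abs_mult using static_environmentD[OF a, of x i] f[of u] f[of v]
      by (intro mult_mono) auto
    then show ?thesis by simp
  qed
  have "\<bar>lap a f y\<bar> \<le> (\<Sum>i\<in>UNIV. \<bar>a (edge_at y i) * (f (y + axis i 1) - f y) - a (edge_at (y - axis i 1) i) * (f y - f (y - axis i 1))\<bar>)"
    unfolding lap_eq by (rule sum_abs)
  also have "\<dots> \<le> (\<Sum>i\<in>(UNIV :: 'd set). 4 * B)"
  proof (rule sum_mono)
    fix i
    show "\<bar>a (edge_at y i) * (f (y + axis i 1) - f y) - a (edge_at (y - axis i 1) i) * (f y - f (y - axis i 1))\<bar> \<le> 4 * B"
      using p[of y i "y + axis i 1" y] p[of "y - axis i 1" i y "y - axis i 1"] by linarith
  qed
  finally show ?thesis by simp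
qed

text \<open>In the divergence form the second flux is the first one shifted by a unit vector, and
  sums over the lattice are invariant under shifts. Summability of \<open>f\<close> and boundedness
  of \<open>g\<close> make every series converge, which admits constants and weighted kernels as
  \<open>g\<close>.\<close>

lemma green:
  fixes f g :: "int ^ 'd::finite \<Rightarrow> real"
  assumes a: "static_environment a" and f: "f summable_on UNIV" and g: "\<And>y. \<bar>g y\<bar> \<le> B"
  shows "((\<lambda>y. g y * lap a f y) has_sum
    - (\<Sum>i\<in>UNIV. \<Sum>\<^sub>\<infinity>y. a (edge_at y i) * (g (y + axis i 1) - g y) * (f (y + axis i 1) - f y))) UNIV"
    and "(\<lambda>y. a (edge_at y i) * (g (y + axis i 1) - g y) * (f (y + axis i 1) - f y)) summable_on UNIV"
proof -
  define A where "A i y = a (edge_at y i) * (f (y + axis i 1) - f y)" for i y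
  have sA: "A i summable_on UNIV" for i
    unfolding A_def
    by (intro summable_on_bounded_mult[where B = 1] summable_on_real_diff summable_on_shift_iff[THEN iffD2] f)
      (simp add: static_environmentD[OF a])
  have s1: "(\<lambda>y. g y * A i y) summable_on UNIV" for i by (rule summable_on_bounded_mult[OF sA g])
  have s2: "(\<lambda>y. g (y + axis i 1) * A i y) summable_on UNIV" for i by (rule summable_on_bounded_mult[OF sA g])
  have s3: "(\<lambda>y. g y * A i (y - axis i 1)) summable_on UNIV" for i
    using s2 summable_on_shift_iff[of "\<lambda>y. g y * A i (y - axis i 1)" "axis i 1"] by simp
  have i3: "(\<Sum>\<^sub>\<infinity>y. g y * A i (y - axis i 1)) = (\<Sum>\<^sub>\<infinity>y. g (y + axis i 1) * A i y)" for i
    using infsum_shift[of "\<lambda>y. g y * A i (y - axis i 1)" "axis i 1"] by simp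
  have eq: "a (edge_at y i) * (g (y + axis i 1) - g y) * (f (y + axis i 1) - f y) = g (y + axis i 1) * A i y - g y * A i y" for i y
    by (simp add: A_def algebra_simps)
  show "(\<lambda>y. a (edge_at y i) * (g (y + axis i 1) - g y) * (f (y + axis i 1) - f y)) summable_on UNIV"
    unfolding eq by (intro summable_on_real_diff s1 s2)
  have "((\<lambda>y. g y * A i y - g y * A i (y - axis i 1)) has_sum
    - (\<Sum>\<^sub>\<infinity>y. g (y + axis i 1) * A i y - g y * A i y)) UNIV" for i
  proof -
    have "((\<lambda>y. g y * A i y - g y * A i (y - axis i 1)) has_sum
      ((\<Sum>\<^sub>\<infinity>y. g y * A i y) - (\<Sum>\<^sub>\<infinity>y. g y * A i (y - axis i 1)))) UNIV"
      by (intro has_sum_real_diff has_sum_infsum s1 s3)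
    also have "(\<Sum>\<^sub>\<infinity>y. g y * A i y) - (\<Sum>\<^sub>\<infinity>y. g y * A i (y - axis i 1)) = - (\<Sum>\<^sub>\<infinity>y. g (y + axis i 1) * A i y - g y * A i y)"
      unfolding i3 by (simp add: infsum_real_diff[OF s2 s1])
    finally show ?thesis .
  qed
  then have "((\<lambda>y. \<Sum>i\<in>UNIV. g y * A i y - g y * A i (y - axis i 1)) has_sum
    (\<Sum>i\<in>UNIV. - (\<Sum>\<^sub>\<infinity>y. g (y + axis i 1) * A i y - g y * A i y))) UNIV"
    by (intro has_sum_finite_sum) auto
  moreover have "g y * lap a f y = (\<Sum>i\<in>UNIV. g y * A i y - g y * A i (y - axis i 1))" for y
    by (simp add: lap_eq A_def sum_distrib_left right_diff_distrib)
  ultimately show "((\<lambda>y. g y * lap a f y) has_sum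
    - (\<Sum>i\<in>UNIV. \<Sum>\<^sub>\<infinity>y. a (edge_at y i) * (g (y + axis i 1) - g y) * (f (y + axis i 1) - f y))) UNIV"
    by (simp add: eq sum_negf)
qed

lemma green_symmetric:
  fixes f g :: "int ^ 'd::finite \<Rightarrow> real"
  assumes a: "static_environment a" and f: "f summable_on UNIV" and g: "g summable_on UNIV"
    and bd: "\<And>y. \<bar>f y\<bar> \<le> B" "\<And>y. \<bar>g y\<bar> \<le> B"
  shows "(\<Sum>\<^sub>\<infinity>y. lap a f y * g y - f y * lap a g y) = 0"
proof -
  have h: "((\<lambda>y. g y * lap a f y - f y * lap a g y) has_sum
    - (\<Sum>i\<in>UNIV. \<Sum>\<^sub>\<infinity>y. a (edge_at y i) * (g (y + axis i 1) - g y) * (f (y + axis i 1) - f y))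
     - - (\<Sum>i\<in>UNIV. \<Sum>\<^sub>\<infinity>y. a (edge_at y i) * (f (y + axis i 1) - f y) * (g (y + axis i 1) - g y))) UNIV"
    by (intro has_sum_real_diff green(1)[OF a f bd(2)] green(1)[OF a g bd(1)])
  have "(\<Sum>i\<in>UNIV. \<Sum>\<^sub>\<infinity>y. a (edge_at y i) * (f (y + axis i 1) - f y) * (g (y + axis i 1) - g y)) =
    (\<Sum>i\<in>UNIV. \<Sum>\<^sub>\<infinity>y. a (edge_at y i) * (g (y + axis i 1) - g y) * (f (y + axis i 1) - f y))"
    by (simp add: mult.assoc mult.commute[of "f _ - f _"])
  with h show ?thesis by (simp add: infsumI mult.commute)
qed

section \<open>A lazy random walk of bounded speed\<close>

definition l1 :: "int ^ 'd::finite \<Rightarrow> int" where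
  "l1 y = (\<Sum>i\<in>UNIV. \<bar>y $ i\<bar>)"

lemma l1_nonneg [simp]: "0 \<le> l1 y" and l1_zero [simp]: "l1 0 = 0"
  by (simp_all add: l1_def sum_nonneg)

lemma l1_diff_le: "\<bar>l1 (y + axis i 1) - l1 y\<bar> \<le> 1"
proof -
  have "l1 (y + axis i 1) - l1 y = (\<Sum>j\<in>UNIV. \<bar>(y + axis i 1) $ j\<bar> - \<bar>y $ j\<bar>)"
    by (simp add: l1_def sum_subtractf)
  also have "\<dots> = (\<Sum>j\<in>UNIV. if j = i then \<bar>y $ i + 1\<bar> - \<bar>y $ i\<bar> else 0)"
    by (intro sum.cong) (auto simp: axis_def)
  finally show ?thesis by simp
qed

text \<open>As \<open>a\<close> \<le> 1, the jump rates at a vertex add up to at most 2 d; division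
  by 2 d turns them into the transition probabilities of a lazy random walk.\<close>

definition walk :: "('d::finite edge \<Rightarrow> real) \<Rightarrow> (int ^ 'd \<Rightarrow> real) \<Rightarrow> int ^ 'd \<Rightarrow> real" where
  "walk a f y = f y + lap a f y / (2 * real CARD('d))"

primrec walk_prob :: "('d::finite edge \<Rightarrow> real) \<Rightarrow> nat \<Rightarrow> int ^ 'd \<Rightarrow> real" where
  "walk_prob a 0 = (\<lambda>y. if 0 = y then 1 else 0)"
| "walk_prob a (Suc n) = walk a (walk_prob a n)"

lemma walk_nonneg:
  fixes f :: "int ^ 'd::finite \<Rightarrow> real"
  assumes a: "static_environment a" and f: "\<And>y. 0 \<le> f y"
  shows "0 \<le> walk a f y"
proof -
  have p: "- f y \<le> a (edge_at x i) * (f z - f y)" for x i z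
  proof -
    have "a (edge_at x i) * f y \<le> 1 * f y" using static_environmentD[OF a] f by (intro mult_right_mono)
    moreover have "0 \<le> a (edge_at x i) * f z" using static_environmentD[OF a] f by simp
    ultimately show ?thesis by (simp add: right_diff_distrib)
  qed
  have "(\<Sum>i\<in>(UNIV :: 'd set). - f y + - f y) \<le> lap a f y"
    unfolding lap_eq
  proof (rule sum_mono)
    fix i
    show "- f y + - f y \<le> a (edge_at y i) * (f (y + axis i 1) - f y) - a (edge_at (y - axis i 1) i) * (f y - f (y - axis i 1))"
      using p[of y i "y + axis i 1"] p[of "y - axis i 1" i "y - axis i 1"]
      by (simp add: right_diff_distrib)
  qed
  then have "- (2 * real CARD('d)) * f y \<le> lap a f y" by simp
  then have "- f y \<le> lap a f y / (2 * real CARD('d))" by (simp add: field_simps)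
  then show ?thesis by (simp add: walk_def)
qed

lemma walk_prob_nonneg: "static_environment a \<Longrightarrow> 0 \<le> walk_prob a n y"
  by (induction n arbitrary: y) (auto intro: walk_nonneg)

text \<open>One step changes the distance from the origin by at most 1.\<close>

lemma walk_prob_eq_0: "int n < l1 y \<Longrightarrow> walk_prob a n y = 0"
proof (induction n arbitrary: y)
  case 0
  then show ?case by auto
next
  case (Suc n)
  have "walk_prob a n (y + axis i 1) = 0" "walk_prob a n (y - axis i 1) = 0" for i
    using Suc l1_diff_le[of y i] l1_diff_le[of "y - axis i 1" i] by auto
  then show ?case using Suc by (simp add: walk_def lap_eq)
qed

lemma has_sum_walk_prob:
  assumes a: "static_environment a"
  shows "(walk_prob a n has_sum 1) (UNIV :: (int ^ 'd::finite) set)"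
proof (induction n)
  case 0
  have "(walk_prob a 0 has_sum 1) {0}" by (intro has_sum_finiteI) auto
  also have "?this \<longleftrightarrow> ?case" by (rule has_sum_cong_neutral) auto
  finally show ?case .
next
  case (Suc n)
  \<comment> \<open>Mass conservation is summation by parts against the constant 1.\<close>
  have "((\<lambda>y. 1 * lap a (walk_prob a n) y) has_sum 0) UNIV"
    using green(1)[OF a has_sum_imp_summable[OF Suc.IH], of "\<lambda>_. 1" 1] by simp
  then have "(lap a (walk_prob a n) has_sum 0) UNIV" by simp
  from has_sum_cmult_left[OF this, of "1 / (2 * real CARD('d))"]
  have "((\<lambda>y. walk_prob a n y + lap a (walk_prob a n) y * (1 / (2 * real CARD('d)))) has_sum 1 + 0 * (1 / (2 * CARD('d)))) UNIV"
    by (intro has_sum_add Suc.IH) simp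
  then show ?case by (simp add: walk_def[abs_def])
qed

lemma sum_walk_prob_le:
  assumes "static_environment a" "finite S"
  shows "sum (walk_prob a n) S \<le> 1"
  using finite_sum_le_has_sum[OF has_sum_walk_prob[OF assms(1)] assms(2)] walk_prob_nonneg[OF assms(1)] by auto

lemma walk_prob_le: "static_environment a \<Longrightarrow> walk_prob a n y \<le> 1"
  using sum_walk_prob_le[of a "{y}" n] by simp

section \<open>The kernel as a Poisson series\<close>

lemma power_le_fact_exp:
  assumes "0 \<le> (x :: real)"
  shows "x ^ k \<le> fact k * exp x"
proof -
  have s: "(\<lambda>n. x ^ n / fact n) sums exp x" using exp_converges[of x] by (simp add: field_simps scaleR_conv_of_real)
  have "(\<Sum>n\<in>{k}. x ^ n / fact n) \<le> exp x"
    unfolding sums_unique[OF s] by (rule sum_le_suminf[OF sums_summable[OF s]]) (use assms in auto)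
  then show ?thesis by (simp add: field_simps)
qed

lemma walk_cmult: "walk a (\<lambda>y. c * f y) y = c * walk a f y"
  and lap_cmult: "lap a (\<lambda>y. c * f y) y = c * lap a f y"
proof -
  show l: "lap a (\<lambda>y. c * f y) y = c * lap a f y"
    unfolding lap_def sum_distrib_left by (intro sum.cong) (auto simp: algebra_simps)
  show "walk a (\<lambda>y. c * f y) y = c * walk a f y" by (simp add: walk_def l algebra_simps)
qed

text \<open>The exponential generating function of the walk, without the Poisson factor exp(- s).
  Its coefficients are nonnegative, so values at negative times are dominated by those at positive
  ones.\<close>

definition pois :: "('d::finite edge \<Rightarrow> real) \<Rightarrow> real \<Rightarrow> int ^ 'd \<Rightarrow> real" where
  "pois a s y = (\<Sum>n. walk_prob a n y / fact n * s ^ n)"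

text \<open>The walk with transition operator \<open>I + L / (2 d)\<close>, run at the times of a Poisson process of
  intensity \<open>2 d\<close>; the series makes sense for all real times.\<close>

definition pkernel :: "('d::finite edge \<Rightarrow> real) \<Rightarrow> real \<Rightarrow> int ^ 'd \<Rightarrow> real" where
  "pkernel a t y = exp (- (2 * real CARD('d)) * t) * pois a (2 * real CARD('d) * t) y"

text \<open>Adding 1 keeps the weight at least 1 and makes it comparable at neighbouring vertices,
  up to a factor depending on \<open>k\<close>.\<close>

definition weight :: "nat \<Rightarrow> int ^ 'd::finite \<Rightarrow> real" where
  "weight k y = (1 + real_of_int (l1 y)) ^ k"

lemma weight_ge_1: "1 \<le> weight k y"
  unfolding weight_def by (rule one_le_power) simp

lemma weight_le_exp: "weight k y \<le> fact k * exp 1 * exp (l1 y)"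
  unfolding weight_def using power_le_fact_exp[of "1 + real_of_int (l1 y)" k] by (simp add: exp_add mult.assoc)

text \<open>A majorant of the kernel that is uniform over the times in [- T, T]. It permits
  differentiation in time under infinite sums, also at time 0.\<close>

definition envelope :: "('d::finite edge \<Rightarrow> real) \<Rightarrow> real \<Rightarrow> int ^ 'd \<Rightarrow> real" where
  "envelope a T y = exp (2 * real CARD('d) * T) * pois a (2 * real CARD('d) * T) y"

text \<open>With \<open>k = 0\<close> this is the squared l2 norm E, with \<open>k = 2 d\<close> the
  quantity N.\<close>

definition energy :: "('d::finite edge \<Rightarrow> real) \<Rightarrow> nat \<Rightarrow> real \<Rightarrow> real" where
  "energy a k t = (\<Sum>\<^sub>\<infinity>y. weight k y * (pkernel a t y)\<^sup>2)"

definition dirichlet_form :: "('d::finite edge \<Rightarrow> real) \<Rightarrow> real \<Rightarrow> real" where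
  "dirichlet_form a t = (\<Sum>i\<in>UNIV. \<Sum>\<^sub>\<infinity>y. a (edge_at y i) * (pkernel a t (y + axis i 1) - pkernel a t y)\<^sup>2)"

context
  fixes a :: "'d::finite edge \<Rightarrow> real"
  assumes env: "static_environment a"
begin

lemma pois_terms_sums:
  "(\<lambda>n. walk_prob a n y / fact n * s ^ n) sums pois a s y"
proof -
  have "summable (\<lambda>n. walk_prob a n y / fact n * s ^ n)"
  proof (rule summable_comparison_test')
    show "summable (\<lambda>n. \<bar>s\<bar> ^ n / fact n)" using summable_exp[of "\<bar>s\<bar>"] by (simp add: field_simps)
    show "norm (walk_prob a n y / fact n * s ^ n) \<le> \<bar>s\<bar> ^ n / fact n" if "n \<ge> 0" for n
    proof -
      have "norm (walk_prob a n y / fact n * s ^ n) = walk_prob a n y * (\<bar>s\<bar> ^ n / fact n)"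
        using walk_prob_nonneg[OF env] by (simp add: abs_mult power_abs)
      also have "\<dots> \<le> 1 * (\<bar>s\<bar> ^ n / fact n)" by (intro mult_right_mono walk_prob_le[OF env]) auto
      finally show ?thesis by simp
    qed
  qed
  then show ?thesis unfolding pois_def by (rule summable_sums)
qed

lemma abs_pois_le:
  assumes "\<bar>s\<bar> \<le> S"
  shows "\<bar>pois a s y\<bar> \<le> pois a S y"
proof -
  have "norm (walk_prob a n y / fact n * s ^ n) \<le> walk_prob a n y / fact n * S ^ n" for n
    using walk_prob_nonneg[OF env, of n y] assms
    by (simp add: abs_mult power_abs) (intro divide_right_mono mult_left_mono power_mono, auto)
  then have "norm (pois a s y) \<le> (\<Sum>n. walk_prob a n y / fact n * S ^ n)"
    unfolding pois_def by (intro norm_suminf_le sums_summable[OF pois_terms_sums])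
  then show ?thesis by (simp add: pois_def)
qed

lemma pois_nonneg: "0 \<le> s \<Longrightarrow> 0 \<le> pois a s y"
  using abs_pois_le[of s s y] by simp

text \<open>After n steps the walk has mass at most 1 in \<open>S\<close>, located where
  \<open>w\<close> is at most c^n; summing (c s)^n / n! gives exp (c s). The case c = 1 bounds the
  mass, and c = exp 1 bounds exponential moments.\<close>

lemma sum_exp_pois_le:
  assumes S: "finite S" and s: "0 \<le> s" and w: "\<And>n y. 0 < walk_prob a n y \<Longrightarrow> w y \<le> c ^ n" and c: "0 \<le> c"
  shows "(\<Sum>y\<in>S. w y * pois a s y) \<le> exp (c * s)"
proof -
  have "(\<lambda>n. \<Sum>y\<in>S. w y * (walk_prob a n y / fact n * s ^ n)) sums (\<Sum>y\<in>S. w y * pois a s y)"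
    by (intro sums_sum sums_mult pois_terms_sums)
  moreover have "(\<lambda>n. (c * s) ^ n / fact n) sums exp (c * s)"
    using exp_converges[of "c * s"] by (simp add: field_simps scaleR_conv_of_real)
  moreover have "(\<Sum>y\<in>S. w y * (walk_prob a n y / fact n * s ^ n)) \<le> (c * s) ^ n / fact n" for n
  proof -
    have "(\<Sum>y\<in>S. w y * (walk_prob a n y / fact n * s ^ n)) \<le> (\<Sum>y\<in>S. c ^ n * (walk_prob a n y / fact n * s ^ n))"
    proof (intro sum_mono)
      fix y
      show "w y * (walk_prob a n y / fact n * s ^ n) \<le> c ^ n * (walk_prob a n y / fact n * s ^ n)"
      proof (cases "walk_prob a n y = 0")
        case False
        then have "0 < walk_prob a n y" using walk_prob_nonneg[OF env, of n y] by simp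
        then show ?thesis using w[of n y] s by (intro mult_right_mono) auto
      qed simp
    qed
    also have "\<dots> = (c * s) ^ n / fact n * sum (walk_prob a n) S"
      by (simp add: power_mult_distrib sum_distrib_left field_simps)
    also have "\<dots> \<le> (c * s) ^ n / fact n * 1"
      using s c by (intro mult_left_mono sum_walk_prob_le env S) auto
    finally show ?thesis by simp
  qed
  ultimately show ?thesis by (rule sums_le[rotated])
qed

lemma summable_exp_pois:
  assumes "0 \<le> s"
  shows "(\<lambda>y. exp (l1 y) * pois a s y) summable_on UNIV"
proof (rule nonneg_bounded_partial_sums_imp_summable_on)
  show "0 \<le> exp (real_of_int (l1 y)) * pois a s y" for y using pois_nonneg[OF assms] by simp
  have w: "exp (real_of_int (l1 y)) \<le> exp 1 ^ n" if "0 < walk_prob a n y" for n and y :: "int ^ 'd"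
  proof -
    have "l1 y \<le> int n" using walk_prob_eq_0[of n y a] that by (cases "int n < l1 y") auto
    then have "real_of_int (l1 y) \<le> real n" by linarith
    then show ?thesis by (simp flip: exp_of_nat_mult)
  qed
  show "\<forall>\<^sub>F X in finite_subsets_at_top UNIV. (\<Sum>y\<in>X. exp (real_of_int (l1 y)) * pois a s y) \<le> exp (exp 1 * s)"
  proof (rule eventually_finite_subsets_at_top_weakI)
    fix X :: "(int ^ 'd) set" assume "finite X"
    then show "(\<Sum>y\<in>X. exp (real_of_int (l1 y)) * pois a s y) \<le> exp (exp 1 * s)"
      by (rule sum_exp_pois_le[OF _ assms w]) auto
  qed
qed

text \<open>Termwise differentiation shifts the index of the series, and shifting the index is one
  step of the walk.\<close>

lemma DERIV_pois: "((\<lambda>s. pois a s y) has_real_derivative walk a (pois a s) y) (at s)"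
proof -
  let ?c = "\<lambda>n. walk_prob a n y / fact n"
  have "((\<lambda>s. \<Sum>n. ?c n * s ^ n) has_real_derivative (\<Sum>n. diffs ?c n * s ^ n)) (at s)"
    by (rule termdiffs_strong_converges_everywhere) (rule sums_summable[OF pois_terms_sums])
  moreover have "(\<lambda>n. diffs ?c n * s ^ n) sums walk a (pois a s) y"
  proof -
    have "(\<lambda>n. walk a (\<lambda>y. walk_prob a n y / fact n * s ^ n) y) sums walk a (pois a s) y"
      unfolding walk_def lap_eq
      by (intro sums_add sums_divide sums_sum sums_diff sums_mult pois_terms_sums)
    moreover have "walk a (\<lambda>y. walk_prob a n y / fact n * s ^ n) y = diffs ?c n * s ^ n" for n
    proof -
      have "walk a (\<lambda>y. walk_prob a n y / fact n * s ^ n) y = walk a (\<lambda>y. (s ^ n / fact n) * walk_prob a n y) y"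
        by (simp add: mult.commute)
      also have "\<dots> = (s ^ n / fact n) * walk_prob a (Suc n) y" by (subst walk_cmult) simp
      also have "\<dots> = diffs ?c n * s ^ n" 
        by (simp add: diffs_def divide_simps del: of_nat_Suc walk_prob.simps)
      finally show ?thesis .
    qed
    ultimately show ?thesis by simp
  qed
  ultimately show ?thesis by (simp add: pois_def sums_iff)
qed

text \<open>Differentiating exp (- 2 d t) cancels the identity in 2 d (I + L / (2 d)), which leaves
  L.\<close>

lemma DERIV_kernel: "((\<lambda>t. pkernel a t y) has_real_derivative lap a (pkernel a t) y) (at t)"
proof -
  let ?r = "(2 * real CARD('d))"
  have "((\<lambda>t. exp (- ?r * t) * pois a (?r * t) y) has_real_derivative
     (exp (- ?r * t) * (- ?r)) * pois a (?r * t) y + (walk a (pois a (?r * t)) y * ?r) * exp (- ?r * t)) (at t)"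
    by (intro DERIV_mult DERIV_chain2[OF DERIV_exp] DERIV_chain2[OF DERIV_pois] DERIV_cmult_Id)
  also have "(exp (- ?r * t) * (- ?r)) * pois a (?r * t) y + (walk a (pois a (?r * t)) y * ?r) * exp (- ?r * t)
    = exp (- ?r * t) * lap a (pois a (?r * t)) y"
    by (simp add: walk_def field_simps)
  also have "\<dots> = lap a (pkernel a t) y"
    by (simp add: pkernel_def[abs_def] lap_cmult)
  finally show ?thesis by (simp add: pkernel_def)
qed

lemma kernel_0: "pkernel a 0 y = (if 0 = y then 1 else 0)"
proof -
  have "pois a 0 y = walk_prob a 0 y" unfolding pois_def by (subst powser_zero) simp
  then show ?thesis by (simp add: pkernel_def)
qed

lemma kernel_nonneg: "0 \<le> t \<Longrightarrow> 0 \<le> pkernel a t y"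
  by (simp add: pkernel_def pois_nonneg)

lemma sum_kernel_le:
  assumes "0 \<le> t" "finite S"
  shows "sum (pkernel a t) S \<le> 1"
proof -
  have "(\<Sum>y\<in>S. 1 * pois a (2 * real CARD('d) * t) y) \<le> exp (1 * (2 * real CARD('d) * t))"
    by (rule sum_exp_pois_le) (use assms in auto)
  then have "exp (- (2 * real CARD('d)) * t) * (\<Sum>y\<in>S. 1 * pois a (2 * real CARD('d) * t) y) \<le> exp (- (2 * real CARD('d)) * t) * exp (1 * (2 * real CARD('d) * t))"
    by (intro mult_left_mono) auto
  also have "\<dots> = 1" by (simp flip: exp_add)
  finally show ?thesis by (simp add: pkernel_def sum_distrib_left)
qed

lemma kernel_le_1: "0 \<le> t \<Longrightarrow> pkernel a t y \<le> 1"
  using sum_kernel_le[of t "{y}"] by simp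

lemma kernel_0_pos:
  assumes "0 \<le> t"
  shows "0 < pkernel a t 0"
proof -
  let ?s = "2 * real CARD('d) * t"
  have "(\<Sum>n\<in>{0}. walk_prob a n 0 / fact n * ?s ^ n) \<le> pois a ?s 0"
    unfolding pois_def by (rule sum_le_suminf[OF sums_summable[OF pois_terms_sums]]) (use assms walk_prob_nonneg[OF env] in auto)
  then have "1 \<le> pois a ?s 0" by simp
  then show ?thesis by (simp add: pkernel_def)
qed

lemma abs_kernel_le_envelope:
  assumes "\<bar>t\<bar> \<le> T"
  shows "\<bar>pkernel a t y\<bar> \<le> envelope a T y"
proof -
  have "\<bar>pkernel a t y\<bar> = exp (- (2 * real CARD('d)) * t) * \<bar>pois a (2 * real CARD('d) * t) y\<bar>"
    by (simp add: pkernel_def abs_mult)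
  also have "\<dots> \<le> exp (2 * real CARD('d) * T) * pois a (2 * real CARD('d) * T) y"
  proof (intro mult_mono abs_pois_le)
    have "- t \<le> T" using assms by linarith
    then have "(2 * real CARD('d)) * (- t) \<le> (2 * real CARD('d)) * T" by (intro mult_left_mono) auto
    then show "exp (- (2 * real CARD('d)) * t) \<le> exp (2 * real CARD('d) * T)" by simp
    show "\<bar>2 * real CARD('d) * t\<bar> \<le> 2 * real CARD('d) * T" using assms by (simp add: abs_mult)
  qed auto
  finally show ?thesis by (simp add: envelope_def)
qed

lemma summable_weight_envelope:
  assumes "0 \<le> T"
  shows "(\<lambda>y. weight k y * envelope a T y) summable_on UNIV"
proof (rule summable_on_comparison_test)
  show "(\<lambda>y. (fact k * exp 1 * exp (2 * real CARD('d) * T)) * (exp (l1 y) * pois a (2 * real CARD('d) * T) y)) summable_on UNIV"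
    using assms by (intro summable_on_cmult_right summable_exp_pois) auto
  fix y :: "int ^ 'd"
  have e: "0 \<le> envelope a T y" using assms by (simp add: envelope_def pois_nonneg)
  have "weight k y * envelope a T y \<le> fact k * exp 1 * exp (l1 y) * envelope a T y"
    by (intro mult_right_mono weight_le_exp e)
  then show "weight k y * envelope a T y \<le> (fact k * exp 1 * exp (2 * real CARD('d) * T)) * (exp (l1 y) * pois a (2 * real CARD('d) * T) y)"
    by (simp add: envelope_def mult_ac)
  show "0 \<le> weight k y * envelope a T y" using e weight_ge_1[of k y] by simp
qed

lemma ex_kernel_bound: "\<exists>B. \<forall>t y. \<bar>t\<bar> \<le> T \<longrightarrow> \<bar>pkernel a t y\<bar> \<le> B"
proof (cases "0 \<le> T")
  case True
  have "\<bar>pkernel a t y\<bar> \<le> exp (2 * real CARD('d) * T) * exp (1 * (2 * real CARD('d) * T))" if "\<bar>t\<bar> \<le> T" for t y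
  proof -
    have "(\<Sum>y\<in>{y}. 1 * pois a (2 * real CARD('d) * T) y) \<le> exp (1 * (2 * real CARD('d) * T))"
      by (rule sum_exp_pois_le) (use True in auto)
    then have "envelope a T y \<le> exp (2 * real CARD('d) * T) * exp (1 * (2 * real CARD('d) * T))"
      unfolding envelope_def by (intro mult_left_mono) auto
    then show ?thesis using abs_kernel_le_envelope[OF that, of y] by linarith
  qed
  then show ?thesis by blast
qed auto

lemma summable_weight_kernel: "(\<lambda>y. weight k y * pkernel a t y) summable_on UNIV"
proof (rule summable_on_iff_abs_summable_on_real[THEN iffD2], rule summable_on_comparison_test)
  show "(\<lambda>y. weight k y * envelope a \<bar>t\<bar> y) summable_on UNIV" by (rule summable_weight_envelope) simp
  show "norm (weight k y * pkernel a t y) \<le> weight k y * envelope a \<bar>t\<bar> y" for y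
    using weight_ge_1[of k y] abs_kernel_le_envelope[of t "\<bar>t\<bar>" y] by (simp add: abs_mult mult_left_mono)
qed simp

lemma summable_kernel: "pkernel a t summable_on UNIV"
  using summable_weight_kernel[of 0 t] by (simp add: weight_def)

lemma summable_weight_kernel_power2: "(\<lambda>y. weight k y * (pkernel a t y)\<^sup>2) summable_on UNIV"
proof -
  obtain B where "\<And>y. \<bar>pkernel a t y\<bar> \<le> B" using ex_kernel_bound[of "\<bar>t\<bar>"] by auto
  then have "(\<lambda>y. pkernel a t y * (weight k y * pkernel a t y)) summable_on UNIV"
    by (intro summable_on_bounded_mult summable_weight_kernel)
  then show ?thesis by (simp add: power2_eq_square mult_ac)
qed

text \<open>Differentiation under the sum: the kernel factor is dominated by the summable weighted
  \<open>envelope\<close>, its Laplacian by a constant.\<close>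

lemma DERIV_energy:
  "(energy a k has_real_derivative (\<Sum>\<^sub>\<infinity>y. 2 * (weight k y * pkernel a t y * lap a (pkernel a t) y))) (at t)"
proof -
  define T where "T = \<bar>t\<bar> + 1"
  obtain B where B: "\<And>t y. \<bar>t\<bar> \<le> T \<Longrightarrow> \<bar>pkernel a t y\<bar> \<le> B" using ex_kernel_bound[of T] by auto
  show ?thesis
    unfolding energy_def[abs_def]
  proof (rule has_real_derivative_infsum[OF infinite_lattice, where T = T
      and M = "\<lambda>y. 2 * (4 * real CARD('d) * B) * (weight k y * envelope a T y)"])
    show "\<bar>t\<bar> < T" by (simp add: T_def)
    show "((\<lambda>t. weight k y * (pkernel a t y)\<^sup>2) has_real_derivative 2 * (weight k y * pkernel a s y * lap a (pkernel a s) y)) (at s)" for s y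
      by (auto intro!: derivative_eq_intros DERIV_kernel)
    show "(\<lambda>y. 2 * (4 * real CARD('d) * B) * (weight k y * envelope a T y)) summable_on UNIV"
      by (intro summable_on_cmult_right summable_weight_envelope) (simp add: T_def)
    show "\<bar>2 * (weight k y * pkernel a s y * lap a (pkernel a s) y)\<bar> \<le> 2 * (4 * real CARD('d) * B) * (weight k y * envelope a T y)"
      if "\<bar>s\<bar> < T" for s y
    proof -
      have s: "\<bar>s\<bar> \<le> T" using that by simp
      have "(weight k y * \<bar>pkernel a s y\<bar>) * \<bar>lap a (pkernel a s) y\<bar> \<le> (weight k y * envelope a T y) * (4 * real CARD('d) * B)"
        using weight_ge_1[of k y]
        by (intro mult_mono mult_left_mono abs_kernel_le_envelope abs_lap_le[OF env] B s)
          (auto intro!: mult_nonneg_nonneg order.trans[OF abs_ge_zero abs_kernel_le_envelope[OF s]])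
      then show ?thesis using weight_ge_1[of k y] by (simp add: abs_mult mult_ac)
    qed
    show "(\<lambda>y. weight k y * (pkernel a s y)\<^sup>2) summable_on UNIV" for s by (rule summable_weight_kernel_power2)
  qed
qed

end

text \<open>Let X \<le> Y be the bases of the weights A and B. The left side is - 2 A (u - v)^2 plus
  a cross term with the factor B - A, and Y \<le> X + 1 \<le> 2 X gives B - A \<le> c X^(2 d - 1)
  with c = 2 d 4^d. Completing the square absorbs the cross term into the first one at the cost of
  c^2 X^(2 d - 2) v^2; the claim is symmetric in the two endpoints.\<close>

lemma weight_diff_le:
  fixes x y :: "int ^ 'd::finite"
  assumes "\<bar>l1 x - l1 y\<bar> \<le> 1" and d: "1 \<le> d"
  shows "- 2 * ((weight (2 * d) x * u - weight (2 * d) y * v) * (u - v))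
    \<le> 4 * real d ^ 2 * 16 ^ d * (weight (2 * d - 2) x * u\<^sup>2 + weight (2 * d - 2) y * v\<^sup>2)"
proof -
  have main: "- 2 * ((X ^ (2 * d) * u - Y ^ (2 * d) * v) * (u - v))
      \<le> 4 * real d ^ 2 * 16 ^ d * (X ^ (2 * d - 2) * u\<^sup>2 + Y ^ (2 * d - 2) * v\<^sup>2)"
    if X: "1 \<le> X" "X \<le> Y" "Y \<le> X + 1" for X Y u v :: real
  proof -
    define A where "A = X ^ (2 * d)"
    define B where "B = Y ^ (2 * d)"
    define p where "p = X ^ (d - 1)"
    have p: "0 < p" using X by (simp add: p_def)
    have A: "A = (X * p)\<^sup>2"
    proof -
      have "X * p = X ^ d" using d by (simp add: p_def flip: power_Suc)
      then show ?thesis by (simp add: A_def power_mult mult.commute[of 2])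
    qed
    have AB: "A \<le> B" unfolding A_def B_def using X by (intro power_mono) auto
    have "B - A \<le> 2 * real d * 4 ^ d * X ^ (2 * d - 1)"
    proof -
      have "B - A = (Y - X) * (\<Sum>i<2 * d. X ^ (2 * d - Suc i) * Y ^ i)"
        unfolding A_def B_def by (rule power_diff_sumr2)
      also have "\<dots> \<le> 1 * (\<Sum>i<2 * d. (2 * X) ^ (2 * d - 1))"
      proof (intro mult_mono sum_mono sum_nonneg)
        fix i assume i: "i \<in> {..<2 * d}"
        have "X ^ (2 * d - Suc i) * Y ^ i \<le> (2 * X) ^ (2 * d - Suc i) * (2 * X) ^ i"
          using X by (intro mult_mono power_mono) auto
        also have "\<dots> = (2 * X) ^ (2 * d - 1)" 
        proof -
          have "2 * d - Suc i + i = 2 * d - 1" using i by simp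
          then show ?thesis by (metis power_add)
        qed
        finally show "X ^ (2 * d - Suc i) * Y ^ i \<le> (2 * X) ^ (2 * d - 1)" .
      qed (use X in auto)
      also have "\<dots> = 2 * real d * 2 ^ (2 * d - 1) * X ^ (2 * d - 1)" by (simp add: power_mult_distrib)
      also have "\<dots> \<le> 2 * real d * 4 ^ d * X ^ (2 * d - 1)"
      proof -
        have "(2::real) ^ (2 * d - 1) \<le> 2 ^ (2 * d)" by (intro power_increasing) auto
        then show ?thesis using X by (intro mult_right_mono mult_left_mono) (auto simp: power_mult)
      qed
      finally show ?thesis .
    qed
    also have "X ^ (2 * d - 1) = X * p\<^sup>2"
    proof -
      have "2 * d - 1 = Suc (2 * (d - 1))" using d by simp
      then show ?thesis by (simp add: p_def power_mult mult.commute[of 2])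
    qed
    finally have BA: "B - A \<le> c * (X * p\<^sup>2)" if "c = 2 * real d * 4 ^ d" for c using that by simp
    define c where "c = 2 * real d * 4 ^ d"
    have c: "c \<ge> 0" by (simp add: c_def)
    have "- 2 * ((A * u - B * v) * (u - v)) = - 2 * A * (u - v)\<^sup>2 + 2 * (B - A) * v * (u - v)"
      by (simp add: power2_eq_square algebra_simps)
    also have "2 * (B - A) * v * (u - v) \<le> 2 * ((B - A) * (\<bar>v\<bar> * \<bar>u - v\<bar>))"
    proof -
      have "v * (u - v) \<le> \<bar>v\<bar> * \<bar>u - v\<bar>" by (metis abs_ge_self abs_mult)
      then have "(B - A) * (v * (u - v)) \<le> (B - A) * (\<bar>v\<bar> * \<bar>u - v\<bar>)" using AB by (intro mult_left_mono) auto
      moreover have "2 * (B - A) * v * (u - v) = 2 * ((B - A) * (v * (u - v)))" by (simp only: mult.assoc)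
      ultimately show ?thesis by linarith
    qed
    also have "2 * ((B - A) * (\<bar>v\<bar> * \<bar>u - v\<bar>)) \<le> 2 * (c * (X * p\<^sup>2) * (\<bar>v\<bar> * \<bar>u - v\<bar>))"
      using BA[OF c_def] by (intro mult_left_mono mult_right_mono) auto
    also have "\<dots> \<le> 2 * A * (u - v)\<^sup>2 + c\<^sup>2 * (p\<^sup>2 * v\<^sup>2)"
    proof -
      have "0 \<le> (2 * (X * p) * \<bar>u - v\<bar> - c * p * \<bar>v\<bar>)\<^sup>2 / 2" by simp
      also have "\<dots> = 2 * (X * p)\<^sup>2 * \<bar>u - v\<bar>\<^sup>2 - 2 * (c * (X * p\<^sup>2) * (\<bar>v\<bar> * \<bar>u - v\<bar>)) + c\<^sup>2 * (p\<^sup>2 * \<bar>v\<bar>\<^sup>2) / 2"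
        by (simp add: power2_eq_square field_simps)
      finally have "2 * (c * (X * p\<^sup>2) * (\<bar>v\<bar> * \<bar>u - v\<bar>)) \<le> 2 * A * (u - v)\<^sup>2 + c\<^sup>2 * (p\<^sup>2 * v\<^sup>2) / 2"
        by (simp add: A)
      moreover have "0 \<le> c\<^sup>2 * (p\<^sup>2 * v\<^sup>2)" by simp
      ultimately show ?thesis by linarith
    qed
    finally have "- 2 * ((A * u - B * v) * (u - v)) \<le> c\<^sup>2 * (p\<^sup>2 * v\<^sup>2)" by simp
    also have "\<dots> \<le> c\<^sup>2 * (X ^ (2 * d - 2) * u\<^sup>2 + Y ^ (2 * d - 2) * v\<^sup>2)"
    proof (rule mult_left_mono)
      have "p\<^sup>2 = X ^ (2 * d - 2)" 
      proof -
        have "2 * d - 2 = (d - 1) * 2" by simp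
        then show ?thesis by (simp only: p_def power_mult)
      qed
      also have "\<dots> \<le> Y ^ (2 * d - 2)" using X by (intro power_mono) auto
      finally have "p\<^sup>2 * v\<^sup>2 \<le> Y ^ (2 * d - 2) * v\<^sup>2" by (intro mult_right_mono) auto
      moreover have "0 \<le> X ^ (2 * d - 2) * u\<^sup>2" using X by simp
      ultimately show "p\<^sup>2 * v\<^sup>2 \<le> X ^ (2 * d - 2) * u\<^sup>2 + Y ^ (2 * d - 2) * v\<^sup>2" by linarith
    qed simp
    also have "c\<^sup>2 = 4 * real d ^ 2 * 16 ^ d"
    proof -
      have "((4 :: real) ^ d)\<^sup>2 = 16 ^ d" by (simp add: power2_eq_square flip: power_mult_distrib)
      then show ?thesis by (simp add: c_def power_mult_distrib)
    qed
    finally show ?thesis unfolding A_def B_def .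
  qed
  define X Y where "X = 1 + real_of_int (l1 x)" and "Y = 1 + real_of_int (l1 y)"
  have XY: "1 \<le> X" "1 \<le> Y" "\<bar>X - Y\<bar> \<le> 1" using assms(1) by (auto simp: X_def Y_def)
  show ?thesis
    unfolding weight_def X_def[symmetric] Y_def[symmetric]
  proof (cases "X \<le> Y")
    case True
    then show "- 2 * ((X ^ (2 * d) * u - Y ^ (2 * d) * v) * (u - v))
      \<le> 4 * real d ^ 2 * 16 ^ d * (X ^ (2 * d - 2) * u\<^sup>2 + Y ^ (2 * d - 2) * v\<^sup>2)"
      using XY by (intro main) auto
  next
    case False
    have "- 2 * ((Y ^ (2 * d) * v - X ^ (2 * d) * u) * (v - u))
      \<le> 4 * real d ^ 2 * 16 ^ d * (Y ^ (2 * d - 2) * v\<^sup>2 + X ^ (2 * d - 2) * u\<^sup>2)"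
      using XY False by (intro main) auto
    then show "- 2 * ((X ^ (2 * d) * u - Y ^ (2 * d) * v) * (u - v))
      \<le> 4 * real d ^ 2 * 16 ^ d * (X ^ (2 * d - 2) * u\<^sup>2 + Y ^ (2 * d - 2) * v\<^sup>2)"
      by (simp add: algebra_simps)
  qed
qed

section \<open>Energy identities and a priori bounds\<close>

context
  fixes a :: "'d::finite edge \<Rightarrow> real"
  assumes env: "static_environment a"
begin

lemma summable_dirichlet:
  "(\<lambda>y. a (edge_at y i) * (pkernel a t (y + axis i 1) - pkernel a t y)\<^sup>2) summable_on UNIV"
proof -
  obtain B where "\<And>y. \<bar>pkernel a t y\<bar> \<le> B" using ex_kernel_bound[OF env, of "\<bar>t\<bar>"] by auto
  from green(2)[OF env summable_kernel[OF env] this] show ?thesis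
    by (simp add: power2_eq_square mult.assoc)
qed

lemma DERIV_energy_0: "(energy a 0 has_real_derivative - 2 * dirichlet_form a t) (at t)"
proof -
  obtain B where "\<And>y. \<bar>pkernel a t y\<bar> \<le> B" using ex_kernel_bound[OF env, of "\<bar>t\<bar>"] by auto
  from green(1)[OF env summable_kernel[OF env, of t] this]
  have "((\<lambda>y. pkernel a t y * lap a (pkernel a t) y) has_sum - dirichlet_form a t) UNIV"
    by (simp add: dirichlet_form_def power2_eq_square mult.assoc)
  then have "((\<lambda>y. 2 * (pkernel a t y * lap a (pkernel a t) y)) has_sum 2 * - dirichlet_form a t) UNIV"
    by (rule has_sum_cmult_right)
  then have "(\<Sum>\<^sub>\<infinity>y. 2 * (weight 0 y * pkernel a t y * lap a (pkernel a t) y)) = - 2 * dirichlet_form a t"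
    by (intro infsumI) (simp add: weight_def)
  with DERIV_energy[OF env, of 0 t] show ?thesis by simp
qed

text \<open>The pairing \<open>F s\<close> of the kernels at times s and t - s does not depend on s,
  because the Laplacian is symmetric. At s = t / 2 it is the energy, and at s = 0 the return
  probability. As the series is defined at all real times, s may range over the whole line.\<close>

lemma energy_0_eq_kernel: "energy a 0 (t / 2) = pkernel a t 0"
proof -
  define F where "F s = (\<Sum>\<^sub>\<infinity>y. pkernel a s y * pkernel a (t - s) y)" for s
  have "(F has_real_derivative 0) (at s)" for s
  proof -
    define T where "T = \<bar>s\<bar> + 1"
    obtain B where B: "\<And>r y. \<bar>r\<bar> \<le> T + \<bar>t\<bar> \<Longrightarrow> \<bar>pkernel a r y\<bar> \<le> B"
      using ex_kernel_bound[OF env, of "T + \<bar>t\<bar>"] by auto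
    have B0: "0 \<le> B" using B[of 0 0] by (simp add: T_def)
    have "(F has_real_derivative (\<Sum>\<^sub>\<infinity>y. lap a (pkernel a s) y * pkernel a (t - s) y - pkernel a s y * lap a (pkernel a (t - s)) y)) (at s)"
      unfolding F_def[abs_def]
    proof (rule has_real_derivative_infsum[OF infinite_lattice, where T = T
        and M = "\<lambda>y. 2 * (4 * real CARD('d) * B) * (weight 0 y * envelope a (T + \<bar>t\<bar>) y)"])
      show "\<bar>s\<bar> < T" by (simp add: T_def)
      show "((\<lambda>s. pkernel a s y * pkernel a (t - s) y) has_real_derivative
        lap a (pkernel a r) y * pkernel a (t - r) y - pkernel a r y * lap a (pkernel a (t - r)) y) (at r)" for r y
      proof -
        have "((\<lambda>s. pkernel a (t - s) y) has_real_derivative lap a (pkernel a (t - r)) y * - 1) (at r)"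
          by (rule DERIV_chain2[OF DERIV_kernel[OF env]]) (auto intro!: derivative_eq_intros)
        from DERIV_mult[OF DERIV_kernel[OF env] this, of y] show ?thesis by (simp add: mult.commute)
      qed
      show "(\<lambda>y. 2 * (4 * real CARD('d) * B) * (weight 0 y * envelope a (T + \<bar>t\<bar>) y)) summable_on UNIV"
        by (intro summable_on_cmult_right summable_weight_envelope[OF env]) (simp add: T_def)
      show "\<bar>lap a (pkernel a r) y * pkernel a (t - r) y - pkernel a r y * lap a (pkernel a (t - r)) y\<bar>
        \<le> 2 * (4 * real CARD('d) * B) * (weight 0 y * envelope a (T + \<bar>t\<bar>) y)" if "\<bar>r\<bar> < T" for r y
      proof -
        have r: "\<bar>r\<bar> \<le> T + \<bar>t\<bar>" "\<bar>t - r\<bar> \<le> T + \<bar>t\<bar>" using that by linarith+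
        have *: "\<bar>lap a (pkernel a u) y * pkernel a v y\<bar> \<le> 4 * real CARD('d) * B * envelope a (T + \<bar>t\<bar>) y"
          if "\<bar>u\<bar> \<le> T + \<bar>t\<bar>" "\<bar>v\<bar> \<le> T + \<bar>t\<bar>" for u v
          unfolding abs_mult using that B0
          by (intro mult_mono abs_lap_le[OF env] abs_kernel_le_envelope[OF env] B) auto
        show ?thesis
          using *[OF r(1,2)] *[OF r(2,1)] by (simp add: weight_def mult.commute)
      qed
      show "(\<lambda>y. pkernel a r y * pkernel a (t - r) y) summable_on UNIV" for r
      proof -
        obtain B' where "\<And>y. \<bar>pkernel a r y\<bar> \<le> B'" using ex_kernel_bound[OF env, of "\<bar>r\<bar>"] by auto
        then show ?thesis by (intro summable_on_bounded_mult summable_kernel[OF env])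
      qed
    qed
    also have "(\<Sum>\<^sub>\<infinity>y. lap a (pkernel a s) y * pkernel a (t - s) y - pkernel a s y * lap a (pkernel a (t - s)) y) = 0"
    proof (rule green_symmetric[OF env summable_kernel[OF env] summable_kernel[OF env]])
      show "\<bar>pkernel a s y\<bar> \<le> B" "\<bar>pkernel a (t - s) y\<bar> \<le> B" for y
        by (intro B; simp add: T_def; linarith)+
    qed
    finally show ?thesis .
  qed
  then have "F (t / 2) = F 0" by (intro DERIV_isconst_all) blast
  moreover have "F (t / 2) = energy a 0 (t / 2)" by (simp add: F_def energy_def weight_def power2_eq_square)
  moreover have "F 0 = pkernel a t 0"
  proof -
    have "((\<lambda>y. pkernel a 0 y * pkernel a (t - 0) y) has_sum pkernel a t 0) {0}"
      by (intro has_sum_finiteI) (auto simp: kernel_0[OF env])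
    also have "?this \<longleftrightarrow> ((\<lambda>y. pkernel a 0 y * pkernel a (t - 0) y) has_sum pkernel a t 0) UNIV"
      by (rule has_sum_cong_neutral) (auto simp: kernel_0[OF env])
    finally show ?thesis unfolding F_def by (rule infsumI)
  qed
  ultimately show ?thesis by simp
qed

lemma energy_at_0: "energy a k 0 = 1"
proof -
  have "((\<lambda>y. weight k y * (pkernel a 0 y)\<^sup>2) has_sum 1) {0}"
    by (intro has_sum_finiteI) (auto simp: kernel_0[OF env] weight_def)
  also have "?this \<longleftrightarrow> ((\<lambda>y. weight k y * (pkernel a 0 y)\<^sup>2) has_sum 1) UNIV"
    by (rule has_sum_cong_neutral) (auto simp: kernel_0[OF env])
  finally show ?thesis unfolding energy_def by (rule infsumI)
qed

lemma energy_pos: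
  assumes "0 \<le> t"
  shows "0 < energy a k t"
proof -
  have "(\<Sum>y\<in>{0}. weight k y * (pkernel a t y)\<^sup>2) \<le> energy a k t"
    unfolding energy_def
    by (intro finite_sum_le_infsum summable_weight_kernel_power2[OF env])
      (auto intro!: mult_nonneg_nonneg order.trans[OF zero_le_one weight_ge_1])
  moreover have "0 < (\<Sum>y\<in>{0}. weight k y * (pkernel a t y)\<^sup>2)"
    using kernel_0_pos[OF env assms] weight_ge_1[of k "0 :: int ^ 'd"] by (simp add: weight_def)
  ultimately show ?thesis by linarith
qed

lemma energy_0_le: "energy a 0 t \<le> energy a k t"
  unfolding energy_def
  by (intro infsum_mono summable_weight_kernel_power2[OF env] mult_right_mono) (use weight_ge_1 in \<open>auto simp: weight_def\<close>)

lemma energy_0_le_1: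
  assumes "0 \<le> t"
  shows "energy a 0 t \<le> 1"
  unfolding energy_def
proof (rule infsum_le_finite_sums[OF summable_weight_kernel_power2[OF env]])
  fix S :: "(int ^ 'd) set" assume S: "finite S"
  have "(\<Sum>y\<in>S. weight 0 y * (pkernel a t y)\<^sup>2) \<le> sum (pkernel a t) S"
  proof (rule sum_mono)
    fix y
    show "weight 0 y * (pkernel a t y)\<^sup>2 \<le> pkernel a t y"
      using kernel_le_1[OF env assms, of y] kernel_nonneg[OF env assms, of y]
      by (simp add: weight_def power2_eq_square mult_left_le)
  qed
  also have "\<dots> \<le> 1" by (rule sum_kernel_le[OF env assms S])
  finally show "(\<Sum>y\<in>S. weight 0 y * (pkernel a t y)\<^sup>2) \<le> 1" .
qed

lemma dirichlet_form_nonneg: "0 \<le> dirichlet_form a t"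
  unfolding dirichlet_form_def
  by (intro sum_nonneg infsum_nonneg) (simp add: static_environmentD[OF env])

text \<open>Each direction contributes at most 4, from (u - v)^2 \<le> 2 u^2 + 2 v^2 and the bound 1
  on the energy.\<close>

lemma dirichlet_form_le:
  assumes "0 \<le> t"
  shows "dirichlet_form a t \<le> 4 * real CARD('d)"
proof -
  have s: "(\<lambda>y. (pkernel a t y)\<^sup>2) summable_on UNIV"
    using summable_weight_kernel_power2[OF env, of 0 t] by (simp add: weight_def)
  have s': "(\<lambda>y. (pkernel a t (y + axis i 1))\<^sup>2) summable_on UNIV" for i
    using s by (subst summable_on_shift_iff)
  have "(\<Sum>\<^sub>\<infinity>y. a (edge_at y i) * (pkernel a t (y + axis i 1) - pkernel a t y)\<^sup>2) \<le> 4" for i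
  proof -
    have "(\<Sum>\<^sub>\<infinity>y. a (edge_at y i) * (pkernel a t (y + axis i 1) - pkernel a t y)\<^sup>2)
      \<le> (\<Sum>\<^sub>\<infinity>y. 2 * (pkernel a t (y + axis i 1))\<^sup>2 + 2 * (pkernel a t y)\<^sup>2)"
    proof (intro infsum_mono summable_dirichlet summable_on_add summable_on_cmult_right s s')
      fix y
      have "a (edge_at y i) * (pkernel a t (y + axis i 1) - pkernel a t y)\<^sup>2 \<le> 1 * (pkernel a t (y + axis i 1) - pkernel a t y)\<^sup>2"
        by (intro mult_right_mono static_environmentD[OF env]) auto
      also have "\<dots> \<le> 2 * (pkernel a t (y + axis i 1))\<^sup>2 + 2 * (pkernel a t y)\<^sup>2"
        using zero_le_power2[of "pkernel a t (y + axis i 1) + pkernel a t y"] by (simp add: power2_eq_square algebra_simps)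
      finally show "a (edge_at y i) * (pkernel a t (y + axis i 1) - pkernel a t y)\<^sup>2 \<le> 2 * (pkernel a t (y + axis i 1))\<^sup>2 + 2 * (pkernel a t y)\<^sup>2" .
    qed
    also have "\<dots> = 2 * energy a 0 t + 2 * energy a 0 t"
      using infsum_shift[of "\<lambda>y. (pkernel a t y)\<^sup>2" "axis i 1"]
      by (simp add: infsum_add[OF summable_on_cmult_right[OF s'] summable_on_cmult_right[OF s]]
          infsum_cmult_right'  energy_def weight_def)
    finally show ?thesis using energy_0_le_1[OF assms] by linarith
  qed
  then have "dirichlet_form a t \<le> (\<Sum>i\<in>(UNIV :: 'd set). 4)" unfolding dirichlet_form_def by (intro sum_mono)
  then show ?thesis by simp
qed

end

section \<open>Growth of the weighted energy\<close>

lemma weight_interpolation: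
  fixes y :: "int ^ 'd::finite"
  assumes d: "1 \<le> d" and l: "0 < (l :: real)"
  shows "weight (2 * d - 2) y \<le> l powr (- 1 / d) * weight (2 * d) y + l powr (1 - 1 / d) * weight 0 y"
proof -
  define X where "X = 1 + real_of_int (l1 y)"
  have X: "1 \<le> X" by (simp add: X_def)
  have e: "2 * d - 2 = 2 * (d - 1)" "2 * d = 2 * (d - 1) + 2" using d by auto
  have "X ^ (2 * d - 2) \<le> l powr (- 1 / d) * X ^ (2 * d) + l powr (1 - 1 / d)"
  \<comment> \<open>If X^2 is at least l^(1 / d), the factor X^2 / l^(1 / d) \<ge> 1 can be
    inserted; otherwise X^(2 d - 2) is at most the power d - 1 of l^(1 / d).\<close>
  proof (cases "l powr (1 / d) \<le> X\<^sup>2")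
    case True
    have "l powr (- 1 / d) * l powr (1 / d) \<le> l powr (- 1 / d) * X\<^sup>2" using True by (intro mult_left_mono) auto
    then have "1 \<le> l powr (- 1 / d) * X\<^sup>2" using l by (simp flip: powr_add)
    then have "1 * X ^ (2 * d - 2) \<le> (l powr (- 1 / d) * X\<^sup>2) * X ^ (2 * d - 2)"
      using X by (intro mult_right_mono) auto
    also have "\<dots> = l powr (- 1 / d) * X ^ (2 * d)" unfolding e by (simp only: diff_add_inverse2 power_add) (simp add: mult_ac)
    finally show ?thesis by (simp add: add_increasing2)
  next
    case False
    have "X ^ (2 * d - 2) = (X\<^sup>2) ^ (d - 1)" by (simp only: e(1) power_mult)
    also have "\<dots> \<le> (l powr (1 / d)) ^ (d - 1)" using False by (intro power_mono) auto
    also have "\<dots> = (l powr (1 / d)) powr (real d - 1)" using d l by (simp add: of_nat_diff flip: powr_realpow)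
    also have "\<dots> = l powr (1 - 1 / d)" using d by (simp add: powr_powr field_simps)
    finally show ?thesis using X by (simp add: add_increasing)
  qed
  then show ?thesis by (simp add: weight_def X_def)
qed

lemma energy_interpolation:
  assumes env: "static_environment (a :: 'd::finite edge \<Rightarrow> real)" and d: "1 \<le> d" and l: "0 < (l :: real)"
  shows "energy a (2 * d - 2) t \<le> l powr (- 1 / d) * energy a (2 * d) t + l powr (1 - 1 / d) * energy a 0 t"
proof -
  note s = summable_weight_kernel_power2[OF env]
  have "energy a (2 * d - 2) t \<le> (\<Sum>\<^sub>\<infinity>y. l powr (- 1 / d) * (weight (2 * d) y * (pkernel a t y)\<^sup>2) + l powr (1 - 1 / d) * (weight 0 y * (pkernel a t y)\<^sup>2))"
    unfolding energy_def
  proof (intro infsum_mono summable_on_add summable_on_cmult_right s)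
    fix y
    have "weight (2 * d - 2) y * (pkernel a t y)\<^sup>2 \<le> (l powr (- 1 / d) * weight (2 * d) y + l powr (1 - 1 / d) * weight 0 y) * (pkernel a t y)\<^sup>2"
      by (intro mult_right_mono weight_interpolation d l) simp
    then show "weight (2 * d - 2) y * (pkernel a t y)\<^sup>2 \<le> l powr (- 1 / d) * (weight (2 * d) y * (pkernel a t y)\<^sup>2) + l powr (1 - 1 / d) * (weight 0 y * (pkernel a t y)\<^sup>2)"
      by (simp add: algebra_simps)
  qed
  also have "\<dots> = l powr (- 1 / d) * energy a (2 * d) t + l powr (1 - 1 / d) * energy a 0 t"
    by (simp add: infsum_add[OF summable_on_cmult_right[OF s] summable_on_cmult_right[OF s]] infsum_cmult_right' energy_def)
  finally show ?thesis .
qed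

text \<open>Summation by parts against the weighted kernel, the edgewise bound on weights and shift
  invariance lead to the energy of weight exponent 2 d - 2, which is interpolated. Each of the d
  directions contributes 2 C with C = 4 d^2 16^d.\<close>

lemma energy_growth:
  fixes a :: "'d::finite edge \<Rightarrow> real"
  assumes env: "static_environment a"
  defines "d \<equiv> CARD('d)"
  shows "\<exists>N'. (energy a (2 * d) has_real_derivative N') (at t) \<and>
    (\<forall>l>0. N' \<le> 8 * real d ^ 3 * 16 ^ d * (energy a (2 * d) t * l powr (- 1 / d) + energy a 0 t * l powr (1 - 1 / d)))"
proof (intro exI conjI allI impI)
  show "(energy a (2 * d) has_real_derivative (\<Sum>\<^sub>\<infinity>y. 2 * (weight (2 * d) y * pkernel a t y * lap a (pkernel a t) y))) (at t)"
    by (rule DERIV_energy[OF env])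
  fix l :: real assume l: "0 < l"
  have d: "1 \<le> d" by (simp add: d_def Suc_leI)
  let ?u = "pkernel a t"
  define \<phi> where "\<phi> y = weight (2 * d) y * ?u y" for y
  define C where "C = 4 * real d ^ 2 * 16 ^ d"
  define I where "I i y = a (edge_at y i) * (\<phi> (y + axis i 1) - \<phi> y) * (?u (y + axis i 1) - ?u y)" for i y
  define J where "J y = weight (2 * d - 2) y * (?u y)\<^sup>2" for y
  have C0: "C \<ge> 0" by (simp add: C_def)
  have \<phi>_sum: "\<phi> summable_on UNIV" unfolding \<phi>_def by (rule summable_weight_kernel[OF env])
  \<comment> \<open>The test function must be bounded; being summable, it is bounded by the sum of
    its absolute values.\<close>
  have \<phi>_bd: "\<bar>\<phi> y\<bar> \<le> (\<Sum>\<^sub>\<infinity>y. norm (\<phi> y))" for y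
    using finite_sum_le_infsum[OF \<phi>_sum[THEN summable_on_iff_abs_summable_on_real[THEN iffD1]], of "{y}"] by simp
  have J: "J summable_on UNIV" unfolding J_def by (rule summable_weight_kernel_power2[OF env])
  have J': "(\<lambda>y. J (y + axis i 1)) summable_on UNIV" for i using J by (subst summable_on_shift_iff)
  have I: "I i summable_on UNIV" for i
    unfolding I_def by (rule green(2)[OF env summable_kernel[OF env] \<phi>_bd])
  have "((\<lambda>y. \<phi> y * lap a ?u y) has_sum - (\<Sum>i\<in>UNIV. infsum (I i) UNIV)) UNIV"
    unfolding I_def by (rule green(1)[OF env summable_kernel[OF env] \<phi>_bd])
  then have "((\<lambda>y. 2 * (\<phi> y * lap a ?u y)) has_sum 2 * - (\<Sum>i\<in>UNIV. infsum (I i) UNIV)) UNIV"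
    by (rule has_sum_cmult_right)
  then have "(\<Sum>\<^sub>\<infinity>y. 2 * (weight (2 * d) y * ?u y * lap a ?u y)) = (\<Sum>i\<in>UNIV. - 2 * infsum (I i) UNIV)"
    by (simp add: infsumI \<phi>_def sum_distrib_left sum_negf)
  also have "\<dots> \<le> (\<Sum>i\<in>(UNIV :: 'd set). 2 * C * energy a (2 * d - 2) t)"
  proof (rule sum_mono)
    fix i :: 'd
    have "- 2 * infsum (I i) UNIV = (\<Sum>\<^sub>\<infinity>y. - 2 * I i y)" by (rule infsum_cmult_right'[symmetric])
    also have "\<dots> \<le> (\<Sum>\<^sub>\<infinity>y. C * J (y + axis i 1) + C * J y)"
    proof (intro infsum_mono summable_on_cmult_right summable_on_add I J J')
      fix y
      have "\<bar>l1 (y + axis i 1) - l1 y\<bar> \<le> 1" by (rule l1_diff_le)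
      from weight_diff_le[OF this d, of "?u (y + axis i 1)" "?u y"]
      have le: "- 2 * ((\<phi> (y + axis i 1) - \<phi> y) * (?u (y + axis i 1) - ?u y)) \<le> C * J (y + axis i 1) + C * J y"
        by (simp add: \<phi>_def C_def J_def distrib_left)
      have J0: "0 \<le> J z" for z unfolding J_def using weight_ge_1[of "2 * d - 2" z] by simp
      have "- 2 * I i y = a (edge_at y i) * (- 2 * ((\<phi> (y + axis i 1) - \<phi> y) * (?u (y + axis i 1) - ?u y)))"
        by (simp add: I_def)
      also have "\<dots> \<le> a (edge_at y i) * (C * J (y + axis i 1) + C * J y)"
        by (intro mult_left_mono le static_environmentD[OF env])
      also have "\<dots> \<le> 1 * (C * J (y + axis i 1) + C * J y)"
        using C0 J0 by (intro mult_right_mono static_environmentD[OF env]) auto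
      finally show "- 2 * I i y \<le> C * J (y + axis i 1) + C * J y" by simp
    qed
    also have "\<dots> = 2 * C * energy a (2 * d - 2) t"
    proof -
      have "(\<Sum>\<^sub>\<infinity>y. C * J (y + axis i 1) + C * J y) = C * infsum J UNIV + C * infsum J UNIV"
        unfolding infsum_add[OF summable_on_cmult_right[OF J'] summable_on_cmult_right[OF J]] infsum_cmult_right' infsum_shift ..
      moreover have "energy a (2 * d - 2) t = infsum J UNIV" unfolding energy_def J_def[abs_def] ..
      ultimately show ?thesis by simp
    qed
    finally show "- 2 * infsum (I i) UNIV \<le> 2 * C * energy a (2 * d - 2) t" .
  qed
  also have "\<dots> = 8 * real d ^ 3 * 16 ^ d * energy a (2 * d - 2) t"
    by (simp add: C_def d_def power2_eq_square power3_eq_cube)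
  also have "\<dots> \<le> 8 * real d ^ 3 * 16 ^ d * (energy a (2 * d) t * l powr (- 1 / d) + energy a 0 t * l powr (1 - 1 / d))"
    using energy_interpolation[OF env d l, of t] by (intro mult_left_mono) (auto simp: mult.commute)
  finally show "(\<Sum>\<^sub>\<infinity>y. 2 * (weight (2 * d) y * ?u y * lap a ?u y)) \<le> 8 * real d ^ 3 * 16 ^ d * (energy a (2 * d) t * l powr (- 1 / d) + energy a 0 t * l powr (1 - 1 / d))" .
qed

section \<open>Identification with the heat kernel of the definitions\<close>

lemma heat_equation_unique:
  fixes v :: "real \<Rightarrow> int ^ 'd::finite \<Rightarrow> real"
  assumes env: "static_environment a" and v0: "\<And>y. v 0 y = 0"
    and dv: "\<And>t y. 0 \<le> t \<Longrightarrow> ((\<lambda>s. v s y) has_real_derivative lap a (v t) y) (at t within {0..})"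
    and K: "\<And>t y. 0 \<le> t \<Longrightarrow> \<bar>v t y\<bar> \<le> K" and t: "0 \<le> t"
  shows "v t y = 0"
proof -
  define c where "c = 4 * real CARD('d)"
  \<comment> \<open>The Laplacian has norm at most \<open>c\<close> on bounded functions, so each
    integration in time improves the bound by the factor c t / (n + 1), and the factorial forces the
    limit 0.\<close>
  have bound: "\<bar>v t y\<bar> \<le> K * ((c * t) ^ n / fact n)" if "0 \<le> t" for n t y
    using that
  proof (induction n arbitrary: t y)
    case 0
    then show ?case using K by simp
  next
    case (Suc n)
    define h where "h s = K * ((c * s) ^ Suc n / fact (Suc n))" for s
    have dh: "(h has_real_derivative c * (K * ((c * s) ^ n / fact n))) (at s)" for s
    proof -
      have "(h has_real_derivative K * (real (Suc n) * (c * s) ^ n * c / fact (Suc n))) (at s)"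
        unfolding h_def by (auto intro!: derivative_eq_intros simp del: fact_Suc power_Suc)
      moreover have "real (Suc n) * (c * s) ^ n * c / fact (Suc n) = c * ((c * s) ^ n / fact n)"
        by (simp add: divide_simps del: of_nat_Suc)
      ultimately show ?thesis by (simp add: mult_ac)
    qed
    have cv: "continuous_on {0..t} (\<lambda>s. v s y)"
      unfolding continuous_on_eq_continuous_within
    proof
      fix s assume "s \<in> {0..t}"
      then have "continuous (at s within {0..}) (\<lambda>s. v s y)" using DERIV_continuous[OF dv] by auto
      then show "continuous (at s within {0..t}) (\<lambda>s. v s y)" by (rule continuous_within_subset) auto
    qed
    have ch: "continuous_on {0..t} h" using dh by (intro continuous_at_imp_continuous_on) (metis DERIV_isCont)
    \<comment> \<open>For both signs the function starts at 0 and has nonnegative derivative; this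
      takes the place of integrating the equation.\<close>
    have "h 0 + \<epsilon> * v 0 y \<le> h t + \<epsilon> * v t y" if \<epsilon>: "\<epsilon> = 1 \<or> \<epsilon> = -1" for \<epsilon> :: real
    proof (rule DERIV_nonneg_imp_increasing_open[OF Suc.prems])
      show "continuous_on {0..t} (\<lambda>s. h s + \<epsilon> * v s y)" by (intro continuous_intros cv ch)
      fix s assume s: "0 < s" "s < t"
      have "at s within {0..} = at s" using s by (intro at_within_interior) (simp add: interior_real_atLeast)
      then have "((\<lambda>s. v s y) has_real_derivative lap a (v s) y) (at s)" using dv[of s y] s by simp
      then have "((\<lambda>s. h s + \<epsilon> * v s y) has_real_derivative c * (K * ((c * s) ^ n / fact n)) + \<epsilon> * lap a (v s) y) (at s)"
        by (intro DERIV_add DERIV_cmult dh)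
      moreover have "\<bar>lap a (v s) y\<bar> \<le> c * (K * ((c * s) ^ n / fact n))"
        unfolding c_def using Suc.IH[of s] s by (intro abs_lap_le[OF env]) (auto simp: c_def)
      then have "0 \<le> c * (K * ((c * s) ^ n / fact n)) + \<epsilon> * lap a (v s) y" using \<epsilon> by auto
      ultimately show "\<exists>z. ((\<lambda>s. h s + \<epsilon> * v s y) has_real_derivative z) (at s) \<and> 0 \<le> z" by blast
    qed
    from this[of 1] this[of "-1"] have "\<bar>v t y\<bar> \<le> h t" by (simp add: h_def v0)
    then show ?case by (simp add: h_def)
  qed
  have "(\<lambda>n. (c * t) ^ n / fact n) \<longlonglongrightarrow> 0"
    using summable_LIMSEQ_zero[OF summable_exp[of "c * t"]] by (simp add: field_simps)
  then have "(\<lambda>n. K * ((c * t) ^ n / fact n)) \<longlonglongrightarrow> K * 0" by (intro tendsto_intros)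
  then have "\<bar>v t y\<bar> \<le> K * 0" by (rule LIMSEQ_le_const) (use bound[OF t] in auto)
  then show ?thesis by simp
qed

lemma heat_kernel_eq_pkernel:
  fixes a :: "'d::finite edge \<Rightarrow> real"
  assumes env: "static_environment a" and t: "0 \<le> t"
  shows "heat_kernel a t 0 = pkernel a t"
proof -
  \<comment> \<open>The series has its own values at negative times; cutting it off matches the
    convention under which the description of the kernel is unique.\<close>
  define U where "U s = (if s < 0 then (\<lambda>_. 0) else pkernel a s)" for s :: real
  have U: "is_heat_kernel a 0 U"
    unfolding is_heat_kernel_def
  proof (intro conjI allI impI exI)
    fix s :: real and y assume s: "0 \<le> s"
    have "((\<lambda>r. pkernel a r y) has_real_derivative lap a (pkernel a s) y) (at s within {0..})"
      by (rule has_field_derivative_at_within[OF DERIV_kernel[OF env]])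
    then have "((\<lambda>r. U r y) has_real_derivative lap a (pkernel a s) y) (at s within {0..})"
      by (rule has_field_derivative_transform_within[where d = 1]) (use s in \<open>auto simp: U_def\<close>)
    then show "((\<lambda>r. U r y) has_real_derivative (\<Sum>z\<in>{z. adjacent z y}. a {y, z} * (U s z - U s y))) (at s within {0..})"
      using s by (simp add: U_def lap_def)
    show "\<bar>U s y\<bar> \<le> 1" using s kernel_nonneg[OF env s] kernel_le_1[OF env s] by (simp add: U_def)
  qed (auto simp: U_def kernel_0[OF env])
  have "u = U" if u: "is_heat_kernel a 0 u" for u
  proof (intro ext)
    fix s y
    show "u s y = U s y"
    proof (cases "0 \<le> s")
      case True
      obtain K where K: "\<And>t y. 0 \<le> t \<Longrightarrow> \<bar>u t y\<bar> \<le> K" using u unfolding is_heat_kernel_def by blast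
      obtain K' where K': "\<And>t y. 0 \<le> t \<Longrightarrow> \<bar>U t y\<bar> \<le> K'" using U unfolding is_heat_kernel_def by blast
      have "u s y - U s y = 0"
      proof (rule heat_equation_unique[OF env, where v = "\<lambda>s y. u s y - U s y" and K = "K + K'"])
        show "u 0 y - U 0 y = 0" for y using u U by (simp add: is_heat_kernel_def)
        show "\<bar>u t y - U t y\<bar> \<le> K + K'" if "0 \<le> t" for t y using K[OF that, of y] K'[OF that, of y] by linarith
        show "((\<lambda>s. u s y - U s y) has_real_derivative lap a (\<lambda>y. u t y - U t y) y) (at t within {0..})" if t: "0 \<le> t" for t y
        proof -
          have "((\<lambda>s. u s y - U s y) has_real_derivative lap a (u t) y - lap a (U t) y) (at t within {0..})"
            unfolding lap_def using u U t by (intro DERIV_diff) (simp_all add: is_heat_kernel_def)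
          also have "lap a (u t) y - lap a (U t) y = lap a (\<lambda>y. u t y - U t y) y"
            by (simp add: lap_def algebra_simps flip: sum_subtractf)
          finally show ?thesis .
        qed
      qed (rule True)
      then show ?thesis by simp
    next
      case False
      then show ?thesis using u by (simp add: is_heat_kernel_def U_def)
    qed
  qed
  with U have "(THE u. is_heat_kernel a 0 u) = U" by (intro the_equality)
  then show ?thesis using t by (intro ext) (simp add: heat_kernel_def U_def)
qed

lemma l2norm_power2: "(l2norm I F)\<^sup>2 = (\<Sum>\<^sub>\<infinity>i\<in>I. ennreal ((F i)\<^sup>2))"
proof -
  have "(epowr x (1 / 2))\<^sup>2 = x" for x
  proof (cases x)
    case (real r)
    then have "(r powr (1 / 2))\<^sup>2 = r" by (simp add: powr_half_sqrt)
    with real show ?thesis by (simp add: epowr_def ennreal_power)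
  qed (simp add: epowr_def ennreal_top_eq_mult_iff power2_eq_square ennreal_mult_top)
  then show ?thesis by (simp add: l2norm_def)
qed

lemma sum_edges_le:
  fixes g :: "'d::finite edge \<Rightarrow> real"
  assumes Z: "finite Z" "Z \<subseteq> edges" and g: "\<And>e. e \<in> edges \<Longrightarrow> 0 \<le> g e"
    and s: "\<And>i. (\<lambda>y. g (edge_at y i)) summable_on UNIV"
  shows "(\<Sum>e\<in>Z. g e) \<le> (\<Sum>i\<in>UNIV. \<Sum>\<^sub>\<infinity>y. g (edge_at y i))"
proof -
  have "\<forall>e\<in>Z. \<exists>z. e = edge_at (fst z) (snd z)" using Z by (metis edgesE fst_conv snd_conv subsetD)
  then obtain z where z: "\<And>e. e \<in> Z \<Longrightarrow> e = edge_at (fst (z e)) (snd (z e))" by metis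
  define Y where "Y = (fst \<circ> z) ` Z"
  have Y: "finite Y" using Z by (simp add: Y_def)
  have sub: "Z \<subseteq> (\<lambda>(y, i). edge_at y i) ` (Y \<times> UNIV)"
  proof
    fix e assume e: "e \<in> Z"
    have "e = (case (fst (z e), snd (z e)) of (y, i) \<Rightarrow> edge_at y i)" unfolding prod.case by (rule z[OF e])
    moreover have "(fst (z e), snd (z e)) \<in> Y \<times> UNIV" using e by (force simp: Y_def)
    ultimately show "e \<in> (\<lambda>(y, i). edge_at y i) ` (Y \<times> UNIV)" by (rule image_eqI)
  qed
  have "(\<Sum>e\<in>Z. g e) \<le> (\<Sum>e\<in>(\<lambda>(y, i). edge_at y i) ` (Y \<times> UNIV). g e)"
  proof (rule sum_mono2)
    show "0 \<le> g e" if "e \<in> (\<lambda>(y, i). edge_at y i) ` (Y \<times> UNIV) - Z" for e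
      using that by (intro g) auto
  qed (use Y sub in auto)
  also have "\<dots> = (\<Sum>(y, i)\<in>Y \<times> UNIV. g (edge_at y i))"
  proof -
    have "inj_on (\<lambda>(y, i). edge_at y i) (Y \<times> (UNIV :: 'd set))" by (auto simp: inj_on_def edge_at_inject)
    from sum.reindex[OF this, of g] show ?thesis by (simp add: case_prod_unfold)
  qed
  also have "\<dots> = (\<Sum>i\<in>UNIV. \<Sum>y\<in>Y. g (edge_at y i))"
    unfolding sum.cartesian_product[symmetric] by (rule sum.swap)
  also have "\<dots> \<le> (\<Sum>i\<in>UNIV. \<Sum>\<^sub>\<infinity>y. g (edge_at y i))"
  proof (rule sum_mono)
    fix i
    show "(\<Sum>y\<in>Y. g (edge_at y i)) \<le> (\<Sum>\<^sub>\<infinity>y. g (edge_at y i))"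
      by (rule finite_sum_le_infsum[OF s Y]) (use g in auto)
  qed
  finally show ?thesis .
qed

text \<open>Passage from extended to real numbers: moderation compares extended-valued energies, and
  the one of the kernel is at most the finite real Dirichlet form.\<close>

lemma moderate_sum_le:
  fixes a w :: "'d::finite edge \<Rightarrow> real"
  assumes env: "static_environment a" and mod: "moderate w a" and t: "0 \<le> t"
    and Z: "finite Z" "Z \<subseteq> edges"
  shows "(\<Sum>e\<in>Z. (w e * grad_abs (pkernel a t) e)\<^sup>2) \<le> dirichlet_form a t"
proof -
  let ?g = "grad_abs (pkernel a t)"
  have "dirichlet_energy a t \<le> ennreal (dirichlet_form a t)"
    unfolding dirichlet_energy_def l2norm_power2 heat_kernel_eq_pkernel[OF env t]
  proof (rule infsum_le_finite_sums)
    fix F :: "'d edge set" assume F: "finite F" "F \<subseteq> edges"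
    have eq: "(sqrt (a e) * ?g e)\<^sup>2 = a e * (?g e)\<^sup>2" if "e \<in> edges" for e
      using that env by (simp add: static_environment_def power_mult_distrib)
    have "(\<Sum>e\<in>F. (sqrt (a e) * ?g e)\<^sup>2) = (\<Sum>e\<in>F. a e * (?g e)\<^sup>2)" using F eq by (intro sum.cong) auto
    also have "\<dots> \<le> (\<Sum>i\<in>UNIV. \<Sum>\<^sub>\<infinity>y. a (edge_at y i) * (?g (edge_at y i))\<^sup>2)"
      using F env summable_dirichlet[OF env]
      by (intro sum_edges_le) (auto simp: static_environment_def grad_abs_edge_at)
    also have "\<dots> = dirichlet_form a t" by (simp add: dirichlet_form_def grad_abs_edge_at)
    finally show "(\<Sum>e\<in>F. ennreal ((sqrt (a e) * ?g e)\<^sup>2)) \<le> ennreal (dirichlet_form a t)"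
      by (simp add: sum_ennreal ennreal_leI)
  qed (rule nonneg_summable_on_complete, simp)
  moreover have "(\<Sum>\<^sub>\<infinity>e\<in>edges. ennreal ((w e * ?g e)\<^sup>2)) \<le> dirichlet_energy a t"
    using mod t unfolding moderate_def l2norm_power2 heat_kernel_eq_pkernel[OF env t, symmetric] by blast
  moreover have "(\<Sum>e\<in>Z. ennreal ((w e * ?g e)\<^sup>2)) \<le> (\<Sum>\<^sub>\<infinity>e\<in>edges. ennreal ((w e * ?g e)\<^sup>2))"
    using infsum_mono_neutral[of "\<lambda>e. ennreal ((w e * ?g e)\<^sup>2)" Z "\<lambda>e. ennreal ((w e * ?g e)\<^sup>2)" edges] Z
    by (auto simp: nonneg_summable_on_complete)
  ultimately have "ennreal (\<Sum>e\<in>Z. (w e * ?g e)\<^sup>2) \<le> ennreal (dirichlet_form a t)"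
    by (simp add: sum_ennreal)
  then show ?thesis using dirichlet_form_nonneg[OF env] by (simp add: ennreal_le_iff)
qed

section \<open>Heat kernel decay\<close>

text \<open>Outside the box some coordinate exceeds the integer part of \<open>R\<close> in absolute
  value, so 1 + |y| \<ge> R and the weight divided by R^k is at least 1.\<close>

lemma energy_le_sum_vbox:
  fixes a :: "'d::finite edge \<Rightarrow> real"
  assumes env: "static_environment a" and R: "1 \<le> R"
  shows "energy a 0 t \<le> (\<Sum>y\<in>vbox (nat \<lfloor>R\<rfloor>). (pkernel a t y)\<^sup>2) + energy a k t / R ^ k"
proof -
  let ?u = "pkernel a t" and ?B = "vbox (nat \<lfloor>R\<rfloor>) :: (int ^ 'd) set"
  have hs: "((\<lambda>y. if y \<in> ?B then (?u y)\<^sup>2 else 0) has_sum (\<Sum>y\<in>?B. (?u y)\<^sup>2)) UNIV"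
  proof -
    have "((\<lambda>y. (?u y)\<^sup>2) has_sum (\<Sum>y\<in>?B. (?u y)\<^sup>2)) ?B" by (intro has_sum_finiteI) auto
    also have "?this \<longleftrightarrow> ((\<lambda>y. if y \<in> ?B then (?u y)\<^sup>2 else 0) has_sum (\<Sum>y\<in>?B. (?u y)\<^sup>2)) UNIV"
      by (rule has_sum_cong_neutral) auto
    finally show ?thesis .
  qed
  have hw: "((\<lambda>y. weight k y * (?u y)\<^sup>2 * (1 / R ^ k)) has_sum energy a k t * (1 / R ^ k)) UNIV"
    unfolding energy_def by (intro has_sum_cmult_left has_sum_infsum summable_weight_kernel_power2[OF env])
  have h0: "((\<lambda>y. weight 0 y * (?u y)\<^sup>2) has_sum energy a 0 t) UNIV"
    unfolding energy_def by (intro has_sum_infsum summable_weight_kernel_power2[OF env])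
  have "energy a 0 t \<le> (\<Sum>y\<in>?B. (?u y)\<^sup>2) + energy a k t * (1 / R ^ k)"
  proof (rule has_sum_mono[OF h0 has_sum_add[OF hs hw]])
    fix y :: "int ^ 'd"
    have wR: "0 \<le> weight k y * (?u y)\<^sup>2 * (1 / R ^ k)" using weight_ge_1[of k y] R by simp
    show "weight 0 y * (?u y)\<^sup>2 \<le> (if y \<in> ?B then (?u y)\<^sup>2 else 0) + weight k y * (?u y)\<^sup>2 * (1 / R ^ k)"
    proof (cases "y \<in> ?B")
      case True
      then show ?thesis using wR by (simp add: weight_def)
    next
      case False
      then obtain i where i: "\<not> (- int (nat \<lfloor>R\<rfloor>) \<le> y $ i \<and> y $ i \<le> int (nat \<lfloor>R\<rfloor>))" by (auto simp: vbox_def)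
      have "\<bar>y $ i\<bar> \<le> l1 y" unfolding l1_def by (rule member_le_sum) auto
      moreover have "\<lfloor>R\<rfloor> < \<bar>y $ i\<bar>" using i R by (auto simp: abs_if split: if_splits)
      ultimately have "R \<le> 1 + real_of_int (l1 y)" by linarith
      then have "R ^ k \<le> weight k y" unfolding weight_def using R by (intro power_mono) auto
      then have "1 \<le> weight k y * (1 / R ^ k)" using R by simp
      then have "1 * (?u y)\<^sup>2 \<le> weight k y * (1 / R ^ k) * (?u y)\<^sup>2" by (rule mult_right_mono) simp
      then show ?thesis using False by (simp add: weight_def mult_ac)
    qed
  qed
  then show ?thesis by simp
qed

lemma pkernel_decay:
  fixes q \<delta> :: real
  assumes q: "2 \<le> q" "CARD('d) < q"
  defines "\<delta> \<equiv> 1 - CARD('d::finite) / q"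
  shows "\<exists>C>0. \<forall>(w :: 'd edge \<Rightarrow> real) a m t. static_environment a \<longrightarrow> moderate w a \<longrightarrow> moment_le q m w \<longrightarrow> 0 < t \<longrightarrow>
    pkernel a t 0 \<le> C * m powr (CARD('d) / \<delta>) * t powr (- (CARD('d) / 2))"
proof -
  define d where "d = CARD('d)"
  have d1: "1 \<le> d" by (simp add: d_def Suc_leI)
  have \<delta>: "0 < \<delta>" "\<delta> < 1" using q d1 by (auto simp: \<delta>_def d_def)
  obtain K1 where K1: "K1 \<ge> 1" and nash: "\<And>(w :: 'd edge \<Rightarrow> real) m f F W \<rho> R. moment_le q m w \<Longrightarrow>
    (\<And>Y. finite Y \<Longrightarrow> (\<Sum>y\<in>Y. \<bar>f y\<bar>) \<le> F) \<Longrightarrow>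
    (\<And>Z. finite Z \<Longrightarrow> Z \<subseteq> edges \<Longrightarrow> (\<Sum>e\<in>Z. (w e * grad_abs f e)\<^sup>2) \<le> W) \<Longrightarrow>
    1 \<le> \<rho> \<Longrightarrow> \<rho> \<le> R \<Longrightarrow>
    (\<Sum>x\<in>vbox (nat \<lfloor>R\<rfloor>). (f x)\<^sup>2) \<le> K1 * (m\<^sup>2 * \<rho> powr (2 * \<delta>) * R powr (2 - 2 * \<delta>) * W + F\<^sup>2 / \<rho> ^ d)"
    using local_nash_inequality[OF q] unfolding \<delta>_def d_def by blast
  \<comment> \<open>One constant dominating those of the Nash inequality, of the bound on the
    dissipation and of the growth of N.\<close>
  define K where "K = K1 + 4 * real d + 8 * real d ^ 3 * 16 ^ d"
  have K: "1 \<le> K" "K1 \<le> K" "4 * real d \<le> K" "8 * real d ^ 3 * 16 ^ d \<le> K"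
  proof -
    have "0 \<le> 8 * real d ^ 3 * 16 ^ d" by simp
    then show "1 \<le> K" "K1 \<le> K" "4 * real d \<le> K" "8 * real d ^ 3 * 16 ^ d \<le> K"
      using K1 unfolding K_def by linarith+
  qed
  obtain C where C: "C > 0" and ode: "\<And>E N D m.
    (\<forall>t\<ge>0. (E has_real_derivative - 2 * D t) (at t)) \<longrightarrow>
    (\<forall>t\<ge>0. \<exists>N'. (N has_real_derivative N') (at t) \<and>
        (\<forall>l>0. N' \<le> K * (N t * l powr (- 1 / d) + E t * l powr (1 - 1 / d)))) \<longrightarrow>
    E 0 = 1 \<longrightarrow> N 0 = 1 \<longrightarrow>
    (\<forall>t\<ge>0. 0 < E t \<and> E t \<le> 1 \<and> E t \<le> N t \<and> 0 \<le> D t \<and> D t \<le> K) \<longrightarrow> 0 \<le> m \<longrightarrow>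
    (\<forall>t\<ge>0. \<forall>\<rho> R. 1 \<le> \<rho> \<longrightarrow> \<rho> \<le> R \<longrightarrow>
        E t \<le> K * (m\<^sup>2 * \<rho> powr (2 * \<delta>) * R powr (2 - 2 * \<delta>) * D t + 1 / \<rho> ^ d) + N t / R ^ (2 * d)) \<longrightarrow>
    (\<forall>t>0. E t \<le> C * m powr (d / \<delta>) * t powr (- real d / 2))"
    using nash_ode[OF d1 \<delta> K(1)] by blast
  have main: "pkernel a t 0 \<le> C * 2 powr (real d / 2) * m powr (d / \<delta>) * t powr (- (real d / 2))"
    if env: "static_environment a" and mod: "moderate w a" and mom: "moment_le q m w" and t: "0 < t"
    for w a :: "'d edge \<Rightarrow> real" and m t
  proof -
    have "\<forall>t>0. energy a 0 t \<le> C * m powr (d / \<delta>) * t powr (- real d / 2)"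
    proof (rule ode[where D = "dirichlet_form a" and N = "energy a (2 * d)", THEN mp, THEN mp, THEN mp, THEN mp, THEN mp, THEN mp, THEN mp])
      show "\<forall>t\<ge>0. (energy a 0 has_real_derivative - 2 * dirichlet_form a t) (at t)"
        using DERIV_energy_0[OF env] by blast
      show "\<forall>t\<ge>0. \<exists>N'. (energy a (2 * d) has_real_derivative N') (at t) \<and>
        (\<forall>l>0. N' \<le> K * (energy a (2 * d) t * l powr (- 1 / d) + energy a 0 t * l powr (1 - 1 / d)))"
      proof (intro allI impI)
        fix t :: real assume t: "0 \<le> t"
        obtain N' where N': "(energy a (2 * d) has_real_derivative N') (at t)"
          and le: "\<And>l. l > 0 \<Longrightarrow> N' \<le> 8 * real d ^ 3 * 16 ^ d * (energy a (2 * d) t * l powr (- 1 / d) + energy a 0 t * l powr (1 - 1 / d))"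
          using energy_growth[OF env, of t] unfolding d_def by blast
        have "N' \<le> K * (energy a (2 * d) t * l powr (- 1 / d) + energy a 0 t * l powr (1 - 1 / d))" if "l > 0" for l
          using energy_pos[OF env t, of "2 * d"] energy_pos[OF env t, of 0]
          by (intro order.trans[OF le[OF that]] mult_right_mono K(4)) auto
        with N' show "\<exists>N'. (energy a (2 * d) has_real_derivative N') (at t) \<and>
          (\<forall>l>0. N' \<le> K * (energy a (2 * d) t * l powr (- 1 / d) + energy a 0 t * l powr (1 - 1 / d)))" by blast
      qed
      show "energy a 0 0 = 1" "energy a (2 * d) 0 = 1" by (rule energy_at_0[OF env])+
      show "\<forall>t\<ge>0. 0 < energy a 0 t \<and> energy a 0 t \<le> 1 \<and> energy a 0 t \<le> energy a (2 * d) t \<and> 0 \<le> dirichlet_form a t \<and> dirichlet_form a t \<le> K"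
        using energy_pos[OF env] energy_0_le_1[OF env] energy_0_le[OF env] dirichlet_form_nonneg[OF env] dirichlet_form_le[OF env] K(3)
        unfolding d_def by (meson order.trans)
      show "0 \<le> m" using mom by (simp add: moment_le_def)
      show "\<forall>t\<ge>0. \<forall>\<rho> R. 1 \<le> \<rho> \<longrightarrow> \<rho> \<le> R \<longrightarrow>
        energy a 0 t \<le> K * (m\<^sup>2 * \<rho> powr (2 * \<delta>) * R powr (2 - 2 * \<delta>) * dirichlet_form a t + 1 / \<rho> ^ d) + energy a (2 * d) t / R ^ (2 * d)"
      proof (intro allI impI)
        fix t \<rho> R :: real assume t: "0 \<le> t" and \<rho>: "1 \<le> \<rho>" "\<rho> \<le> R"
        have "(\<Sum>y\<in>vbox (nat \<lfloor>R\<rfloor>). (pkernel a t y)\<^sup>2) \<le> K1 * (m\<^sup>2 * \<rho> powr (2 * \<delta>) * R powr (2 - 2 * \<delta>) * dirichlet_form a t + 1\<^sup>2 / \<rho> ^ d)"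
        proof (rule nash[OF mom _ _ \<rho>])
          show "(\<Sum>y\<in>Y. \<bar>pkernel a t y\<bar>) \<le> 1" if "finite Y" for Y
            using sum_kernel_le[OF env t that] kernel_nonneg[OF env t] by simp
        qed (rule moderate_sum_le[OF env mod t])
        also have "\<dots> \<le> K * (m\<^sup>2 * \<rho> powr (2 * \<delta>) * R powr (2 - 2 * \<delta>) * dirichlet_form a t + 1\<^sup>2 / \<rho> ^ d)"
          using \<rho> dirichlet_form_nonneg[OF env, of t] by (intro mult_right_mono K(2)) auto
        finally show "energy a 0 t \<le> K * (m\<^sup>2 * \<rho> powr (2 * \<delta>) * R powr (2 - 2 * \<delta>) * dirichlet_form a t + 1 / \<rho> ^ d) + energy a (2 * d) t / R ^ (2 * d)"
          using energy_le_sum_vbox[OF env, of R t "2 * d"] \<rho> by simp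
      qed
    qed
    then have "energy a 0 (t / 2) \<le> C * m powr (d / \<delta>) * (t / 2) powr (- real d / 2)" using t by simp
    also have "(t / 2) powr (- real d / 2) = 2 powr (real d / 2) * t powr (- (real d / 2))"
      using t by (simp add: powr_divide powr_minus field_simps)
    finally show ?thesis by (simp add: energy_0_eq_kernel[OF env] mult_ac)
  qed
  show ?thesis
  proof (intro exI[of _ "C * 2 powr (real d / 2)"] conjI allI impI)
    show "0 < C * 2 powr (real d / 2)" using C by simp
    fix w a :: "'d edge \<Rightarrow> real" and m t :: real
    assume "static_environment a" "moderate w a" "moment_le q m w" "0 < t"
    then show "pkernel a t 0 \<le> C * 2 powr (real d / 2) * m powr (CARD('d) / \<delta>) * t powr (- (CARD('d) / 2))"
      unfolding d_def[symmetric] by (rule main)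
  qed
qed

section \<open>Moments and exponents\<close>

lemma edge_in_some_box:
  assumes "e \<in> (edges :: 'd::finite edge set)"
  shows "\<exists>r\<ge>1. e \<in> box_edges r"
proof -
  obtain y i where e: "e = edge_at y i" using assms by (rule edgesE)
  define r where "r = nat (l1 y + 1)"
  have "\<bar>y $ j\<bar> \<le> l1 y" for j unfolding l1_def by (rule member_le_sum) auto
  then have j: "\<bar>y $ j\<bar> + 1 \<le> int r" for j using l1_nonneg[of y] by (simp add: r_def)
  have "- int r \<le> y $ k \<and> y $ k \<le> int r \<and> - int r \<le> (y + axis i 1) $ k \<and> (y + axis i 1) $ k \<le> int r" for k
    using j[of k] by (auto simp: axis_def abs_if split: if_splits)
  then have "e \<subseteq> vbox r" by (auto simp: e edge_at_def vbox_def)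
  moreover have "r \<ge> 1" using l1_nonneg[of y] unfolding r_def by linarith
  ultimately show ?thesis using assms by (auto simp: box_edges_def)
qed

lemma box_edges_nonempty:
  assumes "1 \<le> r"
  shows "card (box_edges r :: 'd::finite edge set) > 0"
proof -
  have "0 \<in> vbox r" "0 + axis (undefined :: 'd) 1 \<in> vbox r" using assms by (auto simp: vbox_def axis_def)
  then have "edge_at 0 (undefined :: 'd) \<in> box_edges r" unfolding box_edges_eq by blast
  then show ?thesis using finite_box_edges card_gt_0_iff by blast
qed

text \<open>Every edge lies in some box, so a zero of \<open>w\<close> would make that average, and
  hence the moment, infinite. Finiteness forces positivity, after which all terms are real
  numbers.\<close>

lemma moment_le_real:
  assumes q: "1 < q" and w: "\<forall>e\<in>edges. 0 \<le> w e" and fin: "moment (ereal q) w \<noteq> \<infinity>"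
  shows "moment_le q (enn2real (moment (ereal q) w)) (w :: 'd::finite edge \<Rightarrow> real)"
proof -
  define A where "A r = (\<Sum>e\<in>box_edges r. epowr (inverse (ennreal (w e))) q) / of_nat (card (box_edges r :: 'd edge set))" for r
  define S where "S = (SUP r\<in>{1..}. A r)"
  have mom: "moment (ereal q) w = epowr S (1 / q)" by (simp add: moment_def S_def A_def)
  then have S: "S \<noteq> \<infinity>" using fin by (auto simp: epowr_def)
  then have m: "enn2real (moment (ereal q) w) = enn2real S powr (1 / q)" by (simp add: mom epowr_def)
  have AS: "(\<Sum>e\<in>box_edges r. epowr (inverse (ennreal (w e))) q) \<le> S * of_nat (card (box_edges r :: 'd edge set))" if "1 \<le> r" for r
  proof -
    have "A r \<le> S" unfolding S_def using that by (intro SUP_upper) auto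
    then have "A r * of_nat (card (box_edges r :: 'd edge set)) \<le> S * of_nat (card (box_edges r :: 'd edge set))"
      by (intro mult_right_mono) auto
    moreover have "card (box_edges r :: 'd edge set) \<noteq> 0"
      using box_edges_nonempty[OF that, where 'd = 'd] by linarith
    then have "of_nat (card (box_edges r :: 'd edge set)) / of_nat (card (box_edges r :: 'd edge set)) = (1 :: ennreal)"
      unfolding ennreal_of_nat_eq_real_of_nat
      by (intro ennreal_divide_self) (simp_all only: ennreal_eq_zero_iff of_nat_0_le_iff of_nat_eq_0_iff ennreal_less_top not_False_eq_True)
    then have "A r * of_nat (card (box_edges r :: 'd edge set)) = (\<Sum>e\<in>box_edges r. epowr (inverse (ennreal (w e))) q)"
      unfolding A_def ennreal_divide_times by (simp only: mult_1_right)
    ultimately show ?thesis by simp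
  qed
  have pos: "0 < w e" if e: "e \<in> edges" for e
  proof (rule ccontr)
    assume "\<not> 0 < w e"
    then have "w e = 0" using w e by auto
    then have inf: "epowr (inverse (ennreal (w e))) q = \<infinity>" by (simp add: epowr_def)
    obtain r where r: "1 \<le> r" "e \<in> box_edges r" using edge_in_some_box[OF e] by auto
    have "epowr (inverse (ennreal (w e))) q \<le> (\<Sum>e\<in>box_edges r. epowr (inverse (ennreal (w e))) q)"
      using r by (intro member_le_sum) auto
    also note AS[OF r(1)]
    finally have "\<infinity> \<le> S * of_nat (card (box_edges r :: 'd edge set))" by (simp only: inf)
    moreover have "S * of_nat (card (box_edges r :: 'd edge set)) < \<infinity>"
      using S by (simp add: ennreal_mult_less_top less_top ennreal_of_nat_eq_real_of_nat)
    ultimately show False by simp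
  qed
  have ep: "epowr (inverse (ennreal (w e))) q = ennreal ((1 / w e) powr q)" if "e \<in> edges" for e
    using pos[OF that] by (simp add: epowr_def inverse_ennreal divide_inverse)
  have "(\<Sum>e\<in>box_edges r. (1 / w e) powr q) \<le> (enn2real S powr (1 / q)) powr q * card (box_edges r :: 'd edge set)" if r: "1 \<le> r" for r
  proof -
    have "ennreal (\<Sum>e\<in>box_edges r. (1 / w e) powr q) = (\<Sum>e\<in>box_edges r. epowr (inverse (ennreal (w e))) q)"
      by (subst sum_ennreal[symmetric]) (auto intro!: sum.cong simp: ep box_edges_def)
    also have "\<dots> \<le> S * of_nat (card (box_edges r :: 'd edge set))" by (rule AS[OF r])
    also have "S * of_nat (card (box_edges r :: 'd edge set)) = ennreal (enn2real S * card (box_edges r :: 'd edge set))"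
      using S by (cases S) (auto simp: ennreal_mult ennreal_of_nat_eq_real_of_nat)
    finally have "(\<Sum>e\<in>box_edges r. (1 / w e) powr q) \<le> enn2real S * card (box_edges r :: 'd edge set)"
      by (subst (asm) ennreal_le_iff) auto
    then show ?thesis using q by (simp add: powr_powr)
  qed
  then show ?thesis unfolding moment_le_def m using pos by auto
qed

text \<open>The power mean inequality in each box; the powers n^(1 - s / q) and n^(s / q) of the
  number n of edges recombine to n.\<close>

lemma moment_le_mono:
  assumes "moment_le q m w" "0 < s" "s \<le> q"
  shows "moment_le s m (w :: 'd::finite edge \<Rightarrow> real)"
  unfolding moment_le_def
proof (intro conjI allI impI)
  show m: "0 \<le> m" and "\<forall>e\<in>edges. 0 < w e" using assms by (auto simp: moment_le_def)
  then have w: "0 < w e" if "e \<in> box_edges r" for e r using that by (auto simp: box_edges_def)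
  fix r :: nat assume r: "1 \<le> r"
  define n where "n = real (card (box_edges r :: 'd edge set))"
  have n: "n > 0" using box_edges_nonempty[OF r, where 'd = 'd] by (simp add: n_def)
  have "(\<Sum>e\<in>box_edges r. (1 / w e) powr s) \<le> n powr (1 - s / q) * (\<Sum>e\<in>box_edges r. (1 / w e) powr q) powr (s / q)"
    unfolding n_def using w assms by (intro power_mean) (auto simp: less_imp_le)
  also have "\<dots> \<le> n powr (1 - s / q) * (m powr q * n) powr (s / q)"
    using assms r by (intro mult_left_mono powr_mono2) (auto simp: moment_le_def n_def intro!: sum_nonneg)
  also have "\<dots> = m powr s * (n powr (1 - s / q) * n powr (s / q))"
    using assms m n by (simp add: powr_mult powr_powr)
  also have "n powr (1 - s / q) * n powr (s / q) = n" using n by (simp flip: powr_add)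
  finally show "(\<Sum>e\<in>box_edges r. (1 / w e) powr s) \<le> m powr s * card (box_edges r :: 'd edge set)" by (simp add: n_def)
qed

lemma moment_le_infinity:
  assumes s: "0 < s" and w: "\<forall>e\<in>edges. 0 \<le> w e" and fin: "moment \<infinity> w \<noteq> \<infinity>"
  shows "moment_le s (enn2real (moment \<infinity> w)) (w :: 'd::finite edge \<Rightarrow> real)"
proof -
  define S where "S = (SUP e\<in>edges. inverse (ennreal (w e)))"
  have mom: "moment \<infinity> w = S" by (simp add: moment_def S_def)
  have S: "S \<noteq> \<infinity>" using fin by (simp add: mom)
  have le: "inverse (ennreal (w e)) \<le> S" if "e \<in> edges" for e unfolding S_def using that by (rule SUP_upper)
  have pos: "0 < w e" if "e \<in> edges" for e
  proof (rule ccontr)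
    assume "\<not> 0 < w e"
    then have "w e = 0" using w that by auto
    then show False using le[OF that] S by (simp add: top_unique)
  qed
  have wS: "1 / w e \<le> enn2real S" if "e \<in> edges" for e
  proof -
    have "ennreal (1 / w e) \<le> S" using le[OF that] pos[OF that] by (simp add: inverse_ennreal divide_inverse)
    then show ?thesis using S by (cases S) (auto simp: ennreal_le_iff)
  qed
  have "(\<Sum>e\<in>box_edges r. (1 / w e) powr s) \<le> (\<Sum>e\<in>(box_edges r :: 'd edge set). enn2real S powr s)" for r
    using s pos wS by (intro sum_mono powr_mono2) (auto simp: box_edges_def less_imp_le)
  then show ?thesis unfolding moment_le_def mom using pos by (simp add: mult.commute)
qed

text \<open>The exponent \<open>r\<close> solves 1 / \<theta> = 1 + \<kappa> (r / d - 1), so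
  \<open>\<theta>\<close> is critical for it. As \<kappa> = p (d + 2) / (d (p + 2)), both sides of
  the second claim equal d + d \<kappa> \<theta> / (1 - \<theta>). The third claim holds because the
  critical value decreases as the exponent grows.\<close>

lemma exponent_at_critical:
  fixes d p \<theta> :: real
  assumes d: "0 < d" and p: "0 < p" and \<theta>: "0 < \<theta>" "\<theta> < 1"
  defines "r \<equiv> d * (1 + (1 / \<theta> - 1) / ((d * p + 2 * p) / (d * p + 2 * d)))"
  shows "d < r"
    and "2 * ((1 - \<theta>) * (d / (d + 2)) + \<theta> * (p / (p + 2))) / ((1 - \<theta>) * (2 / (d + 2))) = d / (1 - d / r)"
    and "1 / (1 + (d * p + 2 * p) / (d * p + 2 * d) * (s / d - 1)) \<le> \<theta> \<Longrightarrow> d < s \<Longrightarrow> r \<le> s"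
proof -
  define \<kappa> where "\<kappa> = (d * p + 2 * p) / (d * p + 2 * d)"
  define x where "x = (1 / \<theta> - 1) / \<kappa>"
  have \<kappa>: "\<kappa> > 0" using d p by (simp add: \<kappa>_def add_pos_pos)
  have x: "x > 0" using \<kappa> \<theta> by (simp add: x_def)
  have r: "r = d * (1 + x)" by (simp add: r_def x_def \<kappa>_def)
  show "d < r" using d x by (simp add: r)
  have "d / (1 - d / r) = d * (1 + x) / x"
  proof -
    have "d / r = 1 / (1 + x)" using d by (simp add: r)
    moreover have "1 - 1 / (1 + x) = x / (1 + x)" using x by (simp add: field_simps)
    ultimately show ?thesis by simp
  qed
  also have "\<dots> = d + d * (\<kappa> * \<theta> / (1 - \<theta>))"
    using \<kappa> \<theta> d by (simp add: x_def field_simps)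
  also have "\<kappa> = p * (d + 2) / (d * (p + 2))" by (simp add: \<kappa>_def algebra_simps)
  also have "d + d * (p * (d + 2) / (d * (p + 2)) * \<theta> / (1 - \<theta>)) = 2 * ((1 - \<theta>) * (d / (d + 2)) + \<theta> * (p / (p + 2))) / ((1 - \<theta>) * (2 / (d + 2)))"
  proof -
    have nz: "1 - \<theta> \<noteq> 0" "d + 2 \<noteq> 0" "p + 2 \<noteq> 0" "d \<noteq> 0" using \<theta> d p by auto
    then show ?thesis by (simp add: divide_simps) (simp add: algebra_simps)
  qed
  finally show "2 * ((1 - \<theta>) * (d / (d + 2)) + \<theta> * (p / (p + 2))) / ((1 - \<theta>) * (2 / (d + 2))) = d / (1 - d / r)" ..
  assume le: "1 / (1 + (d * p + 2 * p) / (d * p + 2 * d) * (s / d - 1)) \<le> \<theta>" and s: "d < s"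
  have pos: "0 < 1 + \<kappa> * (s / d - 1)" using \<kappa> s d by (intro add_pos_pos mult_pos_pos) (auto simp: field_simps)
  have "1 / (1 + \<kappa> * (s / d - 1)) \<le> \<theta>" using le by (simp add: \<kappa>_def)
  then have "1 / \<theta> \<le> 1 + \<kappa> * (s / d - 1)" using pos \<theta> by (simp add: field_simps)
  then have "x \<le> s / d - 1" using \<kappa> by (simp add: x_def field_simps)
  then have "d * (1 + x) \<le> d * (s / d)" using d by (intro mult_left_mono) auto
  then show "r \<le> s" using d by (simp add: r)
qed

theorem theorem3p2:
  fixes d :: nat and p :: real and q :: ereal and \<theta> \<alpha> \<beta> \<gamma> :: real
  assumes "CARD('d::finite) = d" and "d \<ge> 2"
    and "p > real d" and "q > ereal (real d)"
    and "\<theta> \<in> {theta_crit d p q .. 1}"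
    and "\<alpha> = (1 - \<theta>) * (real d / (real d + 2)) + \<theta> * (p / (p + 2))"
    and "\<beta> = (1 - \<theta>) * (2 / (real d + 2))"
    and "\<gamma> = \<theta> * (2 / (p + 2))"
    and "\<alpha> \<in> {0<..<1}" and "\<beta> \<in> {0<..<1}" and "\<gamma> \<in> {0<..<1}"
  shows "\<exists>C::real. C > 0 \<and>
    (\<forall>(w :: 'd edge \<Rightarrow> real) (a :: 'd edge \<Rightarrow> real).
       (\<forall>e\<in>edges. 0 \<le> w e) \<longrightarrow> static_environment a \<longrightarrow> moderate w a \<longrightarrow>
       (\<forall>t\<ge>1. ennreal (heat_kernel a t 0 0)
                 \<le> ennreal C * epowr (moment q w) (2 * \<alpha> / \<beta>) / ennreal (t powr (real d / 2))))"
proof -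
  have d: "0 < real d" "2 \<le> real d" and p: "0 < p" using assms(2,3) by auto
  \<comment> \<open>Positivity of \<open>\<gamma>\<close> excludes \<theta> = 0, also for infinite
    \<open>q\<close>, and positivity of \<open>\<beta>\<close> excludes \<theta> = 1. Hence the
    exponent \<open>r\<close> below is finite and larger than d.\<close>
  have \<theta>: "0 < \<theta>" "\<theta> < 1"
  proof -
    show "0 < \<theta>" using assms(8,11) p by (simp add: zero_less_mult_iff zero_less_divide_iff)
    have "0 < (1 - \<theta>) * (2 / (real d + 2))" using assms(7,10) by simp
    then show "\<theta> < 1" using d(1) by (simp add: zero_less_mult_iff zero_less_divide_iff)
  qed
  define r where "r = real d * (1 + (1 / \<theta> - 1) / ((real d * p + 2 * p) / (real d * p + 2 * real d)))"
  note crit = exponent_at_critical[OF d(1) p \<theta>, folded r_def]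
  have r: "real d < r" "2 \<le> r" "CARD('d) < r" using crit(1) d assms(1) by auto
  define \<sigma> where "\<sigma> = real d / (1 - real d / r)"
  have \<sigma>: "2 * \<alpha> / \<beta> = \<sigma>" unfolding assms(6,7) \<sigma>_def by (rule crit(2))
  obtain C where C: "C > 0" and decay: "\<And>(w :: 'd edge \<Rightarrow> real) a m t. static_environment a \<Longrightarrow> moderate w a \<Longrightarrow> moment_le r m w \<Longrightarrow> 0 < t \<Longrightarrow>
    pkernel a t 0 \<le> C * m powr \<sigma> * t powr (- (real d / 2))"
    using pkernel_decay[OF r(2,3)] unfolding \<sigma>_def assms(1) by blast
  have mom: "moment_le r (enn2real (moment q w)) w"
    if w: "\<forall>e\<in>edges. 0 \<le> w e" and fin: "moment q w \<noteq> \<infinity>" for w :: "'d edge \<Rightarrow> real"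
  \<comment> \<open>A finite \<open>q\<close> is at least \<open>r\<close>, so its moment bound
    passes down to \<open>r\<close>; for infinite \<open>q\<close> the supremum of 1 / w bounds
    every average.\<close>
  proof (cases q)
    case (real s)
    have s: "real d < s" using assms(4) real by simp
    have "1 / (1 + (real d * p + 2 * p) / (real d * p + 2 * real d) * (s / real d - 1)) \<le> \<theta>"
      using assms(5) real by (simp add: theta_crit_def)
    then have "r \<le> s" using s by (rule crit(3))
    moreover have "moment_le s (enn2real (moment q w)) w"
    proof -
      have "1 < s" using s d by linarith
      moreover have "moment (ereal s) w \<noteq> \<infinity>" using fin unfolding real .
      ultimately show ?thesis unfolding real using w by (intro moment_le_real)
    qed
    moreover have "0 < r" using r by linarith
    ultimately show ?thesis by (rule moment_le_mono[rotated 2])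
  next
    case PInf
    have "0 < r" using r by linarith
    moreover have "moment \<infinity> w \<noteq> \<infinity>" using fin unfolding PInf .
    ultimately show ?thesis unfolding PInf using w by (intro moment_le_infinity)
  next
    case MInf
    then show ?thesis using assms(4) by simp
  qed
  show ?thesis
  proof (intro exI[of _ C] conjI C allI impI)
    fix w a :: "'d edge \<Rightarrow> real" and t :: real
    assume w: "\<forall>e\<in>edges. 0 \<le> w e" and env: "static_environment a" and mod: "moderate w a" and t: "1 \<le> t"
    have tp: "0 < t powr (real d / 2)" using t by simp
    show "ennreal (heat_kernel a t 0 0) \<le> ennreal C * epowr (moment q w) (2 * \<alpha> / \<beta>) / ennreal (t powr (real d / 2))"
    proof (cases "moment q w = \<infinity>")
      case True
      then have "ennreal C * epowr (moment q w) (2 * \<alpha> / \<beta>) / ennreal (t powr (real d / 2)) = \<infinity>"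
        using C tp by (simp add: epowr_def ennreal_mult_top ennreal_top_divide)
      then show ?thesis by simp
    next
      case False
      have "0 \<le> t" using t by linarith
      then have "heat_kernel a t 0 0 = pkernel a t 0" by (simp only: heat_kernel_eq_pkernel[OF env])
      also have "\<dots> \<le> C * enn2real (moment q w) powr \<sigma> * t powr (- (real d / 2))"
        by (rule decay[OF env mod mom[OF w False]]) (use t in linarith)
      also have "\<dots> = C * enn2real (moment q w) powr \<sigma> / t powr (real d / 2)"
        by (simp only: powr_minus_divide times_divide_eq_right mult_1_right)
      finally have "ennreal (heat_kernel a t 0 0) \<le> ennreal (C * enn2real (moment q w) powr \<sigma> / t powr (real d / 2))"
        by (rule ennreal_leI)
      also have "\<dots> = ennreal C * epowr (moment q w) (2 * \<alpha> / \<beta>) / ennreal (t powr (real d / 2))"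
        using C tp False by (simp add: epowr_def \<sigma> divide_ennreal flip: ennreal_mult)
      finally show ?thesis .
    qed
  qed
qed

end
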